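(* Let $G$ be a simply connected Lie group of dimension $n$ equipped with a left invariant affine structure $\nabla$, and let $\theta$ be the linear part of the corresponding affine action of $G$. Then there exists a left invariant integrable complex structure $I$ on the group $G\ltimes_\theta\mathbb{R}^n\simeq TG$ such that $I$ swaps the vertical and horizontal tangent subbundles.
   Context: A left invariant affine structure on a Lie group $G$ is a left invariant flat torsion-free connection $\nabla$ on $TG$. Let $\mathfrak{g}$ be the Lie algebra of $G$ (left invariant vector fields); for $X\in\mathfrak{g}$, $\nabla_X$ is regarded as a linear endomorphism of $\mathfrak{g}$. Fix a linear identification $i:\mathfrak{g}\to\mathbb{R}^n$. The connection $\nabla$ defines a Lie algebra representation $\eta:\mathfrak{g}\to\mathfrak{aff}(\mathbb{R}^n)=\mathfrak{gl}(\mathbb{R}^n)\ltimes\mathbb{R}^n$, $\eta(X)=\begin{pmatrix}\nabla_X & X\\ 0&0\end{pmatrix}$, which integrates to an affine representation (affine action) $G\to\mathrm{Aff}(\mathbb{R}^n)=\mathrm{GL}(\mathbb{R}^n)\ltimes\mathbb{R}^n$; its linear part is a homomorphism $\theta:G\to\mathrm{GL}(\mathbb{R}^n)$. The group $G\ltimes_\theta\mathbb{R}^n$ has multiplication $(g_1,v_1)(g_2,v_2)=(g_1g_2,\,v_1+\theta(g_1)v_2)$. The identification $TG\simeq G\times\mathbb{R}^n=G\ltimes_\theta\mathbb{R}^n$ is given by the trivialization of $TG$ by $\nabla$-parallel vector fields. Vertical tangent vectors to $TG$ are those in $\ker d\pi$, where $\pi:TG\to G$ is the projection; the horizontal subbundle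 is the one defined by the flat connection $\nabla$, i.e. the tangent spaces to the slices $G\times\{v\}$ in this trivialization. *)

theory Defs
  imports
    "HOL-Analysis.Analysis"
    "HOL-Algebra.Group"
    "HOL-Library.Function_Algebras"
begin

section \<open>Smooth maps between Euclidean spaces\<close>

text \<open>These are meant for open sets \<open>S\<close> and finite-dimensional domains, where continuity of
  all directional derivatives is the same as continuity of the total derivative.\<close>

primrec Ck_on :: "nat \<Rightarrow> 'a::real_normed_vector set \<Rightarrow> ('a \<Rightarrow> 'b::real_normed_vector) \<Rightarrow> bool" where
  "Ck_on 0 S f \<longleftrightarrow> continuous_on S f"
| "Ck_on (Suc k) S f \<longleftrightarrow> (\<forall>x\<in>S. f differentiable (at x)) \<and>
     (\<forall>v. Ck_on k S (\<lambda>x. frechet_derivative f (at x) v))"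

definition smooth_on :: "'a::real_normed_vector set \<Rightarrow> ('a \<Rightarrow> 'b::real_normed_vector) \<Rightarrow> bool" where
  "smooth_on S f \<longleftrightarrow> (\<forall>k. Ck_on k S f)"


section \<open>Smooth manifolds\<close>

text \<open>A chart is a pair of its domain and a map that is only relevant on this domain. The atlas
  is not required to be maximal. The points of the manifold form the set \<open>topspace (mtop M)\<close>.\<close>

record ('m, 'e) mfd =
  mtop :: "'m topology"
  atlas :: "('m set \<times> ('m \<Rightarrow> 'e)) set"

definition smooth_manifold :: "('m, 'e::euclidean_space) mfd \<Rightarrow> bool" where
  "smooth_manifold M \<longleftrightarrow>
     Hausdorff_space (mtop M) \<and> second_countable (mtop M) \<and>
     topspace (mtop M) = \<Union> (fst ` atlas M) \<and>
     (\<forall>(U, \<phi>) \<in> atlas M. openin (mtop M) U \<and> open (\<phi> ` U) \<and>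
        homeomorphic_map (subtopology (mtop M) U) (top_of_set (\<phi> ` U)) \<phi>) \<and>
     (\<forall>(U, \<phi>) \<in> atlas M. \<forall>(V, \<psi>) \<in> atlas M.
        smooth_on (\<phi> ` (U \<inter> V)) (\<psi> \<circ> inv_into U \<phi>))"

definition prod_mfd :: "('m, 'e) mfd \<Rightarrow> ('k, 'f) mfd \<Rightarrow> ('m \<times> 'k, 'e \<times> 'f) mfd" where
  "prod_mfd M N = \<lparr> mtop = prod_topology (mtop M) (mtop N),
     atlas = {(U \<times> V, \<lambda>(x, y). (\<phi> x, \<psi> y)) | U \<phi> V \<psi>. (U, \<phi>) \<in> atlas M \<and> (V, \<psi>) \<in> atlas N} \<rparr>"

definition euclidean_mfd :: "('e::euclidean_space, 'e) mfd" where
  "euclidean_mfd = \<lparr> mtop = euclidean, atlas = {(UNIV, \<lambda>x. x)} \<rparr>"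

definition smooth_map ::
  "('m, 'e::euclidean_space) mfd \<Rightarrow> ('k, 'f::euclidean_space) mfd \<Rightarrow> ('m \<Rightarrow> 'k) \<Rightarrow> bool" where
  "smooth_map M N F \<longleftrightarrow> continuous_map (mtop M) (mtop N) F \<and>
     (\<forall>(U, \<phi>) \<in> atlas M. \<forall>(V, \<psi>) \<in> atlas N.
        smooth_on (\<phi> ` (U \<inter> F -` V)) (\<psi> \<circ> F \<circ> inv_into U \<phi>))"

definition diffeomorphism ::
  "('m, 'e::euclidean_space) mfd \<Rightarrow> ('k, 'f::euclidean_space) mfd \<Rightarrow> ('m \<Rightarrow> 'k) \<Rightarrow> bool" where
  "diffeomorphism M N F \<longleftrightarrow> smooth_map M N F \<and>
     (\<exists>H. smooth_map N M H \<and> (\<forall>x \<in> topspace (mtop M). H (F x) = x) \<and>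
          (\<forall>y \<in> topspace (mtop N). F (H y) = y))"

definition smooth_fun_on ::
  "('m, 'e::euclidean_space) mfd \<Rightarrow> 'm set \<Rightarrow> ('m \<Rightarrow> 'b::real_normed_vector) \<Rightarrow> bool" where
  "smooth_fun_on M W f \<longleftrightarrow> (\<forall>(U, \<phi>) \<in> atlas M. smooth_on (\<phi> ` (U \<inter> W)) (f \<circ> inv_into U \<phi>))"

definition smooth_near ::
  "('m, 'e::euclidean_space) mfd \<Rightarrow> 'm \<Rightarrow> ('m \<Rightarrow> 'b::real_normed_vector) \<Rightarrow> bool" where
  "smooth_near M p f \<longleftrightarrow> (\<exists>W. openin (mtop M) W \<and> p \<in> W \<and> smooth_fun_on M W f)"

text \<open>The library predicate \<open>simply_connected\<close>, transcribed from subsets of a type with a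
  topology to abstract topologies: any two loops are freely homotopic through loops.\<close>

definition simply_connected_space :: "'a topology \<Rightarrow> bool" where
  "simply_connected_space X \<longleftrightarrow>
     (\<forall>p q. pathin X p \<and> p 1 = p 0 \<and> pathin X q \<and> q 1 = q 0 \<longrightarrow>
        homotopic_with (\<lambda>r. r 1 = r 0) (top_of_set {0..1}) X p q)"


section \<open>Tangent vectors and vector fields\<close>

text \<open>Tangent vectors at \<open>p\<close> are derivations of the algebra of germs of smooth functions at \<open>p\<close>.
  So that equality of tangent vectors is equality of functions, a derivation takes the value 0
  on functions that are not smooth near \<open>p\<close>. Vector fields vanish outside of the manifold for the
  same reason.\<close>

type_synonym 'm tvec = "('m \<Rightarrow> real) \<Rightarrow> real"

definition tangent_space :: "('m, 'e::euclidean_space) mfd \<Rightarrow> 'm \<Rightarrow> 'm tvec set" where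
  "tangent_space M p = {\<xi>.
     (\<forall>f h. smooth_near M p f \<and> smooth_near M p h \<longrightarrow>
        \<xi> (\<lambda>x. f x + h x) = \<xi> f + \<xi> h \<and>
        \<xi> (\<lambda>x. f x * h x) = \<xi> f * h p + f p * \<xi> h) \<and>
     (\<forall>c f. smooth_near M p f \<longrightarrow> \<xi> (\<lambda>x. c * f x) = c * \<xi> f) \<and>
     (\<forall>f h W. smooth_near M p f \<and> smooth_near M p h \<and> openin (mtop M) W \<and> p \<in> W \<and>
        (\<forall>x\<in>W. f x = h x) \<longrightarrow> \<xi> f = \<xi> h) \<and>
     (\<forall>f. \<not> smooth_near M p f \<longrightarrow> \<xi> f = 0)}"

text \<open>The differential at \<open>p\<close> of a smooth map \<open>F\<close> into \<open>N\<close>.\<close>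

definition differential ::
  "('k, 'f::euclidean_space) mfd \<Rightarrow> ('m \<Rightarrow> 'k) \<Rightarrow> 'm \<Rightarrow> 'm tvec \<Rightarrow> 'k tvec" where
  "differential N F p \<xi> = (\<lambda>f. if smooth_near N (F p) f then \<xi> (f \<circ> F) else 0)"

definition dir_deriv :: "'m tvec \<Rightarrow> ('m \<Rightarrow> 'b::euclidean_space) \<Rightarrow> 'b" where
  "dir_deriv \<xi> F = (\<Sum>b\<in>Basis. \<xi> (\<lambda>x. F x \<bullet> b) *\<^sub>R b)"

type_synonym 'm vfield = "'m \<Rightarrow> 'm tvec"

definition vector_fields :: "('m, 'e::euclidean_space) mfd \<Rightarrow> 'm vfield set" where
  "vector_fields M = {X.
     (\<forall>p \<in> topspace (mtop M). X p \<in> tangent_space M p) \<and>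
     (\<forall>p. p \<notin> topspace (mtop M) \<longrightarrow> X p = 0) \<and>
     (\<forall>W f. openin (mtop M) W \<and> smooth_fun_on M W f \<longrightarrow> smooth_fun_on M W (\<lambda>p. X p f))}"

definition scale_field :: "('m \<Rightarrow> real) \<Rightarrow> 'm vfield \<Rightarrow> 'm vfield" where
  "scale_field f X = (\<lambda>p h. f p * X p h)"

definition lie_bracket :: "('m, 'e::euclidean_space) mfd \<Rightarrow> 'm vfield \<Rightarrow> 'm vfield \<Rightarrow> 'm vfield" where
  "lie_bracket M X Y = (\<lambda>p f.
     if smooth_near M p f then X p (\<lambda>q. Y q f) - Y p (\<lambda>q. X q f) else 0)"

definition tangent_bundle ::
  "('m, 'e::euclidean_space) mfd \<Rightarrow> ('m \<times> 'm tvec, 'e \<times> 'e) mfd" where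
  "tangent_bundle M = (let
     A = {(SIGMA p : U. tangent_space M p, \<lambda>(p, \<xi>). (\<phi> p, dir_deriv \<xi> \<phi>)) | U \<phi>. (U, \<phi>) \<in> atlas M}
   in \<lparr> mtop = topology_generated_by {W \<inter> \<kappa> -` S | W \<kappa> S. (W, \<kappa>) \<in> A \<and> open S}, atlas = A \<rparr>)"


section \<open>Connections on the tangent bundle\<close>

type_synonym 'm connection = "'m vfield \<Rightarrow> 'm vfield \<Rightarrow> 'm vfield"

definition affine_connection :: "('m, 'e::euclidean_space) mfd \<Rightarrow> 'm connection \<Rightarrow> bool" where
  "affine_connection M nab \<longleftrightarrow>
     (\<forall>X \<in> vector_fields M. \<forall>Y \<in> vector_fields M. nab X Y \<in> vector_fields M) \<and>
     (\<forall>X \<in> vector_fields M. \<forall>Y \<in> vector_fields M. \<forall>Z \<in> vector_fields M.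
        nab (X + Y) Z = nab X Z + nab Y Z \<and> nab X (Y + Z) = nab X Y + nab X Z) \<and>
     (\<forall>X \<in> vector_fields M. \<forall>Y \<in> vector_fields M. \<forall>f. smooth_fun_on M (topspace (mtop M)) f \<longrightarrow>
        nab (scale_field f X) Y = scale_field f (nab X Y) \<and>
        nab X (scale_field f Y) = scale_field (\<lambda>p. X p f) Y + scale_field f (nab X Y))"

definition torsion_free :: "('m, 'e::euclidean_space) mfd \<Rightarrow> 'm connection \<Rightarrow> bool" where
  "torsion_free M nab \<longleftrightarrow> (\<forall>X \<in> vector_fields M. \<forall>Y \<in> vector_fields M.
     nab X Y - nab Y X = lie_bracket M X Y)"

definition flat :: "('m, 'e::euclidean_space) mfd \<Rightarrow> 'm connection \<Rightarrow> bool" where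
  "flat M nab \<longleftrightarrow> (\<forall>X \<in> vector_fields M. \<forall>Y \<in> vector_fields M. \<forall>Z \<in> vector_fields M.
     nab X (nab Y Z) - nab Y (nab X Z) = nab (lie_bracket M X Y) Z)"

definition vertical_space ::
  "('m, 'e::euclidean_space) mfd \<Rightarrow> 'm \<times> 'm tvec \<Rightarrow> ('m \<times> 'm tvec) tvec set" where
  "vertical_space M x = {\<zeta> \<in> tangent_space (tangent_bundle M) x. differential M fst x \<zeta> = 0}"

text \<open>The horizontal space of a connection at \<open>(p, \<xi>)\<close> consists of the tangent vectors
  \<open>dY(w)\<close> for those sections \<open>Y\<close> of the tangent bundle through \<open>(p, \<xi>)\<close> that are parallel at \<open>p\<close>.
  If the bundle is trivialized by parallel fields, then these are the tangent vectors of
  the slices of the trivialization.\<close>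

definition horizontal_space ::
  "('m, 'e::euclidean_space) mfd \<Rightarrow> 'm connection \<Rightarrow> 'm \<times> 'm tvec \<Rightarrow> ('m \<times> 'm tvec) tvec set" where
  "horizontal_space M nab x =
     {differential (tangent_bundle M) (\<lambda>q. (q, Y q)) (fst x) w | Y w.
        Y \<in> vector_fields M \<and> Y (fst x) = snd x \<and>
        (\<forall>Z \<in> vector_fields M. nab Z Y (fst x) = 0) \<and> w \<in> tangent_space M (fst x)}"


section \<open>Almost complex structures\<close>

definition apply_field ::
  "('m, 'e::euclidean_space) mfd \<Rightarrow> ('m \<Rightarrow> 'm tvec \<Rightarrow> 'm tvec) \<Rightarrow> 'm vfield \<Rightarrow> 'm vfield" where
  "apply_field M J X = (\<lambda>p. if p \<in> topspace (mtop M) then J p (X p) else 0)"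

definition almost_complex_structure ::
  "('m, 'e::euclidean_space) mfd \<Rightarrow> ('m \<Rightarrow> 'm tvec \<Rightarrow> 'm tvec) \<Rightarrow> bool" where
  "almost_complex_structure M J \<longleftrightarrow>
     (\<forall>p \<in> topspace (mtop M). \<forall>\<xi> \<in> tangent_space M p.
        J p \<xi> \<in> tangent_space M p \<and> J p (J p \<xi>) = - \<xi> \<and>
        (\<forall>\<zeta> \<in> tangent_space M p. J p (\<xi> + \<zeta>) = J p \<xi> + J p \<zeta>) \<and>
        (\<forall>c. J p (\<lambda>f. c * \<xi> f) = (\<lambda>f. c * J p \<xi> f))) \<and>
     (\<forall>X \<in> vector_fields M. apply_field M J X \<in> vector_fields M)"

text \<open>Integrability is the vanishing of the Nijenhuis tensor.\<close>

definition integrable_structure ::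
  "('m, 'e::euclidean_space) mfd \<Rightarrow> ('m \<Rightarrow> 'm tvec \<Rightarrow> 'm tvec) \<Rightarrow> bool" where
  "integrable_structure M J \<longleftrightarrow> (\<forall>X \<in> vector_fields M. \<forall>Y \<in> vector_fields M.
     lie_bracket M (apply_field M J X) (apply_field M J Y)
     - apply_field M J (lie_bracket M (apply_field M J X) Y)
     - apply_field M J (lie_bracket M X (apply_field M J Y))
     - lie_bracket M X Y = 0)"


section \<open>Lie groups\<close>

definition lie_group :: "'g monoid \<Rightarrow> ('g, 'e::euclidean_space) mfd \<Rightarrow> bool" where
  "lie_group G M \<longleftrightarrow> group G \<and> smooth_manifold M \<and> carrier G = topspace (mtop M) \<and>
     smooth_map (prod_mfd M M) M (\<lambda>(x, y). x \<otimes>\<^bsub>G\<^esub> y) \<and> smooth_map M M (\<lambda>x. inv\<^bsub>G\<^esub> x)"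

definition left_invariant_fields :: "'g monoid \<Rightarrow> ('g, 'e::euclidean_space) mfd \<Rightarrow> 'g vfield set" where
  "left_invariant_fields G M = {X \<in> vector_fields M. \<forall>g \<in> carrier G. \<forall>h \<in> carrier G.
     differential M (\<lambda>x. g \<otimes>\<^bsub>G\<^esub> x) h (X h) = X (g \<otimes>\<^bsub>G\<^esub> h)}"

definition left_translate_field ::
  "'g monoid \<Rightarrow> ('g, 'e::euclidean_space) mfd \<Rightarrow> 'g \<Rightarrow> 'g vfield \<Rightarrow> 'g vfield" where
  "left_translate_field G M g X = (\<lambda>p. if p \<in> carrier G
     then differential M (\<lambda>x. g \<otimes>\<^bsub>G\<^esub> x) (inv\<^bsub>G\<^esub> g \<otimes>\<^bsub>G\<^esub> p) (X (inv\<^bsub>G\<^esub> g \<otimes>\<^bsub>G\<^esub> p)) else 0)"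

definition left_invariant_connection ::
  "'g monoid \<Rightarrow> ('g, 'e::euclidean_space) mfd \<Rightarrow> 'g connection \<Rightarrow> bool" where
  "left_invariant_connection G M nab \<longleftrightarrow>
     (\<forall>g \<in> carrier G. \<forall>X \<in> vector_fields M. \<forall>Y \<in> vector_fields M.
        nab (left_translate_field G M g X) (left_translate_field G M g Y) =
        left_translate_field G M g (nab X Y))"

definition left_invariant_affine_structure ::
  "'g monoid \<Rightarrow> ('g, 'e::euclidean_space) mfd \<Rightarrow> 'g connection \<Rightarrow> bool" where
  "left_invariant_affine_structure G M nab \<longleftrightarrow>
     affine_connection M nab \<and> flat M nab \<and> torsion_free M nab \<and> left_invariant_connection G M nab"

definition left_invariant_endomorphism ::
  "'g monoid \<Rightarrow> ('g, 'e::euclidean_space) mfd \<Rightarrow> ('g \<Rightarrow> 'g tvec \<Rightarrow> 'g tvec) \<Rightarrow> bool" where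
  "left_invariant_endomorphism G M J \<longleftrightarrow>
     (\<forall>g \<in> carrier G. \<forall>p \<in> carrier G. \<forall>\<xi> \<in> tangent_space M p.
        differential M (\<lambda>x. g \<otimes>\<^bsub>G\<^esub> x) p (J p \<xi>) =
        J (g \<otimes>\<^bsub>G\<^esub> p) (differential M (\<lambda>x. g \<otimes>\<^bsub>G\<^esub> x) p \<xi>))"


section \<open>The affine action of a left invariant affine structure\<close>

definition lie_algebra_coordinates ::
  "'g monoid \<Rightarrow> ('g, 'e::euclidean_space) mfd \<Rightarrow> ('g vfield \<Rightarrow> real^'n) \<Rightarrow> bool" where
  "lie_algebra_coordinates G M i \<longleftrightarrow> bij_betw i (left_invariant_fields G M) UNIV \<and>
     (\<forall>X \<in> left_invariant_fields G M. \<forall>Y \<in> left_invariant_fields G M. i (X + Y) = i X + i Y) \<and>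
     (\<forall>X \<in> left_invariant_fields G M. \<forall>c. i (scale_field (\<lambda>_. c) X) = c *\<^sub>R i X)"

text \<open>The element \<open>(A, v)\<close> is the affine transformation \<open>w \<mapsto> v + A w\<close>.\<close>

definition aff_group :: "((real^'n^'n) \<times> (real^'n)) monoid" where
  "aff_group = \<lparr> carrier = {A. invertible A} \<times> UNIV,
     monoid.mult = (\<lambda>(A, v) (B, w). (A ** B, v + A *v w)), one = (mat 1, 0) \<rparr>"

definition eta ::
  "'g monoid \<Rightarrow> ('g, 'e::euclidean_space) mfd \<Rightarrow> 'g connection \<Rightarrow> ('g vfield \<Rightarrow> real^'n) \<Rightarrow>
   'g vfield \<Rightarrow> (real^'n^'n) \<times> (real^'n)" where
  "eta G M nab i X = (matrix (\<lambda>v. i (nab X (inv_into (left_invariant_fields G M) i v))), i X)"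

text \<open>The action \<open>rho\<close> integrates \<open>eta\<close>: it is a smooth homomorphism with differential \<open>eta\<close> at
  the unit. On a simply connected group there is exactly one such homomorphism.\<close>

definition corresponding_affine_action ::
  "'g monoid \<Rightarrow> ('g, 'e::euclidean_space) mfd \<Rightarrow> 'g connection \<Rightarrow> ('g vfield \<Rightarrow> real^'n) \<Rightarrow>
   ('g \<Rightarrow> (real^'n^'n) \<times> (real^'n)) \<Rightarrow> bool" where
  "corresponding_affine_action G M nab i rho \<longleftrightarrow>
     rho \<in> hom G aff_group \<and> smooth_fun_on M (carrier G) rho \<and>
     (\<forall>X \<in> left_invariant_fields G M. dir_deriv (X \<one>\<^bsub>G\<^esub>) rho = eta G M nab i X)"

definition semidirect :: "'g monoid \<Rightarrow> ('g \<Rightarrow> real^'n^'n) \<Rightarrow> ('g \<times> (real^'n)) monoid" where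
  "semidirect G \<theta> = \<lparr> carrier = carrier G \<times> UNIV,
     monoid.mult = (\<lambda>(g, v) (h, w). (g \<otimes>\<^bsub>G\<^esub> h, v + \<theta> g *v w)), one = (\<one>\<^bsub>G\<^esub>, 0) \<rparr>"

text \<open>The parallel field \<open>T (_, v)\<close> takes the value at the unit that corresponds to \<open>v\<close> under \<open>i\<close>;
  since \<open>G\<close> is connected, this determines \<open>T\<close> and makes it fibrewise linear.\<close>

definition parallel_trivialization ::
  "'g monoid \<Rightarrow> ('g, 'e::euclidean_space) mfd \<Rightarrow> 'g connection \<Rightarrow> ('g vfield \<Rightarrow> real^'n) \<Rightarrow>
   ('g \<times> (real^'n) \<Rightarrow> 'g \<times> 'g tvec) \<Rightarrow> bool" where
  "parallel_trivialization G M nab i T \<longleftrightarrow>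
     diffeomorphism (prod_mfd M euclidean_mfd) (tangent_bundle M) T \<and>
     (\<forall>v. \<exists>P \<in> vector_fields M. (\<forall>Z \<in> vector_fields M. nab Z P = 0) \<and>
        (\<forall>g \<in> carrier G. T (g, v) = (g, P g)) \<and>
        P \<one>\<^bsub>G\<^esub> = inv_into (left_invariant_fields G M) i v \<one>\<^bsub>G\<^esub>)"

text \<open>For a diffeomorphism \<open>T\<close> from \<open>N\<close> onto the tangent bundle of \<open>M\<close>, the structure \<open>J\<close> on \<open>N\<close>
  swaps the preimages of the vertical and the horizontal subbundle.\<close>

definition swaps_vertical_horizontal ::
  "('m, 'e::euclidean_space) mfd \<Rightarrow> 'm connection \<Rightarrow> ('k, 'f::euclidean_space) mfd \<Rightarrow>
   ('k \<Rightarrow> 'm \<times> 'm tvec) \<Rightarrow> ('k \<Rightarrow> 'k tvec \<Rightarrow> 'k tvec) \<Rightarrow> bool" where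
  "swaps_vertical_horizontal M nab N T J \<longleftrightarrow>
     (\<forall>x \<in> topspace (mtop N).
       let V = {\<zeta> \<in> tangent_space N x.
                 differential (tangent_bundle M) T x \<zeta> \<in> vertical_space M (T x)};
           H = {\<zeta> \<in> tangent_space N x.
                 differential (tangent_bundle M) T x \<zeta> \<in> horizontal_space M nab (T x)}
       in J x ` V = H \<and> J x ` H = V)"

end

theory Submission
  imports Defs
begin

text \<open>
  Let \<open>L v\<close> be the left invariant field that corresponds to \<open>v\<close> under \<open>i\<close>, and let \<open>D u\<close> be the
  operator \<open>nab (L u)\<close> on left invariant fields. The homomorphism \<open>\<theta>\<close> has the differential \<open>D\<close> at the
  unit, so its derivative along \<open>L u\<close> is \<open>\<theta> D u\<close>. It follows that the field \<open>P v\<close> with components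
  \<open>\<theta>\<inverse> v\<close> in the left invariant frame is parallel (\<open>P_parallel\<close>). Parallel fields of a torsion-free
  connection commute. So the fields \<open>P v\<close> form a commuting parallel frame of \<open>G\<close>, and the fields
  \<open>(P u, w)\<close> form a commuting frame of \<open>G \<times> \<real>\<^sup>n\<close> (\<open>pair_frame_commute\<close>).

  The structure \<open>I\<close> maps \<open>(P u, w)\<close> to \<open>(- P w, u)\<close>. It is integrable because its components in a
  commuting frame are constant (\<open>integrable_constant_structure\<close>). It is left invariant because the left
  translation by \<open>(g, a)\<close> acts on the frame by \<open>\<theta> g\<close> in both components
  (\<open>semidirect_translation_frame\<close>), which commutes with \<open>I\<close>. The map \<open>T (g, v) = (g, P v g)\<close> is the
  trivialization of the tangent bundle by parallel fields (\<open>trivialization_diffeomorphism\<close>). It makes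
  the vectors \<open>(0, w)\<close> vertical and the vectors \<open>(P u, 0)\<close> horizontal (\<open>vertical_iff\<close>,
  \<open>horizontal_iff\<close>), and \<open>I\<close> swaps them.

  Tangent vectors are derivations of germs, and Hadamard's lemma links them to calculus: a
  derivation is determined by its values on the coordinates of a chart (\<open>tangent_chart\<close>). Equalities
  of tangent vectors, such as the vanishing of a bracket or the effect of a differential, are
  therefore checked on coordinate functions. The same lemma shows that tangent spaces have the
  dimension of the model space. So a space of fields of this dimension is a frame as soon as
  its nonzero elements have no zeros (\<open>frame_surj\<close>), and by Cramer's rule the components of smooth
  fields in it are smooth (\<open>framed_smooth_framed\<close>).
\<close>

section \<open>Calculus of smooth maps between Euclidean spaces\<close>

lemma Ck_on_subset: "Ck_on k S f \<Longrightarrow> T \<subseteq> S \<Longrightarrow> Ck_on k T f"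
  by (induction k arbitrary: f) (auto intro: continuous_on_subset)

lemma frechet_derivative_eqI:
  "(f has_derivative f') (at x) \<Longrightarrow> frechet_derivative f (at x) = f'"
  using frechet_derivative_at[of f f' x] by simp

lemma frechet_derivative_cong_open:
  assumes "open S" "x \<in> S" "\<And>y. y \<in> S \<Longrightarrow> f y = g y"
  shows "frechet_derivative f (at x) = frechet_derivative g (at x)"
proof -
  have "(f has_derivative D) (at x) \<longleftrightarrow> (g has_derivative D) (at x)" for D
    using assms has_derivative_transform_within_open[of f D x UNIV S g]
      has_derivative_transform_within_open[of g D x UNIV S f] by auto
  then show ?thesis unfolding frechet_derivative_def by simp
qed

lemma Ck_on_cong:
  assumes "open S" "\<And>x. x \<in> S \<Longrightarrow> f x = g x" "Ck_on k S f"
  shows "Ck_on k S g"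
  using assms(2,3)
proof (induction k arbitrary: f g)
  case 0
  then show ?case by (auto simp: continuous_on_eq)
next
  case (Suc k)
  have "g differentiable (at x)" if "x \<in> S" for x
  proof -
    obtain D where "(f has_derivative D) (at x)"
      using Suc.prems(2) \<open>x \<in> S\<close> by (auto simp: differentiable_def)
    then have "(g has_derivative D) (at x)"
      by (rule has_derivative_transform_within_open) (use \<open>open S\<close> \<open>x \<in> S\<close> Suc.prems(1) in auto)
    then show ?thesis by (rule differentiableI)
  qed
  moreover have "Ck_on k S (\<lambda>x. frechet_derivative g (at x) v)" for v
  proof (rule Suc.IH)
    show "Ck_on k S (\<lambda>x. frechet_derivative f (at x) v)" using Suc.prems by simp
    show "frechet_derivative f (at x) v = frechet_derivative g (at x) v" if "x \<in> S" for x
      by (subst frechet_derivative_cong_open[OF \<open>open S\<close> that Suc.prems(1)]) auto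
  qed
  ultimately show ?case by simp
qed

lemma Ck_on_SucI:
  assumes "open S" "\<And>x. x \<in> S \<Longrightarrow> (f has_derivative f' x) (at x)"
    "\<And>v. Ck_on k S (\<lambda>x. f' x v)"
  shows "Ck_on (Suc k) S f"
proof -
  have "Ck_on k S (\<lambda>x. frechet_derivative f (at x) v)" for v
    by (rule Ck_on_cong[OF \<open>open S\<close> _ assms(3)[of v]]) (simp add: frechet_derivative_eqI[OF assms(2)])
  then show ?thesis using assms(2) by (auto simp: differentiable_def)
qed

lemma Ck_on_SucD:
  assumes "Ck_on (Suc k) S f" "x \<in> S"
  shows "(f has_derivative frechet_derivative f (at x)) (at x)"
  using assms by (simp add: frechet_derivative_works)

lemma Ck_on_Suc_imp: "Ck_on (Suc k) S f \<Longrightarrow> Ck_on k S f"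
proof (induction k arbitrary: f)
  case 0
  then show ?case
    by (auto intro!: continuous_at_imp_continuous_on differentiable_imp_continuous_within)
qed auto

lemma Ck_on_imp_continuous_on: "Ck_on k S f \<Longrightarrow> continuous_on S f"
  by (induction k) (auto dest: Ck_on_Suc_imp simp del: Ck_on.simps(2))

lemma Ck_on_local:
  assumes "\<And>x. x \<in> S \<Longrightarrow> \<exists>T. open T \<and> x \<in> T \<and> Ck_on k T f"
  shows "Ck_on k S f"
  using assms
proof (induction k arbitrary: f)
  case 0
  have "isCont f x" if "x \<in> S" for x
    using 0[OF that] continuous_on_eq_continuous_at by auto
  then show ?case by (simp add: continuous_at_imp_continuous_on)
next
  case (Suc k)
  have "f differentiable (at x)" if "x \<in> S" for x
    using Suc.prems[OF that] by auto
  moreover have "Ck_on k S (\<lambda>x. frechet_derivative f (at x) v)" for v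
  proof (rule Suc.IH)
    fix x assume "x \<in> S"
    from Suc.prems[OF this] obtain T where "open T" "x \<in> T" "Ck_on (Suc k) T f" by blast
    then show "\<exists>T. open T \<and> x \<in> T \<and> Ck_on k T (\<lambda>x. frechet_derivative f (at x) v)"
      by (intro exI[of _ T]) simp
  qed
  ultimately show ?case by simp
qed

lemma Ck_on_const: "Ck_on k S (\<lambda>x. c)"
  by (induction k arbitrary: c) auto

lemma Ck_on_bounded_linear:
  assumes "bounded_linear L" "open S" "Ck_on k S f"
  shows "Ck_on k S (\<lambda>x. L (f x))"
  using assms(3)
proof (induction k arbitrary: f)
  case 0
  then show ?case using assms(1) linear_continuous_on_compose bounded_linear.continuous_on by auto
next
  case (Suc k)
  show ?case
  proof (rule Ck_on_SucI[OF \<open>open S\<close>])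
    show "((\<lambda>x. L (f x)) has_derivative (\<lambda>v. L (frechet_derivative f (at x) v))) (at x)" if "x \<in> S" for x
      using bounded_linear.has_derivative[OF assms(1) Ck_on_SucD[OF Suc.prems that]] by simp
    show "Ck_on k S (\<lambda>x. L (frechet_derivative f (at x) v))" for v
      using Suc by auto
  qed
qed

lemma Ck_on_id: "open S \<Longrightarrow> Ck_on k S (\<lambda>x. x)"
proof (cases k)
  case (Suc l)
  moreover assume "open S"
  ultimately show ?thesis
    using Ck_on_SucI[of S "\<lambda>x. x" "\<lambda>x v. v" l] by (auto simp: Ck_on_const)
qed auto

lemma Ck_on_add:
  assumes "open S" "Ck_on k S f" "Ck_on k S g"
  shows "Ck_on k S (\<lambda>x. f x + g x)"
  using assms(2,3)
proof (induction k arbitrary: f g)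
  case (Suc k)
  show ?case
  proof (rule Ck_on_SucI[OF \<open>open S\<close>])
    show "((\<lambda>x. f x + g x) has_derivative
        (\<lambda>v. frechet_derivative f (at x) v + frechet_derivative g (at x) v)) (at x)" if "x \<in> S" for x
      using Suc.prems that by (intro has_derivative_add Ck_on_SucD)
    show "Ck_on k S (\<lambda>x. frechet_derivative f (at x) v + frechet_derivative g (at x) v)" for v
      using Suc by auto
  qed
qed (auto intro: continuous_intros)

lemma Ck_on_sum:
  "open S \<Longrightarrow> (\<And>i. i \<in> I \<Longrightarrow> Ck_on k S (f i)) \<Longrightarrow> Ck_on k S (\<lambda>x. \<Sum>i\<in>I. f i x)"
  by (induction I rule: infinite_finite_induct) (auto simp: Ck_on_const intro: Ck_on_add)

lemma Ck_on_bilinear: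
  assumes "bounded_bilinear B" "open S" "Ck_on k S f" "Ck_on k S g"
  shows "Ck_on k S (\<lambda>x. B (f x) (g x))"
  using assms(3,4)
proof (induction k arbitrary: f g)
  case 0
  then show ?case using bounded_bilinear.continuous_on[OF assms(1)] by auto
next
  case (Suc k)
  show ?case
  proof (rule Ck_on_SucI[OF \<open>open S\<close>])
    show "((\<lambda>x. B (f x) (g x)) has_derivative
        (\<lambda>v. B (f x) (frechet_derivative g (at x) v) + B (frechet_derivative f (at x) v) (g x))) (at x)"
      if "x \<in> S" for x
      by (intro bounded_bilinear.FDERIV[OF assms(1)] Ck_on_SucD[OF Suc.prems(1) that] Ck_on_SucD[OF Suc.prems(2) that])
    show "Ck_on k S (\<lambda>x. B (f x) (frechet_derivative g (at x) v) + B (frechet_derivative f (at x) v) (g x))" for v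
      using Suc Ck_on_Suc_imp[OF Suc.prems(1)] Ck_on_Suc_imp[OF Suc.prems(2)]
      by (intro Ck_on_add \<open>open S\<close> Suc.IH) auto
  qed
qed

lemma linear_Basis_expansion:
  fixes D :: "'a::euclidean_space \<Rightarrow> 'b::real_vector"
  assumes "linear D"
  shows "D v = (\<Sum>b\<in>Basis. (v \<bullet> b) *\<^sub>R D b)"
proof -
  have "D v = D (\<Sum>b\<in>Basis. (v \<bullet> b) *\<^sub>R b)" by (simp add: euclidean_representation)
  also have "\<dots> = (\<Sum>b\<in>Basis. (v \<bullet> b) *\<^sub>R D b)"
    by (simp add: linear_sum[OF assms] linear_cmul[OF assms])
  finally show ?thesis .
qed

text \<open>By the chain rule, a directional derivative of \<open>g \<circ> f\<close> is a sum of products of directional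
  derivatives of \<open>f\<close> with compositions of partial derivatives of \<open>g\<close> with \<open>f\<close>, to which the
  induction hypothesis applies.\<close>

lemma Ck_on_compose:
  fixes f :: "'a::real_normed_vector \<Rightarrow> 'b::euclidean_space" and g :: "'b \<Rightarrow> 'c::real_normed_vector"
  assumes "open S" "open T" "f ` S \<subseteq> T" "Ck_on k S f" "Ck_on k T g"
  shows "Ck_on k S (\<lambda>x. g (f x))"
  using assms(4,5)
proof (induction k arbitrary: g)
  case 0
  then show ?case using assms(3) continuous_on_compose2 by auto
next
  case (Suc k)
  show ?case
  proof (rule Ck_on_SucI[OF \<open>open S\<close>])
    fix x assume "x \<in> S"
    then have f: "(f has_derivative frechet_derivative f (at x)) (at x)"
      and g: "(g has_derivative frechet_derivative g (at (f x))) (at (f x))"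
      using Suc.prems assms(3) Ck_on_SucD by blast+
    have "((\<lambda>x. g (f x)) has_derivative (\<lambda>v. frechet_derivative g (at (f x)) (frechet_derivative f (at x) v))) (at x)"
      using diff_chain_at[OF f g] by (simp add: o_def)
    then show "((\<lambda>x. g (f x)) has_derivative
        (\<lambda>v. \<Sum>b\<in>Basis. (frechet_derivative f (at x) v \<bullet> b) *\<^sub>R frechet_derivative g (at (f x)) b)) (at x)"
      by (subst (asm) linear_Basis_expansion[OF has_derivative_linear[OF g]])
  next
    fix v
    have "Ck_on k S (\<lambda>x. frechet_derivative g (at (f x)) b)" for b
      using Suc.IH[of "\<lambda>y. frechet_derivative g (at y) b"] Ck_on_Suc_imp[OF Suc.prems(1)] Suc.prems(2) by simp
    moreover have "Ck_on k S (\<lambda>x. frechet_derivative f (at x) v \<bullet> b)" for b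
      using Suc.prems(1) by (intro Ck_on_bounded_linear[OF bounded_linear_inner_left \<open>open S\<close>]) simp
    ultimately show "Ck_on k S (\<lambda>x. \<Sum>b\<in>Basis. (frechet_derivative f (at x) v \<bullet> b) *\<^sub>R frechet_derivative g (at (f x)) b)"
      by (intro Ck_on_sum Ck_on_bilinear[OF bounded_bilinear_scaleR] \<open>open S\<close>) auto
  qed
qed

text \<open>The derivative of \<open>1 / f\<close> is a product of \<open>1 / f\<close>, twice, with a derivative of \<open>f\<close>, so that one
  order of differentiability of \<open>1 / f\<close> gives the next one.\<close>

lemma Ck_on_inverse:
  fixes f :: "'a::real_normed_vector \<Rightarrow> real"
  assumes "open S" "\<And>x. x \<in> S \<Longrightarrow> f x \<noteq> 0" "Ck_on k S f"
  shows "Ck_on k S (\<lambda>x. inverse (f x))"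
  using assms(3)
proof (induction k)
  case 0
  then show ?case using assms(2) by (auto intro: continuous_on_inverse)
next
  case (Suc k)
  show ?case
  proof (rule Ck_on_SucI[OF \<open>open S\<close>])
    show "((\<lambda>x. inverse (f x)) has_derivative
        (\<lambda>v. (-1) * (inverse (f x) * frechet_derivative f (at x) v * inverse (f x)))) (at x)" if "x \<in> S" for x
      using Deriv.has_derivative_inverse[OF assms(2)[OF that] Ck_on_SucD[OF Suc.prems that]] by simp
    show "Ck_on k S (\<lambda>x. (-1) * (inverse (f x) * frechet_derivative f (at x) v * inverse (f x)))" for v
      using Suc Ck_on_Suc_imp[OF Suc.prems]
      by (intro Ck_on_bilinear[OF bounded_bilinear_mult] \<open>open S\<close> Ck_on_const) auto
  qed
qed

lemma smooth_on_subset: "smooth_on S f \<Longrightarrow> T \<subseteq> S \<Longrightarrow> smooth_on T f"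
  unfolding smooth_on_def using Ck_on_subset by blast

lemma smooth_on_cong:
  assumes "smooth_on S f" "open S" "\<And>x. x \<in> S \<Longrightarrow> f x = g x"
  shows "smooth_on S g"
  using assms Ck_on_cong unfolding smooth_on_def by metis

lemma smooth_on_local:
  "(\<And>x. x \<in> S \<Longrightarrow> \<exists>T. open T \<and> x \<in> T \<and> smooth_on T f) \<Longrightarrow> smooth_on S f"
  unfolding smooth_on_def by (intro allI Ck_on_local) blast

lemma smooth_on_const: "smooth_on S (\<lambda>x. c)"
  by (simp add: smooth_on_def Ck_on_const)

lemma smooth_on_id: "open S \<Longrightarrow> smooth_on S (\<lambda>x. x)"
  by (simp add: smooth_on_def Ck_on_id)

lemma smooth_on_bounded_linear:
  "bounded_linear L \<Longrightarrow> open S \<Longrightarrow> smooth_on S f \<Longrightarrow> smooth_on S (\<lambda>x. L (f x))"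
  by (simp add: smooth_on_def Ck_on_bounded_linear)

lemma smooth_on_add:
  "open S \<Longrightarrow> smooth_on S f \<Longrightarrow> smooth_on S g \<Longrightarrow> smooth_on S (\<lambda>x. f x + g x)"
  by (simp add: smooth_on_def Ck_on_add)

lemma smooth_on_sum:
  "open S \<Longrightarrow> (\<And>i. i \<in> I \<Longrightarrow> smooth_on S (f i)) \<Longrightarrow> smooth_on S (\<lambda>x. \<Sum>i\<in>I. f i x)"
  by (simp add: smooth_on_def Ck_on_sum)

lemma smooth_on_bilinear:
  "bounded_bilinear B \<Longrightarrow> open S \<Longrightarrow> smooth_on S f \<Longrightarrow> smooth_on S g \<Longrightarrow> smooth_on S (\<lambda>x. B (f x) (g x))"
  by (simp add: smooth_on_def Ck_on_bilinear)

lemma smooth_on_compose: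
  fixes f :: "'a::real_normed_vector \<Rightarrow> 'b::euclidean_space" and g :: "'b \<Rightarrow> 'c::real_normed_vector"
  shows "open S \<Longrightarrow> open T \<Longrightarrow> f ` S \<subseteq> T \<Longrightarrow> smooth_on S f \<Longrightarrow> smooth_on T g \<Longrightarrow> smooth_on S (\<lambda>x. g (f x))"
  unfolding smooth_on_def using Ck_on_compose by blast

lemma smooth_on_inverse:
  fixes f :: "'a::real_normed_vector \<Rightarrow> real"
  shows "open S \<Longrightarrow> (\<And>x. x \<in> S \<Longrightarrow> f x \<noteq> 0) \<Longrightarrow> smooth_on S f \<Longrightarrow> smooth_on S (\<lambda>x. inverse (f x))"
  by (simp add: smooth_on_def Ck_on_inverse)

lemma smooth_on_prod:
  fixes f :: "'i \<Rightarrow> 'a::real_normed_vector \<Rightarrow> real"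
  shows "open S \<Longrightarrow> (\<And>i. i \<in> I \<Longrightarrow> smooth_on S (f i)) \<Longrightarrow> smooth_on S (\<lambda>x. \<Prod>i\<in>I. f i x)"
  by (induction I rule: infinite_finite_induct)
    (auto simp: smooth_on_const intro: smooth_on_bilinear[OF bounded_bilinear_mult])

lemma smooth_on_componentwise:
  fixes f :: "'a::real_normed_vector \<Rightarrow> 'b::euclidean_space"
  assumes "open S" "\<And>b. b \<in> Basis \<Longrightarrow> smooth_on S (\<lambda>x. f x \<bullet> b)"
  shows "smooth_on S f"
proof -
  have "smooth_on S (\<lambda>x. \<Sum>b\<in>Basis. (f x \<bullet> b) *\<^sub>R b)"
    using assms by (intro smooth_on_sum smooth_on_bilinear[OF bounded_bilinear_scaleR] smooth_on_const)
  then show ?thesis by (simp add: euclidean_representation)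
qed

lemma smooth_on_Pair:
  assumes "open S" "smooth_on S f" "smooth_on S g"
  shows "smooth_on S (\<lambda>x. (f x, g x))"
proof -
  have "bounded_linear (\<lambda>x. (x, 0))" "bounded_linear (\<lambda>x. (0, x))"
    by (auto intro!: bounded_linear_Pair bounded_linear_ident bounded_linear_zero)
  then have "smooth_on S (\<lambda>x. (f x, 0) + (0, g x))"
    using assms smooth_on_bounded_linear by (intro smooth_on_add; blast)
  then show ?thesis by simp
qed

lemma smooth_on_derivative:
  "smooth_on S f \<Longrightarrow> smooth_on S (\<lambda>x. frechet_derivative f (at x) v)"
  unfolding smooth_on_def by (metis Ck_on.simps(2))

lemma smooth_on_has_derivative:
  "smooth_on S f \<Longrightarrow> x \<in> S \<Longrightarrow> (f has_derivative frechet_derivative f (at x)) (at x)"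
  unfolding smooth_on_def using Ck_on_SucD by blast

lemma smooth_on_imp_continuous_on: "smooth_on S f \<Longrightarrow> continuous_on S f"
  unfolding smooth_on_def using Ck_on_imp_continuous_on by blast

text \<open>By Cramer's rule, the solution is a quotient of polynomials in the entries of the system. This
  makes the components of smooth vector fields with respect to a smooth frame smooth.\<close>

lemma smooth_on_linear_system:
  fixes A :: "'a::real_normed_vector \<Rightarrow> real^'n^'n"
  assumes "open S" "smooth_on S A" "smooth_on S b"
    and inj: "\<And>x. x \<in> S \<Longrightarrow> invertible (A x)" and sol: "\<And>x. x \<in> S \<Longrightarrow> A x *v c x = b x"
  shows "smooth_on S c"
proof -
  have A: "smooth_on S (\<lambda>x. A x $ i $ j)" for i j
    using smooth_on_bounded_linear[OF _ assms(1,2)] bounded_linear_compose[OF bounded_linear_vec_nth bounded_linear_vec_nth]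
    by blast
  have b: "smooth_on S (\<lambda>x. b x $ i)" for i
    using smooth_on_bounded_linear[OF bounded_linear_vec_nth assms(1,3)] .
  have det: "smooth_on S (\<lambda>x. det (B x))" if "\<And>i j. smooth_on S (\<lambda>x. B x $ i $ j)" for B :: "'a \<Rightarrow> real^'n^'n"
    unfolding det_def
    by (intro smooth_on_sum smooth_on_bilinear[OF bounded_bilinear_mult] smooth_on_prod smooth_on_const that assms(1))
  have "smooth_on S (\<lambda>x. c x $ k)" for k
  proof -
    have "smooth_on S (\<lambda>x. det (\<chi> i j. if j = k then b x $ i else A x $ i $ j))"
    proof (rule det)
      show "smooth_on S (\<lambda>x. (\<chi> i j. if j = k then b x $ i else A x $ i $ j) $ i $ j)" for i j
        by (cases "j = k") (simp_all add: A b)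
    qed
    then have "smooth_on S (\<lambda>x. det (\<chi> i j. if j = k then b x $ i else A x $ i $ j) * inverse (det (A x)))"
      using assms(1) inj
      by (intro smooth_on_bilinear[OF bounded_bilinear_mult] smooth_on_inverse det[OF A])
        (auto simp: invertible_det_nz)
    then show ?thesis
    proof (rule smooth_on_cong[OF _ assms(1)])
      fix x assume "x \<in> S"
      then have "det (A x) \<noteq> 0" "A x *v c x = b x" using inj sol by (auto simp: invertible_det_nz)
      then have "c x = (\<chi> k. det (\<chi> i j. if j = k then b x $ i else A x $ i $ j) / det (A x))"
        using cramer by blast
      then show "det (\<chi> i j. if j = k then b x $ i else A x $ i $ j) * inverse (det (A x)) = c x $ k"
        by (simp add: divide_inverse)
    qed
  qed
  then have "smooth_on S (\<lambda>x. c x \<bullet> a)" if "a \<in> Basis" for a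
    using that by (auto simp: Basis_vec_def inner_axis)
  then show ?thesis using smooth_on_componentwise assms(1) by blast
qed

section \<open>Hadamard's lemma\<close>

lemma segment_in_ball:
  fixes a x :: "'a::real_normed_vector"
  assumes "x \<in> ball a r" "t \<in> {0..1}"
  shows "a + t *\<^sub>R (x - a) \<in> ball a r"
proof -
  have "\<bar>t\<bar> * norm (x - a) \<le> 1 * norm (x - a)"
    using assms by (intro mult_right_mono) auto
  then show ?thesis using assms by (simp add: dist_norm norm_minus_commute)
qed

lemma continuous_on_segment:
  fixes H :: "'a::euclidean_space \<Rightarrow> real"
  assumes "continuous_on (ball a r) H"
  shows "continuous_on (ball a r \<times> cbox 0 1) (\<lambda>(x, t::real). t ^ m * H (a + t *\<^sub>R (x - a)))"
  unfolding case_prod_beta using segment_in_ball[of _ a r]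
  by (intro continuous_intros continuous_on_compose2[OF assms]) auto

lemma integrable_on_segment:
  fixes H :: "'a::euclidean_space \<Rightarrow> real"
  assumes "continuous_on (ball a r) H" "x \<in> ball a r"
  shows "(\<lambda>t. t ^ m * H (a + t *\<^sub>R (x - a))) integrable_on {0..1}"
  using segment_in_ball[OF assms(2)]
  by (intro integrable_continuous_interval continuous_intros continuous_on_compose2[OF assms(1)]) auto

text \<open>The weight \<open>t ^ m\<close> is there for the induction: each derivative under the integral sign
  contributes one more factor \<open>t\<close>.\<close>

lemma Ck_on_integral:
  fixes H :: "'a::euclidean_space \<Rightarrow> real"
  assumes "Ck_on k (ball a r) H"
  shows "Ck_on k (ball a r) (\<lambda>x. integral {0..1} (\<lambda>t. t ^ m * H (a + t *\<^sub>R (x - a))))"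
  using assms
proof (induction k arbitrary: H m)
  case 0
  have "continuous_on (ball a r) (\<lambda>x. integral (cbox 0 1) (\<lambda>t::real. t ^ m * H (a + t *\<^sub>R (x - a))))"
    by (rule integral_continuous_on_param[OF continuous_on_segment[OF 0[simplified]]])
  then show ?case by simp
next
  case (Suc k)
  let ?D = "\<lambda>x. frechet_derivative H (at x)"
  let ?d = "\<lambda>x t v. t ^ Suc m * ?D (a + t *\<^sub>R (x - a)) v"
  have lin: "bounded_linear (?d x t)" if "x \<in> ball a r" "t \<in> {0..1}" for x t
    using Ck_on_SucD[OF Suc.prems segment_in_ball[OF that]] has_derivative_bounded_linear
      bounded_linear_const_mult by blast
  have cH: "continuous_on (ball a r) H" using Suc.prems by (rule Ck_on_imp_continuous_on)
  have cD: "continuous_on (ball a r) (\<lambda>x. ?D x v)" for v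
    using Suc.prems by (intro Ck_on_imp_continuous_on[of k]) simp
  \<comment> \<open>The derivative under the integral sign has to be continuous as a bounded linear map.\<close>
  have dconv: "continuous_on (ball a r \<times> cbox 0 1) (\<lambda>(x, t). Blinfun (?d x t))"
  proof (rule continuous_on_blinfun_componentwise)
    fix v :: 'a
    show "continuous_on (ball a r \<times> cbox 0 1) (\<lambda>p. blinfun_apply (case p of (x, t) \<Rightarrow> Blinfun (?d x t)) v)"
      using continuous_on_segment[OF cD, of "Suc m" v]
    proof (rule continuous_on_eq)
      fix p assume "p \<in> ball a r \<times> cbox 0 (1::real)"
      then have "bounded_linear (?d (fst p) (snd p))" by (intro lin) auto
      from bounded_linear_Blinfun_apply[OF this]
      show "(case p of (x, t) \<Rightarrow> t ^ Suc m * ?D (a + t *\<^sub>R (x - a)) v) =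
          blinfun_apply (case p of (x, t) \<Rightarrow> Blinfun (?d x t)) v"
        by (simp add: case_prod_beta)
    qed
  qed
  show ?case
  proof (rule Ck_on_SucI[OF open_ball])
    fix x assume x: "x \<in> ball a r"
    have "((\<lambda>x. integral (cbox 0 1) (\<lambda>t. t ^ m * H (a + t *\<^sub>R (x - a)))) has_derivative
        blinfun_apply (integral (cbox 0 1) (\<lambda>t. Blinfun (?d x t)))) (at x within ball a r)"
    proof (rule leibniz_rule[OF _ _ dconv x convex_ball])
      show "(\<lambda>t. t ^ m * H (a + t *\<^sub>R (y - a))) integrable_on cbox 0 1" if "y \<in> ball a r" for y
        using integrable_on_segment[OF cH that] by simp
      fix y and t :: real assume "y \<in> ball a r" and t: "t \<in> cbox 0 1"
      then have H: "(H has_derivative ?D (a + t *\<^sub>R (y - a))) (at (a + t *\<^sub>R (y - a)))"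
        using Ck_on_SucD[OF Suc.prems segment_in_ball] by simp
      have "((\<lambda>y. a + t *\<^sub>R (y - a)) has_derivative (\<lambda>v. t *\<^sub>R v)) (at y)"
        by (auto intro!: derivative_eq_intros)
      from diff_chain_at[OF this H]
      have "((\<lambda>y. H (a + t *\<^sub>R (y - a))) has_derivative (\<lambda>v. t * ?D (a + t *\<^sub>R (y - a)) v)) (at y)"
        by (simp add: o_def linear_cmul[OF has_derivative_linear[OF H]])
      from has_derivative_mult_right[OF this, of "t ^ m"]
      have "((\<lambda>y. t ^ m * H (a + t *\<^sub>R (y - a))) has_derivative ?d y t) (at y)"
        by (simp add: mult_ac)
      then show "((\<lambda>y. t ^ m * H (a + t *\<^sub>R (y - a))) has_derivative blinfun_apply (Blinfun (?d y t)))
          (at y within ball a r)"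
        using t by (subst bounded_linear_Blinfun_apply[OF lin[OF \<open>y \<in> ball a r\<close>]])
          (auto intro: has_derivative_at_withinI)
    qed
    moreover have "blinfun_apply (integral (cbox 0 1) (\<lambda>t. Blinfun (?d x t))) =
        (\<lambda>v. integral {0..1} (\<lambda>t. ?d x t v))"
    proof
      fix v
      have "continuous_on {0..1} (\<lambda>t. case (x, t) of (x, t) \<Rightarrow> Blinfun (?d x t))"
        using x by (intro continuous_on_compose2[OF dconv] continuous_intros) auto
      then have "(\<lambda>t. Blinfun (?d x t)) integrable_on cbox 0 1"
        by (simp add: integrable_continuous_interval)
      then have "blinfun_apply (integral (cbox 0 1) (\<lambda>t. Blinfun (?d x t))) v =
          integral (cbox 0 1) (\<lambda>t. blinfun_apply (Blinfun (?d x t)) v)"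
        by (rule blinfun_apply_integral)
      also have "\<dots> = integral {0..1} (\<lambda>t. ?d x t v)"
        unfolding box_real
        by (rule integral_cong) (simp only: bounded_linear_Blinfun_apply[OF lin[OF x]])
      finally show "blinfun_apply (integral (cbox 0 1) (\<lambda>t. Blinfun (?d x t))) v =
          integral {0..1} (\<lambda>t. ?d x t v)" .
    qed
    ultimately show "((\<lambda>x. integral {0..1} (\<lambda>t. t ^ m * H (a + t *\<^sub>R (x - a)))) has_derivative
        (\<lambda>v. integral {0..1} (\<lambda>t. ?d x t v))) (at x)"
      using x by (simp add: at_within_open[OF _ open_ball])
  next
    show "Ck_on k (ball a r) (\<lambda>x. integral {0..1} (\<lambda>t. ?d x t v))" for v
      using Suc.IH[of "\<lambda>x. ?D x v" "Suc m"] Suc.prems by simp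
  qed
qed

text \<open>Integrating the derivative of \<open>F\<close> along the segment from \<open>a\<close> to \<open>x\<close> gives
  \<open>F x - F a\<close> as a combination of the coordinates of \<open>x - a\<close>, whose coefficients are the averages of
  the partial derivatives along the segment.\<close>

lemma Hadamard:
  fixes F :: "'a::euclidean_space \<Rightarrow> real"
  assumes F: "smooth_on (ball a r) F"
  obtains G where "\<And>b. smooth_on (ball a r) (G b)" "\<And>b. G b a = frechet_derivative F (at a) b"
    "\<And>x. x \<in> ball a r \<Longrightarrow> F x = F a + (\<Sum>b\<in>Basis. (x \<bullet> b - a \<bullet> b) * G b x)"
proof
  let ?D = "\<lambda>x. frechet_derivative F (at x)"
  let ?G = "\<lambda>b x. integral {0..1} (\<lambda>t. ?D (a + t *\<^sub>R (x - a)) b)"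
  have D: "smooth_on (ball a r) (\<lambda>x. ?D x b)" for b
    by (rule smooth_on_derivative[OF F])
  show "smooth_on (ball a r) (?G b)" for b
    unfolding smooth_on_def
    using Ck_on_integral[of _ a r "\<lambda>x. ?D x b" 0] D[of b] unfolding smooth_on_def by simp
  show "?G b a = ?D a b" for b by simp
  fix x assume x: "x \<in> ball a r"
  have "((\<lambda>t. \<Sum>b\<in>Basis. (x \<bullet> b - a \<bullet> b) * ?D (a + t *\<^sub>R (x - a)) b) has_integral
      F (a + 1 *\<^sub>R (x - a)) - F (a + 0 *\<^sub>R (x - a))) {0..1}"
  proof (rule fundamental_theorem_of_calculus)
    fix t :: real assume t: "t \<in> {0..1}"
    have H: "(F has_derivative ?D (a + t *\<^sub>R (x - a))) (at (a + t *\<^sub>R (x - a)))"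
      by (rule smooth_on_has_derivative[OF F segment_in_ball[OF x t]])
    have "((\<lambda>t. a + t *\<^sub>R (x - a)) has_derivative (\<lambda>s. s *\<^sub>R (x - a))) (at t within {0..1})"
      by (auto intro!: derivative_eq_intros)
    from has_derivative_compose[OF this H]
    have "((\<lambda>t. F (a + t *\<^sub>R (x - a))) has_derivative (\<lambda>s. s * ?D (a + t *\<^sub>R (x - a)) (x - a))) (at t within {0..1})"
      by (simp add: linear_cmul[OF has_derivative_linear[OF H]])
    then show "((\<lambda>t. F (a + t *\<^sub>R (x - a))) has_vector_derivative
        (\<Sum>b\<in>Basis. (x \<bullet> b - a \<bullet> b) * ?D (a + t *\<^sub>R (x - a)) b)) (at t within {0..1})"
      unfolding has_vector_derivative_def
      using linear_Basis_expansion[OF has_derivative_linear[OF H], of "x - a"]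
      by (simp add: inner_diff_left)
  qed simp
  moreover have "((\<lambda>t. \<Sum>b\<in>Basis. (x \<bullet> b - a \<bullet> b) * ?D (a + t *\<^sub>R (x - a)) b) has_integral
      (\<Sum>b\<in>Basis. (x \<bullet> b - a \<bullet> b) * ?G b x)) {0..1}"
    using integrable_on_segment[OF smooth_on_imp_continuous_on[OF D] x, of 0]
    by (intro has_integral_sum has_integral_mult_right integrable_integral) auto
  ultimately have "F (a + 1 *\<^sub>R (x - a)) - F (a + 0 *\<^sub>R (x - a)) = (\<Sum>b\<in>Basis. (x \<bullet> b - a \<bullet> b) * ?G b x)"
    by (rule has_integral_unique)
  then show "F x = F a + (\<Sum>b\<in>Basis. (x \<bullet> b - a \<bullet> b) * ?G b x)" by simp
qed

section \<open>Functions and maps on charted spaces\<close>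

text \<open>The condition that charts are homeomorphisms onto open sets is spelled out in terms of images and
  preimages. In this form it can be checked for the tangent bundle, whose topology is generated by
  preimages under its charts.\<close>

locale charted =
  fixes M :: "('m, 'e::euclidean_space) mfd"
  assumes topspace_eq: "topspace (mtop M) = \<Union> (fst ` atlas M)"
    and openin_chart: "(U, \<phi>) \<in> atlas M \<Longrightarrow> openin (mtop M) U"
    and inj_on_chart: "(U, \<phi>) \<in> atlas M \<Longrightarrow> inj_on \<phi> U"
    and open_chart_image: "(U, \<phi>) \<in> atlas M \<Longrightarrow> openin (mtop M) W \<Longrightarrow> open (\<phi> ` (U \<inter> W))"
    and openin_chart_vimage: "(U, \<phi>) \<in> atlas M \<Longrightarrow> open S \<Longrightarrow> openin (mtop M) (U \<inter> \<phi> -` S)"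
begin

lemma obtain_chart:
  assumes "p \<in> topspace (mtop M)"
  obtains U \<phi> where "(U, \<phi>) \<in> atlas M" "p \<in> U"
  using assms unfolding topspace_eq by force

lemma inv_chart: "(U, \<phi>) \<in> atlas M \<Longrightarrow> p \<in> U \<Longrightarrow> inv_into U \<phi> (\<phi> p) = p"
  by (simp add: inj_on_chart)

lemma smooth_fun_onI:
  "(\<And>U \<phi>. (U, \<phi>) \<in> atlas M \<Longrightarrow> smooth_on (\<phi> ` (U \<inter> W)) (\<lambda>x. f (inv_into U \<phi> x))) \<Longrightarrow> smooth_fun_on M W f"
  unfolding smooth_fun_on_def by (auto simp: o_def)

lemma smooth_fun_onD:
  "smooth_fun_on M W f \<Longrightarrow> (U, \<phi>) \<in> atlas M \<Longrightarrow> smooth_on (\<phi> ` (U \<inter> W)) (\<lambda>x. f (inv_into U \<phi> x))"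
  unfolding smooth_fun_on_def by (auto simp: o_def)

lemma smooth_fun_on_subset:
  "smooth_fun_on M W f \<Longrightarrow> W' \<subseteq> W \<Longrightarrow> smooth_fun_on M W' f"
  by (rule smooth_fun_onI, rule smooth_on_subset, erule (1) smooth_fun_onD) auto

lemma smooth_fun_on_cong:
  assumes "smooth_fun_on M W f" "openin (mtop M) W" "\<And>p. p \<in> W \<Longrightarrow> f p = g p"
  shows "smooth_fun_on M W g"
proof (rule smooth_fun_onI)
  fix U \<phi> assume c: "(U, \<phi>) \<in> atlas M"
  show "smooth_on (\<phi> ` (U \<inter> W)) (\<lambda>x. g (inv_into U \<phi> x))"
    by (rule smooth_on_cong[OF smooth_fun_onD[OF assms(1) c] open_chart_image[OF c assms(2)]])
      (auto simp: inv_chart[OF c] assms(3))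
qed

text \<open>Smoothness with respect to an arbitrary chart is what has to be proved, but near a given point
  any convenient chart may be used.\<close>

lemma smooth_fun_on_local:
  assumes "\<And>p. p \<in> W \<Longrightarrow> p \<in> topspace (mtop M) \<Longrightarrow>
    \<exists>W'. openin (mtop M) W' \<and> p \<in> W' \<and> smooth_fun_on M W' f"
  shows "smooth_fun_on M W f"
proof (rule smooth_fun_onI)
  fix U \<phi> assume c: "(U, \<phi>) \<in> atlas M"
  show "smooth_on (\<phi> ` (U \<inter> W)) (\<lambda>x. f (inv_into U \<phi> x))"
  proof (rule smooth_on_local)
    fix x assume "x \<in> \<phi> ` (U \<inter> W)"
    then obtain p where p: "p \<in> U" "p \<in> W" "x = \<phi> p" by auto
    then obtain W' where W': "openin (mtop M) W'" "p \<in> W'" "smooth_fun_on M W' f"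
      using assms[of p] openin_subset[OF openin_chart[OF c]] by auto
    show "\<exists>T. open T \<and> x \<in> T \<and> smooth_on T (\<lambda>x. f (inv_into U \<phi> x))"
      by (rule exI[of _ "\<phi> ` (U \<inter> W')"])
        (use p W' open_chart_image[OF c] smooth_fun_onD[OF _ c] in auto)
  qed
qed

lemma smooth_fun_on_const: "smooth_fun_on M W (\<lambda>p. c)"
  by (rule smooth_fun_onI) (rule smooth_on_const)

lemma smooth_fun_on_bounded_linear:
  "bounded_linear L \<Longrightarrow> openin (mtop M) W \<Longrightarrow> smooth_fun_on M W f \<Longrightarrow> smooth_fun_on M W (\<lambda>p. L (f p))"
  by (rule smooth_fun_onI, rule smooth_on_bounded_linear, assumption, erule (1) open_chart_image, erule (1) smooth_fun_onD)

lemma smooth_fun_on_add: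
  "openin (mtop M) W \<Longrightarrow> smooth_fun_on M W f \<Longrightarrow> smooth_fun_on M W g \<Longrightarrow> smooth_fun_on M W (\<lambda>p. f p + g p)"
  by (rule smooth_fun_onI, rule smooth_on_add, erule (1) open_chart_image, (erule (1) smooth_fun_onD)+)

lemma smooth_fun_on_sum:
  "openin (mtop M) W \<Longrightarrow> (\<And>i. i \<in> I \<Longrightarrow> smooth_fun_on M W (f i)) \<Longrightarrow> smooth_fun_on M W (\<lambda>p. \<Sum>i\<in>I. f i p)"
  by (rule smooth_fun_onI, rule smooth_on_sum, erule (1) open_chart_image) (rule smooth_fun_onD)

lemma smooth_fun_on_bilinear:
  "bounded_bilinear B \<Longrightarrow> openin (mtop M) W \<Longrightarrow> smooth_fun_on M W f \<Longrightarrow> smooth_fun_on M W g \<Longrightarrow>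
   smooth_fun_on M W (\<lambda>p. B (f p) (g p))"
  by (rule smooth_fun_onI, rule smooth_on_bilinear, assumption, erule (1) open_chart_image, (erule (1) smooth_fun_onD)+)

lemma smooth_fun_on_Pair:
  "openin (mtop M) W \<Longrightarrow> smooth_fun_on M W f \<Longrightarrow> smooth_fun_on M W g \<Longrightarrow> smooth_fun_on M W (\<lambda>p. (f p, g p))"
  by (rule smooth_fun_onI, rule smooth_on_Pair, erule (1) open_chart_image, (erule (1) smooth_fun_onD)+)

lemma smooth_fun_on_componentwise:
  fixes f :: "'m \<Rightarrow> 'b::euclidean_space"
  shows "openin (mtop M) W \<Longrightarrow> (\<And>b. b \<in> Basis \<Longrightarrow> smooth_fun_on M W (\<lambda>p. f p \<bullet> b)) \<Longrightarrow> smooth_fun_on M W f"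
  by (rule smooth_fun_onI, rule smooth_on_componentwise, erule (1) open_chart_image) (rule smooth_fun_onD)

lemma smooth_fun_on_linear_system:
  fixes A :: "'m \<Rightarrow> real^'n^'n"
  assumes "openin (mtop M) W" "smooth_fun_on M W A" "smooth_fun_on M W b"
    and "\<And>p. p \<in> W \<Longrightarrow> invertible (A p)" "\<And>p. p \<in> W \<Longrightarrow> A p *v c p = b p"
  shows "smooth_fun_on M W c"
proof (rule smooth_fun_onI)
  fix U \<phi> assume c: "(U, \<phi>) \<in> atlas M"
  show "smooth_on (\<phi> ` (U \<inter> W)) (\<lambda>x. c (inv_into U \<phi> x))"
    by (rule smooth_on_linear_system[OF open_chart_image[OF c assms(1)]
          smooth_fun_onD[OF assms(2) c] smooth_fun_onD[OF assms(3) c]])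
      (auto simp: inv_chart[OF c] assms(4,5))
qed

lemma smooth_fun_on_compose_euclidean:
  fixes f :: "'m \<Rightarrow> 'b::euclidean_space"
  assumes "openin (mtop M) W" "smooth_fun_on M W f" "smooth_on S h" "open S" "\<And>p. p \<in> W \<Longrightarrow> f p \<in> S"
  shows "smooth_fun_on M W (\<lambda>p. h (f p))"
proof (rule smooth_fun_onI)
  fix U \<phi> assume c: "(U, \<phi>) \<in> atlas M"
  show "smooth_on (\<phi> ` (U \<inter> W)) (\<lambda>x. h (f (inv_into U \<phi> x)))"
    by (rule smooth_on_compose[OF open_chart_image[OF c assms(1)] assms(4) _ smooth_fun_onD[OF assms(2) c] assms(3)])
      (auto simp: inv_chart[OF c] assms(5))
qed

lemma smooth_fun_on_vimage_open:
  fixes f :: "'m \<Rightarrow> 'b::real_normed_vector"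
  assumes "openin (mtop M) W" "smooth_fun_on M W f" "open S"
  shows "openin (mtop M) (W \<inter> f -` S)"
proof (subst openin_subopen, intro ballI)
  fix p assume p: "p \<in> W \<inter> f -` S"
  then obtain U \<phi> where c: "(U, \<phi>) \<in> atlas M" "p \<in> U"
    using obtain_chart openin_subset[OF assms(1)] by blast
  let ?T = "\<phi> ` (U \<inter> W) \<inter> (\<lambda>x. f (inv_into U \<phi> x)) -` S"
  have "open ?T"
    using smooth_on_imp_continuous_on[OF smooth_fun_onD[OF assms(2) c(1)]] open_chart_image[OF c(1) assms(1)] assms(3)
    by (simp add: continuous_on_open_vimage Int_commute)
  then have "openin (mtop M) (U \<inter> \<phi> -` ?T)" by (rule openin_chart_vimage[OF c(1)])
  moreover have "U \<inter> \<phi> -` ?T \<subseteq> W \<inter> f -` S"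
  proof
    fix x assume x: "x \<in> U \<inter> \<phi> -` ?T"
    then obtain y where "y \<in> U" "y \<in> W" "\<phi> x = \<phi> y" by auto
    moreover from this x have "x = y" using inj_on_chart[OF c(1)] by (auto dest: inj_onD)
    ultimately show "x \<in> W \<inter> f -` S" using x by (simp add: inv_chart[OF c(1)])
  qed
  moreover have "p \<in> U \<inter> \<phi> -` ?T" using p c(2) by (simp add: inv_chart[OF c(1)])
  ultimately show "\<exists>T. openin (mtop M) T \<and> p \<in> T \<and> T \<subseteq> W \<inter> f -` S"
    by (intro exI[of _ "U \<inter> \<phi> -` ?T"] conjI)
qed

lemma smooth_fun_on_continuous_map:
  fixes f :: "'m \<Rightarrow> 'b::real_normed_vector"
  assumes "smooth_fun_on M (topspace (mtop M)) f"
  shows "continuous_map (mtop M) euclidean f"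
  unfolding continuous_map_def
proof (intro conjI allI impI)
  fix S :: "'b set" assume "openin euclidean S"
  then have "openin (mtop M) (topspace (mtop M) \<inter> f -` S)"
    by (intro smooth_fun_on_vimage_open assms) auto
  moreover have "topspace (mtop M) \<inter> f -` S = {x \<in> topspace (mtop M). f x \<in> S}" by auto
  ultimately show "openin (mtop M) {x \<in> topspace (mtop M). f x \<in> S}" by simp
qed auto

lemma smooth_nearI: "openin (mtop M) W \<Longrightarrow> p \<in> W \<Longrightarrow> smooth_fun_on M W f \<Longrightarrow> smooth_near M p f"
  unfolding smooth_near_def by blast

lemma smooth_nearE:
  assumes "smooth_near M p f"
  obtains W where "openin (mtop M) W" "p \<in> W" "smooth_fun_on M W f"
  using assms unfolding smooth_near_def by blast

lemma smooth_near_topspace: "smooth_near M p f \<Longrightarrow> p \<in> topspace (mtop M)"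
  by (meson openin_subset smooth_nearE subsetD)

lemma smooth_near_const: "p \<in> topspace (mtop M) \<Longrightarrow> smooth_near M p (\<lambda>x. c)"
  by (rule smooth_nearI[OF openin_topspace]) (auto simp: smooth_fun_on_const)

lemma smooth_near_bilinear:
  assumes "bounded_bilinear B" "smooth_near M p f" "smooth_near M p g"
  shows "smooth_near M p (\<lambda>x. B (f x) (g x))"
proof -
  obtain V W where "openin (mtop M) V" "p \<in> V" "smooth_fun_on M V f"
    "openin (mtop M) W" "p \<in> W" "smooth_fun_on M W g"
    using assms(2,3) smooth_nearE by metis
  then show ?thesis
    by (intro smooth_nearI[of "V \<inter> W"] smooth_fun_on_bilinear[OF assms(1)])
      (auto intro: smooth_fun_on_subset)
qed

lemma smooth_near_add:
  assumes "smooth_near M p f" "smooth_near M p g"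
  shows "smooth_near M p (\<lambda>x. f x + g x)"
proof -
  obtain V W where "openin (mtop M) V" "p \<in> V" "smooth_fun_on M V f"
    "openin (mtop M) W" "p \<in> W" "smooth_fun_on M W g"
    using assms smooth_nearE by metis
  then show ?thesis
    by (intro smooth_nearI[of "V \<inter> W"] smooth_fun_on_add) (auto intro: smooth_fun_on_subset)
qed

lemma smooth_near_mult:
  fixes f g :: "'m \<Rightarrow> real"
  shows "smooth_near M p f \<Longrightarrow> smooth_near M p g \<Longrightarrow> smooth_near M p (\<lambda>x. f x * g x)"
  by (rule smooth_near_bilinear[OF bounded_bilinear_mult])

lemma smooth_near_bounded_linear:
  "bounded_linear L \<Longrightarrow> smooth_near M p f \<Longrightarrow> smooth_near M p (\<lambda>x. L (f x))"
  unfolding smooth_near_def using smooth_fun_on_bounded_linear by blast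

lemma smooth_near_inner: "smooth_near M p f \<Longrightarrow> smooth_near M p (\<lambda>x. f x \<bullet> b)"
  by (rule smooth_near_bounded_linear[OF bounded_linear_inner_left])

lemma smooth_near_sum:
  "p \<in> topspace (mtop M) \<Longrightarrow> (\<And>i. i \<in> I \<Longrightarrow> smooth_near M p (f i)) \<Longrightarrow> smooth_near M p (\<lambda>x. \<Sum>i\<in>I. f i x)"
  by (induction I rule: infinite_finite_induct) (auto intro: smooth_near_add smooth_near_const)

lemma smooth_near_cong:
  assumes "smooth_near M p f" "openin (mtop M) W" "p \<in> W" "\<And>x. x \<in> W \<Longrightarrow> f x = g x"
  shows "smooth_near M p g"
proof -
  obtain V where "openin (mtop M) V" "p \<in> V" "smooth_fun_on M V f" by (rule smooth_nearE[OF assms(1)])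
  then show ?thesis using assms(2-4)
    by (intro smooth_nearI[of "V \<inter> W"] smooth_fun_on_cong[of "V \<inter> W" f g])
      (auto intro: smooth_fun_on_subset)
qed

end

locale smooth_charted = charted M for M :: "('m, 'e::euclidean_space) mfd" +
  assumes smooth_transition: "(U, \<phi>) \<in> atlas M \<Longrightarrow> (V, \<psi>) \<in> atlas M \<Longrightarrow>
    smooth_on (\<phi> ` (U \<inter> V)) (\<lambda>x. \<psi> (inv_into U \<phi> x))"
begin

lemma smooth_fun_on_chart: "(U, \<phi>) \<in> atlas M \<Longrightarrow> smooth_fun_on M U \<phi>"
  by (rule smooth_fun_onI) (rule smooth_transition)

lemma smooth_near_chart: "(U, \<phi>) \<in> atlas M \<Longrightarrow> p \<in> U \<Longrightarrow> smooth_near M p \<phi>"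
  by (rule smooth_nearI[OF openin_chart _ smooth_fun_on_chart])

lemma smooth_fun_on_chart_compose:
  assumes "(U, \<phi>) \<in> atlas M" "smooth_on S h" "open S"
  shows "smooth_fun_on M (U \<inter> \<phi> -` S) (\<lambda>p. h (\<phi> p))"
  by (rule smooth_fun_on_compose_euclidean[OF openin_chart_vimage[OF assms(1,3)] _ assms(2,3)])
    (auto intro: smooth_fun_on_subset[OF smooth_fun_on_chart[OF assms(1)]])

end

lemma smooth_manifold_smooth_charted:
  assumes "smooth_manifold M"
  shows "smooth_charted M"
proof
  note M = assms[unfolded smooth_manifold_def]
  show "topspace (mtop M) = \<Union> (fst ` atlas M)" using M by blast
  fix U \<phi> assume c: "(U, \<phi>) \<in> atlas M"
  then have U: "openin (mtop M) U" "open (\<phi> ` U)"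
    and h: "homeomorphic_map (subtopology (mtop M) U) (top_of_set (\<phi> ` U)) \<phi>"
    using M by blast+
  have top: "topspace (subtopology (mtop M) U) = U"
    using openin_subset[OF U(1)] by auto
  show "openin (mtop M) U" by fact
  show "inj_on \<phi> U" using homeomorphic_imp_injective_map[OF h] top by simp
  show "open (\<phi> ` (U \<inter> W))" if "openin (mtop M) W" for W
  proof -
    have "openin (subtopology (mtop M) U) (U \<inter> W)"
      using that by (auto simp: openin_subtopology)
    then have "openin (top_of_set (\<phi> ` U)) (\<phi> ` (U \<inter> W))"
      using homeomorphic_imp_open_map[OF h] by (simp add: open_map_def)
    then show ?thesis using U(2) openin_open_trans by blast
  qed
  show "openin (mtop M) (U \<inter> \<phi> -` S)" if "open S" for S
  proof -
    have "openin (top_of_set (\<phi> ` U)) (\<phi> ` U \<inter> S)" using that by auto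
    then have "openin (subtopology (mtop M) U) {x \<in> topspace (subtopology (mtop M) U). \<phi> x \<in> \<phi> ` U \<inter> S}"
      using homeomorphic_imp_continuous_map[OF h] by (blast intro: openin_continuous_map_preimage)
    moreover have "{x \<in> topspace (subtopology (mtop M) U). \<phi> x \<in> \<phi> ` U \<inter> S} = U \<inter> \<phi> -` S"
      unfolding top by auto
    ultimately show ?thesis using U(1) openin_trans_full by metis
  qed
  show "smooth_on (\<phi> ` (U \<inter> V)) (\<lambda>x. \<psi> (inv_into U \<phi> x))" if "(V, \<psi>) \<in> atlas M" for V \<psi>
    using M c that unfolding o_def by blast
qed

lemma smooth_mapI:
  assumes "continuous_map (mtop M) (mtop N) F"
    "\<And>V \<psi>. (V, \<psi>) \<in> atlas N \<Longrightarrow> smooth_fun_on M (F -` V) (\<lambda>x. \<psi> (F x))"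
  shows "smooth_map M N F"
  using assms unfolding smooth_map_def smooth_fun_on_def by (fastforce simp: o_def)

lemma smooth_map_continuous: "smooth_map M N F \<Longrightarrow> continuous_map (mtop M) (mtop N) F"
  by (simp add: smooth_map_def)

lemma smooth_map_chart:
  "smooth_map M N F \<Longrightarrow> (V, \<psi>) \<in> atlas N \<Longrightarrow> smooth_fun_on M (F -` V) (\<lambda>x. \<psi> (F x))"
  unfolding smooth_map_def smooth_fun_on_def by (auto simp: o_def)

lemma smooth_map_topspace: "smooth_map M N F \<Longrightarrow> p \<in> topspace (mtop M) \<Longrightarrow> F p \<in> topspace (mtop N)"
  using smooth_map_continuous by (fastforce simp: continuous_map_def)

lemma smooth_map_vimage_open:
  "smooth_map M N F \<Longrightarrow> openin (mtop N) W \<Longrightarrow> openin (mtop M) {x \<in> topspace (mtop M). F x \<in> W}"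
  by (rule openin_continuous_map_preimage[OF smooth_map_continuous])

text \<open>Near each point, \<open>f \<circ> F\<close> factors through a chart of \<open>N\<close> as a smooth Euclidean map after the
  smooth function \<open>\<psi> \<circ> F\<close>.\<close>

lemma smooth_fun_on_compose:
  assumes "charted M" "charted N" and F: "smooth_map M N F"
    and W: "openin (mtop N) W" "smooth_fun_on N W f"
  shows "smooth_fun_on M (topspace (mtop M) \<inter> F -` W) (\<lambda>x. f (F x))"
proof -
  interpret M: charted M by fact
  interpret N: charted N by fact
  show ?thesis
  proof (rule M.smooth_fun_on_local)
    fix p assume p: "p \<in> topspace (mtop M) \<inter> F -` W" "p \<in> topspace (mtop M)"
    then have "F p \<in> topspace (mtop N)" using openin_subset[OF W(1)] by auto
    then obtain V \<psi> where c: "(V, \<psi>) \<in> atlas N" "F p \<in> V" by (rule N.obtain_chart)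
    let ?O = "{x \<in> topspace (mtop M). F x \<in> V \<inter> W}"
    have O: "openin (mtop M) ?O"
      using F openin_Int[OF N.openin_chart[OF c(1)] W(1)] by (rule smooth_map_vimage_open)
    have "smooth_fun_on M (F -` V) (\<lambda>x. \<psi> (F x))" using F c(1) by (rule smooth_map_chart)
    then have "smooth_fun_on M ?O (\<lambda>x. \<psi> (F x))" by (rule M.smooth_fun_on_subset) auto
    then have "smooth_fun_on M ?O (\<lambda>x. f (inv_into V \<psi> (\<psi> (F x))))"
      by (rule M.smooth_fun_on_compose_euclidean[OF O _ N.smooth_fun_onD[OF W(2) c(1)]
            N.open_chart_image[OF c(1) W(1)]]) auto
    then have "smooth_fun_on M ?O (\<lambda>x. f (F x))"
      by (rule M.smooth_fun_on_cong[OF _ O]) (simp add: N.inv_chart[OF c(1)])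
    then show "\<exists>W'. openin (mtop M) W' \<and> p \<in> W' \<and> smooth_fun_on M W' (\<lambda>x. f (F x))"
      using O p c by blast
  qed
qed

lemma smooth_near_compose:
  assumes "charted M" "charted N" "smooth_map M N F" "p \<in> topspace (mtop M)" "smooth_near N (F p) f"
  shows "smooth_near M p (\<lambda>x. f (F x))"
proof -
  obtain W where W: "openin (mtop N) W" "F p \<in> W" "smooth_fun_on N W f"
    using assms(5) unfolding smooth_near_def by blast
  have "openin (mtop M) {x \<in> topspace (mtop M). F x \<in> W}"
    using assms(3) W(1) by (rule smooth_map_vimage_open)
  moreover have "topspace (mtop M) \<inter> F -` W = {x \<in> topspace (mtop M). F x \<in> W}" by auto
  ultimately show ?thesis
    using smooth_fun_on_compose[OF assms(1-3) W(1,3)] W(2) assms(4) unfolding smooth_near_def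
    by (intro exI[of _ "topspace (mtop M) \<inter> F -` W"]) simp
qed

lemma smooth_map_compose:
  assumes "charted M" "charted N" "charted K" and F: "smooth_map M N F" and H: "smooth_map N K H"
  shows "smooth_map M K (\<lambda>x. H (F x))"
proof (rule smooth_mapI)
  show "continuous_map (mtop M) (mtop K) (\<lambda>x. H (F x))"
    using continuous_map_compose[OF F[THEN smooth_map_continuous] H[THEN smooth_map_continuous]]
    by (simp add: o_def)
next
  fix V \<psi> assume c: "(V, \<psi>) \<in> atlas K"
  interpret N: charted N by fact
  interpret M: charted M by fact
  interpret K: charted K by fact
  let ?W = "{y \<in> topspace (mtop N). H y \<in> V}"
  have "openin (mtop N) ?W"
    using H K.openin_chart[OF c] by (rule smooth_map_vimage_open)
  moreover have "smooth_fun_on N ?W (\<lambda>y. \<psi> (H y))"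
    by (rule N.smooth_fun_on_subset[OF smooth_map_chart[OF H c]]) auto
  ultimately have "smooth_fun_on M (topspace (mtop M) \<inter> F -` ?W) (\<lambda>x. \<psi> (H (F x)))"
    by (rule smooth_fun_on_compose[OF assms(1,2) F])
  moreover have "U \<inter> (\<lambda>x. H (F x)) -` V = U \<inter> (topspace (mtop M) \<inter> F -` ?W)" if "(U, \<phi>) \<in> atlas M" for U \<phi>
    using openin_subset[OF M.openin_chart[OF that]] smooth_map_topspace[OF F] by auto
  ultimately show "smooth_fun_on M ((\<lambda>x. H (F x)) -` V) (\<lambda>x. \<psi> (H (F x)))"
    unfolding smooth_fun_on_def by auto
qed

lemma smooth_charted_euclidean: "smooth_charted (euclidean_mfd :: ('e::euclidean_space, 'e) mfd)"
proof
  fix U V :: "'e set" and \<phi> \<psi> :: "'e \<Rightarrow> 'e"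
  assume c: "(U, \<phi>) \<in> atlas euclidean_mfd" "(V, \<psi>) \<in> atlas euclidean_mfd"
  have "smooth_on UNIV (\<lambda>x::'e. x)" by (rule smooth_on_id) simp
  then show "smooth_on (\<phi> ` (U \<inter> V)) (\<lambda>x. \<psi> (inv_into U \<phi> x))"
    using c inv_into_f_f[of "\<lambda>x::'e. x" UNIV] by (simp add: euclidean_mfd_def)
qed (auto simp: euclidean_mfd_def)

lemma atlas_prodE:
  assumes "(A, \<kappa>) \<in> atlas (prod_mfd M K)"
  obtains U \<phi> V \<psi> where "A = U \<times> V" "\<kappa> = (\<lambda>(x, y). (\<phi> x, \<psi> y))" "(U, \<phi>) \<in> atlas M" "(V, \<psi>) \<in> atlas K"
  using assms unfolding prod_mfd_def by auto

lemma atlas_prodI: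
  "(U, \<phi>) \<in> atlas M \<Longrightarrow> (V, \<psi>) \<in> atlas K \<Longrightarrow> (U \<times> V, \<lambda>(x, y). (\<phi> x, \<psi> y)) \<in> atlas (prod_mfd M K)"
  unfolding prod_mfd_def by auto

lemma mtop_prod: "mtop (prod_mfd M K) = prod_topology (mtop M) (mtop K)"
  by (simp add: prod_mfd_def)

lemma inv_into_prod:
  assumes "inj_on \<phi> U" "inj_on \<psi> V" "a \<in> \<phi> ` U" "b \<in> \<psi> ` V"
  shows "inv_into (U \<times> V) (\<lambda>(x, y). (\<phi> x, \<psi> y)) (a, b) = (inv_into U \<phi> a, inv_into V \<psi> b)"
proof (rule inv_into_f_eq)
  show "inj_on (\<lambda>(x, y). (\<phi> x, \<psi> y)) (U \<times> V)" using assms(1,2) by (auto simp: inj_on_def)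
qed (use assms(3,4) in \<open>auto simp: f_inv_into_f inv_into_into\<close>)

lemma smooth_charted_prod:
  assumes "smooth_charted M" "smooth_charted K"
  shows "smooth_charted (prod_mfd M K)"
proof -
  interpret M: smooth_charted M by fact
  interpret K: smooth_charted K by fact
  show ?thesis
  proof
    show "topspace (mtop (prod_mfd M K)) = \<Union> (fst ` atlas (prod_mfd M K))" (is "?l = ?r")
    proof
      show "?l \<subseteq> ?r"
      proof
        fix z assume "z \<in> ?l"
        then obtain x y where z: "z = (x, y)" "x \<in> topspace (mtop M)" "y \<in> topspace (mtop K)"
          by (auto simp: mtop_prod)
        obtain U \<phi> V \<psi> where "(U, \<phi>) \<in> atlas M" "x \<in> U" "(V, \<psi>) \<in> atlas K" "y \<in> V"
          using z M.obtain_chart K.obtain_chart by metis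
        then show "z \<in> ?r" using z(1)
            by (intro UnionI[of "U \<times> V"] image_eqI[where x = "(U \<times> V, \<lambda>(x, y). (\<phi> x, \<psi> y))"] atlas_prodI) auto
      qed
      show "?r \<subseteq> ?l"
      proof
        fix z assume "z \<in> ?r"
        then obtain A \<kappa> where A: "(A, \<kappa>) \<in> atlas (prod_mfd M K)" "z \<in> A" by auto
        moreover from A(1) obtain U \<phi> V \<psi> where "A = U \<times> V" "\<kappa> = (\<lambda>(x, y). (\<phi> x, \<psi> y))"
          "(U, \<phi>) \<in> atlas M" "(V, \<psi>) \<in> atlas K" by (rule atlas_prodE)
        moreover from this have "U \<subseteq> topspace (mtop M)" "V \<subseteq> topspace (mtop K)"
          by (simp_all add: openin_subset[OF M.openin_chart] openin_subset[OF K.openin_chart])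
        ultimately show "z \<in> ?l" by (auto simp: mtop_prod)
      qed
    qed
  next
    fix A \<kappa> assume "(A, \<kappa>) \<in> atlas (prod_mfd M K)"
    then obtain U \<phi> V \<psi> where A: "A = U \<times> V" and k: "\<kappa> = (\<lambda>(x, y). (\<phi> x, \<psi> y))"
      and c: "(U, \<phi>) \<in> atlas M" "(V, \<psi>) \<in> atlas K" by (rule atlas_prodE)
    show "openin (mtop (prod_mfd M K)) A"
      unfolding A mtop_prod using M.openin_chart[OF c(1)] K.openin_chart[OF c(2)] by (simp add: openin_prod_Times_iff)
    show "inj_on \<kappa> A"
      using M.inj_on_chart[OF c(1)] K.inj_on_chart[OF c(2)] unfolding A k by (auto simp: inj_on_def)
    show "open (\<kappa> ` (A \<inter> W))" if "openin (mtop (prod_mfd M K)) W" for W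
      unfolding open_prod_def
    proof
      fix z assume "z \<in> \<kappa> ` (A \<inter> W)"
      then obtain x y where z: "z = (\<phi> x, \<psi> y)" "x \<in> U" "y \<in> V" "(x, y) \<in> W" unfolding A k by auto
      have "\<exists>P Q. openin (mtop M) P \<and> openin (mtop K) Q \<and> x \<in> P \<and> y \<in> Q \<and> P \<times> Q \<subseteq> W"
        using that z(4) by (simp add: mtop_prod openin_prod_topology_alt)
      then obtain P Q where PQ: "openin (mtop M) P" "openin (mtop K) Q" "x \<in> P" "y \<in> Q" "P \<times> Q \<subseteq> W"
        by metis
      have "open (\<phi> ` (U \<inter> P)) \<and> open (\<psi> ` (V \<inter> Q)) \<and> z \<in> \<phi> ` (U \<inter> P) \<times> \<psi> ` (V \<inter> Q)"
        using M.open_chart_image[OF c(1) PQ(1)] K.open_chart_image[OF c(2) PQ(2)] z PQ by auto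
      moreover have "\<phi> ` (U \<inter> P) \<times> \<psi> ` (V \<inter> Q) \<subseteq> \<kappa> ` (A \<inter> W)"
      proof
        fix w assume "w \<in> \<phi> ` (U \<inter> P) \<times> \<psi> ` (V \<inter> Q)"
        then obtain x' y' where "w = \<kappa> (x', y')" "(x', y') \<in> A \<inter> W" using PQ(5) unfolding A k by auto
        then show "w \<in> \<kappa> ` (A \<inter> W)" by (rule image_eqI)
      qed
      ultimately show "\<exists>P Q. open P \<and> open Q \<and> z \<in> P \<times> Q \<and> P \<times> Q \<subseteq> \<kappa> ` (A \<inter> W)" by blast
    qed
    show "openin (mtop (prod_mfd M K)) (A \<inter> \<kappa> -` S)" if "open S" for S
      unfolding mtop_prod openin_prod_topology_alt
    proof (intro allI impI)
      fix x y assume xy: "(x, y) \<in> A \<inter> \<kappa> -` S"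
      then have "(\<phi> x, \<psi> y) \<in> S" unfolding k by simp
      from open_prod_elim[OF \<open>open S\<close> this]
      obtain P Q where PQ: "open P" "open Q" "\<phi> x \<in> P" "\<psi> y \<in> Q" "P \<times> Q \<subseteq> S"
        by (metis mem_Sigma_iff)
      have "openin (mtop M) (U \<inter> \<phi> -` P)" "openin (mtop K) (V \<inter> \<psi> -` Q)"
        using M.openin_chart_vimage[OF c(1) PQ(1)] K.openin_chart_vimage[OF c(2) PQ(2)] .
      moreover have "x \<in> U \<inter> \<phi> -` P" "y \<in> V \<inter> \<psi> -` Q" using xy PQ unfolding A by auto
      moreover have "(U \<inter> \<phi> -` P) \<times> (V \<inter> \<psi> -` Q) \<subseteq> A \<inter> \<kappa> -` S" using PQ(5) unfolding A k by auto
      ultimately show "\<exists>P Q. openin (mtop M) P \<and> openin (mtop K) Q \<and> x \<in> P \<and> y \<in> Q \<and> P \<times> Q \<subseteq> A \<inter> \<kappa> -` S"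
        by blast
    qed
    fix A' \<kappa>' assume "(A', \<kappa>') \<in> atlas (prod_mfd M K)"
    then obtain U' \<phi>' V' \<psi>' where A': "A' = U' \<times> V'" and k': "\<kappa>' = (\<lambda>(x, y). (\<phi>' x, \<psi>' y))"
      and c': "(U', \<phi>') \<in> atlas M" "(V', \<psi>') \<in> atlas K" by (rule atlas_prodE)
    have im: "\<kappa> ` (A \<inter> A') = \<phi> ` (U \<inter> U') \<times> \<psi> ` (V \<inter> V')"
      unfolding A A' k by (auto simp: image_iff)
    have op: "open (\<phi> ` (U \<inter> U'))" "open (\<psi> ` (V \<inter> V'))"
      using M.open_chart_image[OF c(1) M.openin_chart[OF c'(1)]]
        K.open_chart_image[OF c(2) K.openin_chart[OF c'(2)]] .
    show "smooth_on (\<kappa> ` (A \<inter> A')) (\<lambda>z. \<kappa>' (inv_into A \<kappa> z))"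
      unfolding im
    proof (rule smooth_on_cong)
      let ?S = "\<phi> ` (U \<inter> U') \<times> \<psi> ` (V \<inter> V')"
      show S: "open ?S" using op by (rule open_Times)
      have fs: "smooth_on ?S fst" "smooth_on ?S snd"
        using smooth_on_bounded_linear[OF bounded_linear_fst S smooth_on_id[OF S]]
          smooth_on_bounded_linear[OF bounded_linear_snd S smooth_on_id[OF S]] by simp_all
      show "smooth_on ?S (\<lambda>z. (\<phi>' (inv_into U \<phi> (fst z)), \<psi>' (inv_into V \<psi> (snd z))))"
        by (intro smooth_on_Pair S smooth_on_compose[OF S op(1) _ fs(1) M.smooth_transition[OF c(1) c'(1)]]
            smooth_on_compose[OF S op(2) _ fs(2) K.smooth_transition[OF c(2) c'(2)]]) auto
      show "(\<phi>' (inv_into U \<phi> (fst z)), \<psi>' (inv_into V \<psi> (snd z))) = \<kappa>' (inv_into A \<kappa> z)" if "z \<in> ?S" for z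
      proof (cases z)
        case (Pair a b)
        then have "a \<in> \<phi> ` U" "b \<in> \<psi> ` V" using that by auto
        then show ?thesis
          using inv_into_prod[OF M.inj_on_chart[OF c(1)] K.inj_on_chart[OF c(2)]] unfolding A k k' Pair by simp
      qed
    qed
  qed
qed

lemma smooth_map_projections:
  assumes "smooth_charted M" "smooth_charted K"
  shows smooth_map_fst: "smooth_map (prod_mfd M K) M fst" and smooth_map_snd: "smooth_map (prod_mfd M K) K snd"
proof -
  interpret M: smooth_charted M by fact
  interpret K: smooth_charted K by fact
  let ?N = "prod_mfd M K"
  interpret N: smooth_charted ?N using assms by (rule smooth_charted_prod)
  have box: "openin (mtop ?N) (U \<times> V)" "smooth_fun_on ?N (U \<times> V) (\<lambda>z. \<phi> (fst z))"
    "smooth_fun_on ?N (U \<times> V) (\<lambda>z. \<psi> (snd z))"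
    if "(U, \<phi>) \<in> atlas M" "(V, \<psi>) \<in> atlas K" for U \<phi> V \<psi>
  proof -
    note c = atlas_prodI[OF that]
    note s = N.smooth_fun_on_bounded_linear[OF _ N.openin_chart[OF c] N.smooth_fun_on_chart[OF c]]
    show "openin (mtop ?N) (U \<times> V)" by (rule N.openin_chart[OF c])
    show "smooth_fun_on ?N (U \<times> V) (\<lambda>z. \<phi> (fst z))" "smooth_fun_on ?N (U \<times> V) (\<lambda>z. \<psi> (snd z))"
      using s[OF bounded_linear_fst] s[OF bounded_linear_snd] by (simp_all add: case_prod_beta)
  qed
  show "smooth_map ?N M fst"
  proof (rule smooth_mapI)
    show "continuous_map (mtop ?N) (mtop M) fst" by (simp add: mtop_prod continuous_map_fst)
    fix U \<phi> assume c: "(U, \<phi>) \<in> atlas M"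
    show "smooth_fun_on ?N (fst -` U) (\<lambda>z. \<phi> (fst z))"
    proof (rule N.smooth_fun_on_local)
      fix z assume z: "z \<in> fst -` U" "z \<in> topspace (mtop ?N)"
      then have "snd z \<in> topspace (mtop K)" by (auto simp: mtop_prod)
      then obtain V \<psi> where "(V, \<psi>) \<in> atlas K" "snd z \<in> V" by (rule K.obtain_chart)
      then show "\<exists>W. openin (mtop ?N) W \<and> z \<in> W \<and> smooth_fun_on ?N W (\<lambda>z. \<phi> (fst z))"
        using box(1,2)[OF c] z by (intro exI[of _ "U \<times> V"]) (auto simp: mem_Times_iff)
    qed
  qed
  show "smooth_map ?N K snd"
  proof (rule smooth_mapI)
    show "continuous_map (mtop ?N) (mtop K) snd" by (simp add: mtop_prod continuous_map_snd)
    fix V \<psi> assume c: "(V, \<psi>) \<in> atlas K"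
    show "smooth_fun_on ?N (snd -` V) (\<lambda>z. \<psi> (snd z))"
    proof (rule N.smooth_fun_on_local)
      fix z assume z: "z \<in> snd -` V" "z \<in> topspace (mtop ?N)"
      then have "fst z \<in> topspace (mtop M)" by (auto simp: mtop_prod)
      then obtain U \<phi> where "(U, \<phi>) \<in> atlas M" "fst z \<in> U" by (rule M.obtain_chart)
      then show "\<exists>W. openin (mtop ?N) W \<and> z \<in> W \<and> smooth_fun_on ?N W (\<lambda>z. \<psi> (snd z))"
        using box(1,3)[OF _ c] z by (intro exI[of _ "U \<times> V"]) (auto simp: mem_Times_iff)
    qed
  qed
qed

lemma smooth_map_Pair:
  assumes "smooth_charted L" "smooth_charted M" "smooth_charted K" "smooth_map L M F" "smooth_map L K H"
  shows "smooth_map L (prod_mfd M K) (\<lambda>x. (F x, H x))"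
proof -
  interpret L: smooth_charted L by fact
  interpret M: smooth_charted M by fact
  interpret K: smooth_charted K by fact
  show ?thesis
  proof (rule smooth_mapI)
    show "continuous_map (mtop L) (mtop (prod_mfd M K)) (\<lambda>x. (F x, H x))"
      unfolding mtop_prod using assms(4,5) by (intro continuous_map_pairedI smooth_map_continuous)
    fix A \<kappa> assume "(A, \<kappa>) \<in> atlas (prod_mfd M K)"
    then obtain U \<phi> V \<psi> where A: "A = U \<times> V" and k: "\<kappa> = (\<lambda>(x, y). (\<phi> x, \<psi> y))"
      and c: "(U, \<phi>) \<in> atlas M" "(V, \<psi>) \<in> atlas K" by (rule atlas_prodE)
    let ?W = "{x \<in> topspace (mtop L). F x \<in> U} \<inter> {x \<in> topspace (mtop L). H x \<in> V}"
    have W: "openin (mtop L) ?W"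
      using smooth_map_vimage_open[OF assms(4) M.openin_chart[OF c(1)]]
        smooth_map_vimage_open[OF assms(5) K.openin_chart[OF c(2)]] by (rule openin_Int)
    have "smooth_fun_on L ?W (\<lambda>x. (\<phi> (F x), \<psi> (H x)))"
      by (intro L.smooth_fun_on_Pair W L.smooth_fun_on_subset[OF smooth_map_chart[OF assms(4) c(1)]]
          L.smooth_fun_on_subset[OF smooth_map_chart[OF assms(5) c(2)]]) auto
    moreover have "X \<inter> (\<lambda>x. (F x, H x)) -` A = X \<inter> ?W" if "(X, \<xi>) \<in> atlas L" for X \<xi>
      using openin_subset[OF L.openin_chart[OF that]] unfolding A by auto
    ultimately show "smooth_fun_on L ((\<lambda>x. (F x, H x)) -` A) (\<lambda>x. \<kappa> (F x, H x))"
      unfolding smooth_fun_on_def k by auto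
  qed
qed

lemma smooth_map_const:
  assumes "charted L" "c \<in> topspace (mtop M)"
  shows "smooth_map L M (\<lambda>x. c)"
  using assms by (intro smooth_mapI) (auto simp: charted.smooth_fun_on_const)

lemma smooth_map_ident:
  assumes "smooth_charted M"
  shows "smooth_map M M (\<lambda>x. x)"
  using assms by (intro smooth_mapI) (auto simp: smooth_charted.smooth_fun_on_chart)

lemma smooth_map_to_euclidean:
  fixes f :: "'m \<Rightarrow> 'b::euclidean_space" and M :: "('m, 'e::euclidean_space) mfd"
  assumes "charted M" "smooth_fun_on M (topspace (mtop M)) f"
  shows "smooth_map M euclidean_mfd f"
proof (rule smooth_mapI)
  interpret charted M by fact
  show "continuous_map (mtop M) (mtop euclidean_mfd) f"
    using smooth_fun_on_continuous_map[OF assms(2)] by (simp add: euclidean_mfd_def)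
  fix V :: "'b set" and \<psi> :: "'b \<Rightarrow> 'b" assume "(V, \<psi>) \<in> atlas euclidean_mfd"
  moreover have "U \<inter> topspace (mtop M) = U" if "(U, \<phi>) \<in> atlas M" for U \<phi>
    using openin_subset[OF openin_chart[OF that]] by auto
  ultimately show "smooth_fun_on M (f -` V) (\<lambda>x. \<psi> (f x))"
    using assms(2) unfolding smooth_fun_on_def by (auto simp: euclidean_mfd_def)
qed

section \<open>Tangent vectors as derivations\<close>

lemma dir_deriv_inner: "b \<in> Basis \<Longrightarrow> dir_deriv \<xi> F \<bullet> b = \<xi> (\<lambda>x. F x \<bullet> b)"
  by (simp add: dir_deriv_def inner_sum_left_Basis)

lemma dir_deriv_real: "dir_deriv \<xi> f = \<xi> f"
  by (simp add: dir_deriv_def)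

context
  fixes M :: "('m, 'e::euclidean_space) mfd" and p :: 'm and \<xi> :: "'m tvec"
  assumes \<xi>: "\<xi> \<in> tangent_space M p"
begin

lemma tangent_add: "smooth_near M p f \<Longrightarrow> smooth_near M p h \<Longrightarrow> \<xi> (\<lambda>x. f x + h x) = \<xi> f + \<xi> h"
  using \<xi> unfolding tangent_space_def by blast

lemma tangent_mult: "smooth_near M p f \<Longrightarrow> smooth_near M p h \<Longrightarrow> \<xi> (\<lambda>x. f x * h x) = \<xi> f * h p + f p * \<xi> h"
  using \<xi> unfolding tangent_space_def by blast

lemma tangent_scale: "smooth_near M p f \<Longrightarrow> \<xi> (\<lambda>x. c * f x) = c * \<xi> f"
  using \<xi> unfolding tangent_space_def by blast

lemma tangent_local:
  "smooth_near M p f \<Longrightarrow> smooth_near M p h \<Longrightarrow> openin (mtop M) W \<Longrightarrow> p \<in> W \<Longrightarrow> (\<And>x. x \<in> W \<Longrightarrow> f x = h x) \<Longrightarrow> \<xi> f = \<xi> h"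
proof -
  have *: "\<forall>f h W. smooth_near M p f \<and> smooth_near M p h \<and> openin (mtop M) W \<and> p \<in> W \<and>
      (\<forall>x\<in>W. f x = h x) \<longrightarrow> \<xi> f = \<xi> h"
    using \<xi> unfolding tangent_space_def mem_Collect_eq by (elim conjE) assumption
  assume "smooth_near M p f" "smooth_near M p h" "openin (mtop M) W" "p \<in> W" "\<And>x. x \<in> W \<Longrightarrow> f x = h x"
  then show ?thesis by (intro *[THEN spec, THEN spec, THEN spec, THEN mp] conjI ballI)
qed

lemma tangent_not_smooth: "\<not> smooth_near M p f \<Longrightarrow> \<xi> f = 0"
  using \<xi> unfolding tangent_space_def by blast

end

lemma tangent_spaceI:
  assumes "\<And>f h. smooth_near M p f \<Longrightarrow> smooth_near M p h \<Longrightarrow> \<xi> (\<lambda>x. f x + h x) = \<xi> f + \<xi> h"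
    "\<And>f h. smooth_near M p f \<Longrightarrow> smooth_near M p h \<Longrightarrow> \<xi> (\<lambda>x. f x * h x) = \<xi> f * h p + f p * \<xi> h"
    "\<And>c f. smooth_near M p f \<Longrightarrow> \<xi> (\<lambda>x. c * f x) = c * \<xi> f"
    "\<And>f h W. smooth_near M p f \<Longrightarrow> smooth_near M p h \<Longrightarrow> openin (mtop M) W \<Longrightarrow> p \<in> W \<Longrightarrow>
      (\<And>x. x \<in> W \<Longrightarrow> f x = h x) \<Longrightarrow> \<xi> f = \<xi> h"
    "\<And>f. \<not> smooth_near M p f \<Longrightarrow> \<xi> f = 0"
  shows "\<xi> \<in> tangent_space M p"
  unfolding tangent_space_def mem_Collect_eq
  by (intro conjI allI impI; (elim conjE)?; (rule assms(1) assms(2) assms(3) assms(5) | rule assms(4)); (assumption | erule (1) bspec))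

lemma tangent_space_zero: "0 \<in> tangent_space M p"
  by (rule tangent_spaceI) auto

lemma tangent_space_plus:
  assumes "\<xi> \<in> tangent_space M p" "\<zeta> \<in> tangent_space M p"
  shows "\<xi> + \<zeta> \<in> tangent_space M p"
proof (rule tangent_spaceI)
  show "(\<xi> + \<zeta>) f = (\<xi> + \<zeta>) h" if "smooth_near M p f" "smooth_near M p h" "openin (mtop M) W" "p \<in> W"
    "\<And>x. x \<in> W \<Longrightarrow> f x = h x" for f h W
    using tangent_local[OF assms(1) that] tangent_local[OF assms(2) that] by simp
qed (simp_all add: tangent_add[OF assms(1)] tangent_add[OF assms(2)] tangent_mult[OF assms(1)]
    tangent_mult[OF assms(2)] tangent_scale[OF assms(1)] tangent_scale[OF assms(2)]
    tangent_not_smooth[OF assms(1)] tangent_not_smooth[OF assms(2)] algebra_simps)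

lemma tangent_space_scale:
  assumes "\<xi> \<in> tangent_space M p"
  shows "(\<lambda>f. c * \<xi> f) \<in> tangent_space M p"
proof (rule tangent_spaceI)
  show "c * \<xi> f = c * \<xi> h" if "smooth_near M p f" "smooth_near M p h" "openin (mtop M) W" "p \<in> W"
    "\<And>x. x \<in> W \<Longrightarrow> f x = h x" for f h W
    using tangent_local[OF assms that] by simp
qed (simp_all add: tangent_add[OF assms] tangent_mult[OF assms] tangent_scale[OF assms]
    tangent_not_smooth[OF assms] algebra_simps)

context charted
begin

text \<open>The Leibniz rule for \<open>1 = 1 * 1\<close>.\<close>

lemma tangent_const:
  assumes "\<xi> \<in> tangent_space M p"
  shows "\<xi> (\<lambda>x. c) = 0"
proof (cases "p \<in> topspace (mtop M)")
  case True
  have "\<xi> (\<lambda>x. 1 * 1) = \<xi> (\<lambda>x. 1) * 1 + 1 * \<xi> (\<lambda>x. 1)"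
    using True by (intro tangent_mult[OF assms] smooth_near_const)
  then have "\<xi> (\<lambda>x. 1) = 0" by simp
  moreover have "\<xi> (\<lambda>x. c * 1) = c * \<xi> (\<lambda>x. 1)"
    using True by (intro tangent_scale[OF assms] smooth_near_const)
  ultimately show ?thesis by simp
next
  case False
  then show ?thesis using tangent_not_smooth[OF assms] smooth_near_topspace by blast
qed

lemma tangent_sum:
  assumes "\<xi> \<in> tangent_space M p" "p \<in> topspace (mtop M)" "\<And>i. i \<in> I \<Longrightarrow> smooth_near M p (f i)"
  shows "\<xi> (\<lambda>x. \<Sum>i\<in>I. f i x) = (\<Sum>i\<in>I. \<xi> (f i))"
  using assms(3)
proof (induction I rule: infinite_finite_induct)
  case (insert i I)
  then have "smooth_near M p (\<lambda>x. \<Sum>i\<in>I. f i x)" by (intro smooth_near_sum assms(2)) auto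
  then show ?case using insert by (simp add: tangent_add[OF assms(1)])
qed (simp_all add: tangent_const[OF assms(1)])

lemma smooth_near_has_derivative:
  assumes "smooth_near M p f" "(U, \<phi>) \<in> atlas M" "p \<in> U"
  shows "((\<lambda>x. f (inv_into U \<phi> x)) has_derivative frechet_derivative (\<lambda>x. f (inv_into U \<phi> x)) (at (\<phi> p))) (at (\<phi> p))"
proof -
  obtain W where "openin (mtop M) W" "p \<in> W" "smooth_fun_on M W f" by (rule smooth_nearE[OF assms(1)])
  then show ?thesis
    using assms(3) by (intro smooth_on_has_derivative[OF smooth_fun_onD[OF _ assms(2)]]) auto
qed

lemma smooth_near_vfield:
  assumes "X \<in> vector_fields M" "smooth_near M p f"
  shows "smooth_near M p (\<lambda>q. X q f)"
  using assms unfolding vector_fields_def smooth_near_def by blast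

end

context smooth_charted
begin

text \<open>Only the values on the coordinate functions matter: by Hadamard's lemma, near \<open>p\<close> a smooth
  function is a constant plus a combination, with smooth coefficients, of coordinate functions
  that vanish at \<open>p\<close>.\<close>

lemma tangent_chart:
  assumes \<xi>: "\<xi> \<in> tangent_space M p" and c: "(U, \<phi>) \<in> atlas M" "p \<in> U" and f: "smooth_near M p f"
  shows "\<xi> f = frechet_derivative (\<lambda>x. f (inv_into U \<phi> x)) (at (\<phi> p)) (dir_deriv \<xi> \<phi>)"
proof -
  let ?F = "\<lambda>x. f (inv_into U \<phi> x)"
  obtain W where W: "openin (mtop M) W" "p \<in> W" "smooth_fun_on M W f" by (rule smooth_nearE[OF f])
  have p: "p \<in> topspace (mtop M)" using f by (rule smooth_near_topspace)
  have "open (\<phi> ` (U \<inter> W))" "\<phi> p \<in> \<phi> ` (U \<inter> W)"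
    using open_chart_image[OF c(1) W(1)] c(2) W(2) by auto
  then obtain r where r: "r > 0" "ball (\<phi> p) r \<subseteq> \<phi> ` (U \<inter> W)" by (meson openE)
  have "smooth_on (ball (\<phi> p) r) ?F"
    by (rule smooth_on_subset[OF smooth_fun_onD[OF W(3) c(1)] r(2)])
  then obtain G where G: "\<And>b. smooth_on (ball (\<phi> p) r) (G b)" "\<And>b. G b (\<phi> p) = frechet_derivative ?F (at (\<phi> p)) b"
    "\<And>x. x \<in> ball (\<phi> p) r \<Longrightarrow> ?F x = ?F (\<phi> p) + (\<Sum>b\<in>Basis. (x \<bullet> b - \<phi> p \<bullet> b) * G b x)"
    using Hadamard by blast
  let ?O = "U \<inter> \<phi> -` ball (\<phi> p) r"
  have O: "openin (mtop M) ?O" "p \<in> ?O" using openin_chart_vimage[OF c(1)] c(2) r(1) by auto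
  have Gb: "smooth_near M p (\<lambda>x. G b (\<phi> x))" for b
    by (rule smooth_nearI[OF O smooth_fun_on_chart_compose[OF c(1) G(1) open_ball]])
  have \<phi>b: "smooth_near M p (\<lambda>x. \<phi> x \<bullet> b + - (\<phi> p \<bullet> b))" for b
    using p by (intro smooth_near_add smooth_near_inner smooth_near_chart[OF c] smooth_near_const)
  have prod: "smooth_near M p (\<lambda>x. (\<phi> x \<bullet> b + - (\<phi> p \<bullet> b)) * G b (\<phi> x))" for b
    by (rule smooth_near_mult[OF \<phi>b Gb])
  have sum: "smooth_near M p (\<lambda>x. \<Sum>b\<in>Basis. (\<phi> x \<bullet> b + - (\<phi> p \<bullet> b)) * G b (\<phi> x))"
    using p prod by (intro smooth_near_sum)
  have "\<xi> f = \<xi> (\<lambda>x. f p + (\<Sum>b\<in>Basis. (\<phi> x \<bullet> b + - (\<phi> p \<bullet> b)) * G b (\<phi> x)))"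
  proof (rule tangent_local[OF \<xi> f _ O])
    show "smooth_near M p (\<lambda>x. f p + (\<Sum>b\<in>Basis. (\<phi> x \<bullet> b + - (\<phi> p \<bullet> b)) * G b (\<phi> x)))"
      using p sum by (intro smooth_near_add smooth_near_const)
    fix x assume "x \<in> ?O"
    then show "f x = f p + (\<Sum>b\<in>Basis. (\<phi> x \<bullet> b + - (\<phi> p \<bullet> b)) * G b (\<phi> x))"
      using G(3)[of "\<phi> x"] c(2) by (simp add: inv_into_f_f[OF inj_on_chart[OF c(1)]])
  qed
  also have "\<dots> = \<xi> (\<lambda>x. \<Sum>b\<in>Basis. (\<phi> x \<bullet> b + - (\<phi> p \<bullet> b)) * G b (\<phi> x))"
    using p sum by (simp only: tangent_add[OF \<xi> smooth_near_const sum] tangent_const[OF \<xi>] add_0_left)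
  also have "\<dots> = (\<Sum>b\<in>Basis. \<xi> (\<lambda>x. (\<phi> x \<bullet> b + - (\<phi> p \<bullet> b)) * G b (\<phi> x)))"
    by (rule tangent_sum[OF \<xi> p prod])
  also have "\<dots> = (\<Sum>b\<in>Basis. (dir_deriv \<xi> \<phi> \<bullet> b) * frechet_derivative ?F (at (\<phi> p)) b)"
  proof (rule sum.cong[OF refl])
    fix b :: 'e assume b: "b \<in> Basis"
    have "\<xi> (\<lambda>x. (\<phi> x \<bullet> b + - (\<phi> p \<bullet> b)) * G b (\<phi> x)) =
        \<xi> (\<lambda>x. \<phi> x \<bullet> b + - (\<phi> p \<bullet> b)) * G b (\<phi> p) + (\<phi> p \<bullet> b + - (\<phi> p \<bullet> b)) * \<xi> (\<lambda>x. G b (\<phi> x))"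
      by (rule tangent_mult[OF \<xi> \<phi>b Gb])
    also have "\<xi> (\<lambda>x. \<phi> x \<bullet> b + - (\<phi> p \<bullet> b)) = \<xi> (\<lambda>x. \<phi> x \<bullet> b) + \<xi> (\<lambda>x. - (\<phi> p \<bullet> b))"
      by (rule tangent_add[OF \<xi> smooth_near_inner[OF smooth_near_chart[OF c]] smooth_near_const[OF p]])
    finally show "\<xi> (\<lambda>x. (\<phi> x \<bullet> b + - (\<phi> p \<bullet> b)) * G b (\<phi> x)) =
        (dir_deriv \<xi> \<phi> \<bullet> b) * frechet_derivative ?F (at (\<phi> p)) b"
      by (simp add: dir_deriv_inner[OF b] G(2) tangent_const[OF \<xi>])
  qed
  also have "\<dots> = frechet_derivative ?F (at (\<phi> p)) (dir_deriv \<xi> \<phi>)"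
    using linear_Basis_expansion[OF has_derivative_linear[OF smooth_near_has_derivative[OF f c]], of "dir_deriv \<xi> \<phi>"]
    by simp
  finally show ?thesis .
qed

text \<open>In this form the rules for \<open>has_derivative\<close> carry over to tangent vectors.\<close>

lemma dir_deriv_chart:
  fixes F :: "'m \<Rightarrow> 'b::euclidean_space"
  assumes \<xi>: "\<xi> \<in> tangent_space M p" and c: "(U, \<phi>) \<in> atlas M" "p \<in> U" and f: "smooth_near M p F"
    and D: "((\<lambda>x. F (inv_into U \<phi> x)) has_derivative D) (at (\<phi> p))"
  shows "dir_deriv \<xi> F = D (dir_deriv \<xi> \<phi>)"
proof (rule euclidean_eqI)
  fix b :: 'b assume b: "b \<in> Basis"
  have "((\<lambda>x. F (inv_into U \<phi> x) \<bullet> b) has_derivative (\<lambda>v. D v \<bullet> b)) (at (\<phi> p))"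
    by (rule has_derivative_inner_left[OF D])
  then show "dir_deriv \<xi> F \<bullet> b = D (dir_deriv \<xi> \<phi>) \<bullet> b"
    using tangent_chart[OF \<xi> c smooth_near_inner[OF f, of b]] frechet_derivative_eqI
    by (fastforce simp: dir_deriv_inner[OF b])
qed

lemma tangent_eqI:
  assumes "\<xi> \<in> tangent_space M p" "\<zeta> \<in> tangent_space M p" "(U, \<phi>) \<in> atlas M" "p \<in> U"
    "dir_deriv \<xi> \<phi> = dir_deriv \<zeta> \<phi>"
  shows "\<xi> = \<zeta>"
proof
  fix f
  show "\<xi> f = \<zeta> f"
  proof (cases "smooth_near M p f")
    case True
    show ?thesis
      using tangent_chart[OF assms(1,3,4) True] tangent_chart[OF assms(2-4) True] assms(5) by simp
  next
    case False
    then show ?thesis using tangent_not_smooth[OF assms(1)] tangent_not_smooth[OF assms(2)] by simp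
  qed
qed

lemma dir_deriv_bilinear:
  fixes F :: "'m \<Rightarrow> 'a::euclidean_space" and H :: "'m \<Rightarrow> 'b::euclidean_space"
    and B :: "'a \<Rightarrow> 'b \<Rightarrow> 'c::euclidean_space"
  assumes B: "bounded_bilinear B" and \<xi>: "\<xi> \<in> tangent_space M p" and s: "smooth_near M p F" "smooth_near M p H"
  shows "dir_deriv \<xi> (\<lambda>x. B (F x) (H x)) = B (F p) (dir_deriv \<xi> H) + B (dir_deriv \<xi> F) (H p)"
proof -
  obtain U \<phi> where c: "(U, \<phi>) \<in> atlas M" "p \<in> U"
    using smooth_near_topspace[OF s(1)] by (rule obtain_chart)
  note D = smooth_near_has_derivative[OF s(1) c] smooth_near_has_derivative[OF s(2) c]
  show ?thesis
    using dir_deriv_chart[OF \<xi> c smooth_near_bilinear[OF B s] bounded_bilinear.FDERIV[OF B D]]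
      dir_deriv_chart[OF \<xi> c s(1) D(1)] dir_deriv_chart[OF \<xi> c s(2) D(2)]
    by (simp add: inv_chart[OF c])
qed

lemma dir_deriv_bounded_linear:
  fixes F :: "'m \<Rightarrow> 'a::euclidean_space" and L :: "'a \<Rightarrow> 'b::euclidean_space"
  assumes L: "bounded_linear L" and \<xi>: "\<xi> \<in> tangent_space M p" and s: "smooth_near M p F"
  shows "dir_deriv \<xi> (\<lambda>x. L (F x)) = L (dir_deriv \<xi> F)"
proof -
  obtain U \<phi> where c: "(U, \<phi>) \<in> atlas M" "p \<in> U"
    using smooth_near_topspace[OF s(1)] by (rule obtain_chart)
  note D = smooth_near_has_derivative[OF s(1) c]
  show ?thesis
    unfolding dir_deriv_chart[OF \<xi> c s D]
    by (rule dir_deriv_chart[OF \<xi> c smooth_near_bounded_linear[OF L s] bounded_linear.has_derivative[OF L D]])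
qed

lemma dir_deriv_Pair:
  fixes F :: "'m \<Rightarrow> 'a::euclidean_space" and H :: "'m \<Rightarrow> 'b::euclidean_space"
  assumes \<xi>: "\<xi> \<in> tangent_space M p" and s: "smooth_near M p F" "smooth_near M p H"
  shows "dir_deriv \<xi> (\<lambda>x. (F x, H x)) = (dir_deriv \<xi> F, dir_deriv \<xi> H)"
proof -
  obtain U \<phi> where c: "(U, \<phi>) \<in> atlas M" "p \<in> U"
    using smooth_near_topspace[OF s(1)] by (rule obtain_chart)
  note D = smooth_near_has_derivative[OF s(1) c] smooth_near_has_derivative[OF s(2) c]
  have L: "bounded_linear (\<lambda>x::'a. (x, 0::'b))" "bounded_linear (\<lambda>x::'b. (0::'a, x))"
    by (auto intro!: bounded_linear_Pair bounded_linear_ident bounded_linear_zero)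
  have "smooth_near M p (\<lambda>x. (F x, 0) + (0, H x))"
    by (rule smooth_near_add[OF smooth_near_bounded_linear[OF L(1) s(1)] smooth_near_bounded_linear[OF L(2) s(2)]])
  then have "smooth_near M p (\<lambda>x. (F x, H x))" by simp
  then show ?thesis
    unfolding dir_deriv_chart[OF \<xi> c s(1) D(1)] dir_deriv_chart[OF \<xi> c s(2) D(2)]
    by (rule dir_deriv_chart[OF \<xi> c _ has_derivative_Pair[OF D]])
qed

lemma dir_deriv_local:
  assumes "\<xi> \<in> tangent_space M p" "smooth_near M p F" "openin (mtop M) W" "p \<in> W" "\<And>x. x \<in> W \<Longrightarrow> F x = H x"
  shows "dir_deriv \<xi> F = dir_deriv \<xi> H"
proof -
  have "smooth_near M p H" by (rule smooth_near_cong[OF assms(2-5)])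
  then show ?thesis
    unfolding dir_deriv_def using assms
    by (intro sum.cong refl arg_cong2[where f = scaleR] tangent_local[OF assms(1) _ _ assms(3,4)] smooth_near_inner) auto
qed

lemma dir_deriv_plus: "dir_deriv (\<xi> + \<zeta>) F = dir_deriv \<xi> F + dir_deriv \<zeta> F"
  by (simp add: dir_deriv_def scaleR_add_left sum.distrib)

lemma dir_deriv_scale: "dir_deriv (\<lambda>f. c * \<xi> f) F = c *\<^sub>R dir_deriv \<xi> F"
  by (simp add: dir_deriv_def scaleR_sum_right)

lemma dir_deriv_const:
  "\<xi> \<in> tangent_space M p \<Longrightarrow> dir_deriv \<xi> (\<lambda>x. c) = 0"
  by (simp add: dir_deriv_def tangent_const)

text \<open>The coordinate vector with components \<open>w\<close>.\<close>

definition chart_vector :: "'m set \<Rightarrow> ('m \<Rightarrow> 'e) \<Rightarrow> 'm \<Rightarrow> 'e \<Rightarrow> 'm tvec" where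
  "chart_vector U \<phi> p w = (\<lambda>f. if smooth_near M p f
     then frechet_derivative (\<lambda>x. f (inv_into U \<phi> x)) (at (\<phi> p)) w else 0)"

lemma chart_vector_eq:
  assumes "(U, \<phi>) \<in> atlas M" "p \<in> U" "smooth_near M p f"
    "((\<lambda>x. f (inv_into U \<phi> x)) has_derivative D) (at (\<phi> p))"
  shows "chart_vector U \<phi> p w f = D w"
  using assms frechet_derivative_eqI unfolding chart_vector_def by fastforce

lemma chart_vector_tangent:
  assumes c: "(U, \<phi>) \<in> atlas M" "p \<in> U"
  shows "chart_vector U \<phi> p w \<in> tangent_space M p"
proof -
  have p: "p \<in> topspace (mtop M)" using openin_subset[OF openin_chart[OF c(1)]] c(2) by auto
  note D = smooth_near_has_derivative[OF _ c]
  show ?thesis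
  proof (rule tangent_spaceI)
    fix f h :: "'m \<Rightarrow> real" assume s: "smooth_near M p f" "smooth_near M p h"
    show "chart_vector U \<phi> p w (\<lambda>x. f x + h x) = chart_vector U \<phi> p w f + chart_vector U \<phi> p w h"
      using chart_vector_eq[OF c smooth_near_add[OF s] has_derivative_add[OF D[OF s(1)] D[OF s(2)]]] s
      by (simp add: chart_vector_def)
    show "chart_vector U \<phi> p w (\<lambda>x. f x * h x) = chart_vector U \<phi> p w f * h p + f p * chart_vector U \<phi> p w h"
      using chart_vector_eq[OF c smooth_near_mult[OF s] has_derivative_mult[OF D[OF s(1)] D[OF s(2)]]] s
      by (simp add: chart_vector_def inv_chart[OF c])
    fix W assume W: "openin (mtop M) W" "p \<in> W" and eq: "\<And>x. x \<in> W \<Longrightarrow> f x = h x"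
    have "frechet_derivative (\<lambda>x. f (inv_into U \<phi> x)) (at (\<phi> p)) = frechet_derivative (\<lambda>x. h (inv_into U \<phi> x)) (at (\<phi> p))"
      by (rule frechet_derivative_cong_open[OF open_chart_image[OF c(1) W(1)]])
        (use W c eq in \<open>auto simp: inv_into_f_f[OF inj_on_chart[OF c(1)]]\<close>)
    then show "chart_vector U \<phi> p w f = chart_vector U \<phi> p w h" using s by (simp add: chart_vector_def)
  next
    fix a and f :: "'m \<Rightarrow> real" assume s: "smooth_near M p f"
    have "smooth_near M p (\<lambda>x. a * f x)" by (rule smooth_near_mult[OF smooth_near_const[OF p] s])
    from chart_vector_eq[OF c this has_derivative_mult_right[OF D[OF s]]]
    show "chart_vector U \<phi> p w (\<lambda>x. a * f x) = a * chart_vector U \<phi> p w f"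
      using s by (simp add: chart_vector_def)
  qed (simp add: chart_vector_def)
qed

lemma dir_deriv_chart_vector:
  assumes c: "(U, \<phi>) \<in> atlas M" "p \<in> U"
  shows "dir_deriv (chart_vector U \<phi> p w) \<phi> = w"
proof (rule euclidean_eqI)
  fix b :: 'e assume b: "b \<in> Basis"
  have "((\<lambda>x. \<phi> (inv_into U \<phi> x) \<bullet> b) has_derivative (\<lambda>v. v \<bullet> b)) (at (\<phi> p))"
  proof (rule has_derivative_transform_within_open)
    show "((\<lambda>x. x \<bullet> b) has_derivative (\<lambda>v. v \<bullet> b)) (at (\<phi> p))"
      by (intro has_derivative_inner_left has_derivative_ident)
    show "open (\<phi> ` (U \<inter> topspace (mtop M)))" by (rule open_chart_image[OF c(1) openin_topspace])
    show "\<phi> p \<in> \<phi> ` (U \<inter> topspace (mtop M))" using c openin_subset[OF openin_chart[OF c(1)]] by auto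
  qed (auto simp: inv_into_f_f[OF inj_on_chart[OF c(1)]])
  from chart_vector_eq[OF c smooth_near_inner[OF smooth_near_chart[OF c]] this]
  show "dir_deriv (chart_vector U \<phi> p w) \<phi> \<bullet> b = w \<bullet> b" by (simp add: dir_deriv_inner[OF b])
qed

end

section \<open>Vector fields, differentials and Lie brackets\<close>

lemma vector_fields_tangent: "X \<in> vector_fields M \<Longrightarrow> p \<in> topspace (mtop M) \<Longrightarrow> X p \<in> tangent_space M p"
  unfolding vector_fields_def by blast

lemma vector_fields_outside: "X \<in> vector_fields M \<Longrightarrow> p \<notin> topspace (mtop M) \<Longrightarrow> X p = 0"
  unfolding vector_fields_def by blast

lemma vector_fields_smooth:
  "X \<in> vector_fields M \<Longrightarrow> openin (mtop M) W \<Longrightarrow> smooth_fun_on M W f \<Longrightarrow> smooth_fun_on M W (\<lambda>p. X p f)"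
  unfolding vector_fields_def by blast

context smooth_charted
begin

lemma vector_fields_smooth_dir_deriv:
  fixes F :: "'m \<Rightarrow> 'b::euclidean_space"
  assumes "X \<in> vector_fields M" "openin (mtop M) W" "smooth_fun_on M W F"
  shows "smooth_fun_on M W (\<lambda>p. dir_deriv (X p) F)"
proof (rule smooth_fun_on_componentwise[OF assms(2)])
  fix b :: 'b assume "b \<in> Basis"
  then show "smooth_fun_on M W (\<lambda>p. dir_deriv (X p) F \<bullet> b)"
    unfolding dir_deriv_inner[OF \<open>b \<in> Basis\<close>]
    by (intro vector_fields_smooth[OF assms(1,2)] smooth_fun_on_bounded_linear[OF bounded_linear_inner_left assms(2,3)])
qed

text \<open>In a chart, \<open>X f\<close> is a combination of partial derivatives of \<open>f\<close> with the components of \<open>X\<close>.\<close>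

lemma vector_fieldsI:
  assumes t: "\<And>p. p \<in> topspace (mtop M) \<Longrightarrow> X p \<in> tangent_space M p"
    and "\<And>p. p \<notin> topspace (mtop M) \<Longrightarrow> X p = 0"
    and s: "\<And>U \<phi>. (U, \<phi>) \<in> atlas M \<Longrightarrow> smooth_fun_on M U (\<lambda>p. dir_deriv (X p) \<phi>)"
  shows "X \<in> vector_fields M"
proof -
  have "smooth_fun_on M W (\<lambda>p. X p f)" if W: "openin (mtop M) W" "smooth_fun_on M W f" for W f
  proof (rule smooth_fun_on_local)
    fix p assume p: "p \<in> W" "p \<in> topspace (mtop M)"
    obtain U \<phi> where c: "(U, \<phi>) \<in> atlas M" "p \<in> U" using p(2) by (rule obtain_chart)
    let ?D = "\<lambda>x. frechet_derivative (\<lambda>x. f (inv_into U \<phi> x)) (at x)"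
    have UW: "openin (mtop M) (U \<inter> W)" using openin_chart[OF c(1)] W(1) by (rule openin_Int)
    have D: "smooth_fun_on M (U \<inter> W) (\<lambda>q. ?D (\<phi> q) b)" for b
      by (rule smooth_fun_on_compose_euclidean[OF UW _ smooth_on_derivative[OF smooth_fun_onD[OF W(2) c(1)]]
            open_chart_image[OF c(1) W(1)]])
        (auto intro: smooth_fun_on_subset[OF smooth_fun_on_chart[OF c(1)]])
    have X: "smooth_fun_on M (U \<inter> W) (\<lambda>q. dir_deriv (X q) \<phi> \<bullet> b)" for b
      by (intro smooth_fun_on_bounded_linear[OF bounded_linear_inner_left UW] smooth_fun_on_subset[OF s[OF c(1)]]) auto
    have "smooth_fun_on M (U \<inter> W) (\<lambda>q. \<Sum>b\<in>Basis. (dir_deriv (X q) \<phi> \<bullet> b) * ?D (\<phi> q) b)"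
      by (intro smooth_fun_on_sum[OF UW] smooth_fun_on_bilinear[OF bounded_bilinear_mult UW] X D)
    then have "smooth_fun_on M (U \<inter> W) (\<lambda>q. X q f)"
    proof (rule smooth_fun_on_cong[OF _ UW])
      fix q assume q: "q \<in> U \<inter> W"
      then have near: "smooth_near M q f" using W by (intro smooth_nearI) auto
      have "X q f = ?D (\<phi> q) (dir_deriv (X q) \<phi>)"
        using q by (intro tangent_chart[OF t c(1) _ near] smooth_near_topspace[OF near]) auto
      then show "(\<Sum>b\<in>Basis. (dir_deriv (X q) \<phi> \<bullet> b) * ?D (\<phi> q) b) = X q f"
        using linear_Basis_expansion[OF has_derivative_linear[OF smooth_near_has_derivative[OF near c(1)]],
            of "dir_deriv (X q) \<phi>"] q by simp
    qed
    then show "\<exists>W'. openin (mtop M) W' \<and> p \<in> W' \<and> smooth_fun_on M W' (\<lambda>q. X q f)"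
      using UW p c(2) by blast
  qed
  then have "\<forall>W f. openin (mtop M) W \<and> smooth_fun_on M W f \<longrightarrow> smooth_fun_on M W (\<lambda>p. X p f)" by simp
  then show ?thesis unfolding vector_fields_def using assms(1,2) by simp
qed

text \<open>The mixed terms \<open>X f * Y h + Y f * X h\<close> in the Leibniz rule for \<open>X Y\<close> are symmetric in \<open>X\<close> and \<open>Y\<close> and
  cancel. The functions \<open>f\<close> and \<open>h\<close> are smooth only near \<open>p\<close>, so the identities for \<open>Y q\<close> hold only for
  \<open>q\<close> near \<open>p\<close>, which is enough because \<open>X p\<close> is local.\<close>

lemma lie_bracket_tangent:
  assumes X: "X \<in> vector_fields M" and Y: "Y \<in> vector_fields M" and p: "p \<in> topspace (mtop M)"
  shows "lie_bracket M X Y p \<in> tangent_space M p"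
proof (rule tangent_spaceI)
  note XY = smooth_near_vfield[OF X] smooth_near_vfield[OF Y]
  note Xp = vector_fields_tangent[OF X] and Yp = vector_fields_tangent[OF Y]
  have op: "\<exists>W. openin (mtop M) W \<and> p \<in> W \<and> (\<forall>q\<in>W. smooth_near M q f \<and> smooth_near M q h)"
    if fh: "smooth_near M p f" "smooth_near M p h" for f h :: "'m \<Rightarrow> real"
  proof -
    obtain V where "openin (mtop M) V" "p \<in> V" "smooth_fun_on M V f" by (rule smooth_nearE[OF fh(1)])
    moreover obtain W where "openin (mtop M) W" "p \<in> W" "smooth_fun_on M W h" by (rule smooth_nearE[OF fh(2)])
    ultimately show ?thesis by (intro exI[of _ "V \<inter> W"]) (auto intro: smooth_nearI)
  qed
  have sub: "x \<in> topspace (mtop M)" if "smooth_near M x f" for x f using that by (rule smooth_near_topspace)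
  \<comment> \<open>The locality of \<open>Z p\<close>, with smoothness of the function \<open>q \<mapsto> Z' q k\<close> inherited from \<open>r\<close>.\<close>
  have rule: "Z p (\<lambda>q. Z' q k) = Z p r" if "Z \<in> vector_fields M" "smooth_near M p r" "openin (mtop M) W" "p \<in> W"
    "\<And>q. q \<in> W \<Longrightarrow> Z' q k = r q" for Z Z' k r W
    using that smooth_near_cong[OF that(2,3,4)]
    by (intro tangent_local[OF vector_fields_tangent[OF that(1) p] _ that(2-4)]) auto
  fix f h :: "'m \<Rightarrow> real" assume s: "smooth_near M p f" "smooth_near M p h"
  then obtain W where W: "openin (mtop M) W" "p \<in> W" "\<And>q. q \<in> W \<Longrightarrow> smooth_near M q f"
    "\<And>q. q \<in> W \<Longrightarrow> smooth_near M q h" using op by metis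
  have plus: "Z p (\<lambda>q. Z' q (\<lambda>x. f x + h x)) = Z p (\<lambda>q. Z' q f) + Z p (\<lambda>q. Z' q h)"
    if Z: "Z \<in> vector_fields M" "Z' \<in> vector_fields M" for Z Z'
  proof -
    note n = smooth_near_vfield[OF Z(2) s(1)] smooth_near_vfield[OF Z(2) s(2)]
    have "Z p (\<lambda>q. Z' q (\<lambda>x. f x + h x)) = Z p (\<lambda>q. Z' q f + Z' q h)"
      by (rule rule[OF Z(1) smooth_near_add[OF n] W(1,2)])
        (use W in \<open>auto intro!: tangent_add vector_fields_tangent[OF Z(2)] intro: sub\<close>)
    then show ?thesis using tangent_add[OF vector_fields_tangent[OF Z(1) p] n] by simp
  qed
  show "lie_bracket M X Y p (\<lambda>x. f x + h x) = lie_bracket M X Y p f + lie_bracket M X Y p h"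
    using s smooth_near_add[OF s] plus[OF X Y] plus[OF Y X] by (simp add: lie_bracket_def)
  have mult: "Z p (\<lambda>q. Z' q (\<lambda>x. f x * h x)) =
      Z p (\<lambda>q. Z' q f) * h p + Z' p f * Z p h + (Z p f * Z' p h + f p * Z p (\<lambda>q. Z' q h))"
    if Z: "Z \<in> vector_fields M" "Z' \<in> vector_fields M" for Z Z'
  proof -
    note n = smooth_near_vfield[OF Z(2) s(1)] smooth_near_vfield[OF Z(2) s(2)]
    note Zt = vector_fields_tangent[OF Z(1) p]
    have "Z p (\<lambda>q. Z' q (\<lambda>x. f x * h x)) = Z p (\<lambda>q. Z' q f * h q + f q * Z' q h)"
      by (rule rule[OF Z(1) smooth_near_add[OF smooth_near_mult[OF n(1) s(2)] smooth_near_mult[OF s(1) n(2)]] W(1,2)])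
        (use W in \<open>auto intro!: tangent_mult vector_fields_tangent[OF Z(2)] intro: sub\<close>)
    then show ?thesis
      by (simp add: tangent_add[OF Zt smooth_near_mult[OF n(1) s(2)] smooth_near_mult[OF s(1) n(2)]]
          tangent_mult[OF Zt n(1) s(2)] tangent_mult[OF Zt s(1) n(2)])
  qed
  show "lie_bracket M X Y p (\<lambda>x. f x * h x) = lie_bracket M X Y p f * h p + f p * lie_bracket M X Y p h"
    using s smooth_near_mult[OF s] mult[OF X Y] mult[OF Y X] by (simp add: lie_bracket_def algebra_simps)
  show "lie_bracket M X Y p f = lie_bracket M X Y p h"
    if V: "openin (mtop M) V" "p \<in> V" "\<And>x. x \<in> V \<Longrightarrow> f x = h x" for V
  proof -
    have "Z p (\<lambda>q. Z' q f) = Z p (\<lambda>q. Z' q h)" if Z: "Z \<in> vector_fields M" "Z' \<in> vector_fields M" for Z Z'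
    proof (rule rule[OF Z(1) smooth_near_vfield[OF Z(2) s(2)], of "W \<inter> V"])
      show "openin (mtop M) (W \<inter> V)" "p \<in> W \<inter> V" using W V by auto
      show "Z' q f = Z' q h" if "q \<in> W \<inter> V" for q
        using that W(3,4) V by (intro tangent_local[OF vector_fields_tangent[OF Z(2)] _ _ V(1)]) (auto intro: sub)
    qed
    from this[OF X Y] this[OF Y X] show ?thesis using s by (simp add: lie_bracket_def)
  qed
next
  fix a and f :: "'m \<Rightarrow> real" assume s: "smooth_near M p f"
  then obtain W where W: "openin (mtop M) W" "p \<in> W" "smooth_fun_on M W f" by (rule smooth_nearE)
  have "Z p (\<lambda>q. Z' q (\<lambda>x. a * f x)) = a * Z p (\<lambda>q. Z' q f)"
    if Z: "Z \<in> vector_fields M" "Z' \<in> vector_fields M" for Z Z'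
  proof -
    note n = smooth_near_vfield[OF Z(2) s] 
    have q: "Z' q (\<lambda>x. a * f x) = a * Z' q f" if "q \<in> W" for q
      using that W openin_subset[OF W(1)]
      by (intro tangent_scale[OF vector_fields_tangent[OF Z(2)]]) (auto intro: smooth_nearI)
    have "smooth_near M p (\<lambda>q. a * Z' q f)" by (rule smooth_near_mult[OF smooth_near_const[OF p] n])
    moreover have "smooth_near M p (\<lambda>q. Z' q (\<lambda>x. a * f x))"
      by (rule smooth_near_cong[OF calculation W(1,2)]) (simp add: q)
    ultimately have "Z p (\<lambda>q. Z' q (\<lambda>x. a * f x)) = Z p (\<lambda>q. a * Z' q f)"
      by (intro tangent_local[OF vector_fields_tangent[OF Z(1) p] _ _ W(1,2)]) (auto simp: q)
    then show ?thesis using tangent_scale[OF vector_fields_tangent[OF Z(1) p] n] by simp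
  qed
  note this[OF X Y] this[OF Y X]
  moreover have "smooth_near M p (\<lambda>x. a * f x)" by (rule smooth_near_mult[OF smooth_near_const[OF p] s])
  ultimately show "lie_bracket M X Y p (\<lambda>x. a * f x) = a * lie_bracket M X Y p f"
    using s by (simp add: lie_bracket_def algebra_simps)
qed (simp add: lie_bracket_def)

lemma lie_bracket_outside:
  assumes "p \<notin> topspace (mtop M)"
  shows "lie_bracket M X Y p = 0"
  using assms smooth_near_topspace by (fastforce simp: lie_bracket_def fun_eq_iff)

end

lemma differential_tangent:
  fixes M :: "('m, 'e::euclidean_space) mfd" and N :: "('k, 'f::euclidean_space) mfd"
  assumes "charted M" "charted N" "smooth_map M N F" "p \<in> topspace (mtop M)" "\<xi> \<in> tangent_space M p"
  shows "differential N F p \<xi> \<in> tangent_space N (F p)"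
proof -
  interpret M: charted M by fact
  interpret N: charted N by fact
  note near = smooth_near_compose[OF assms(1-4)]
  show ?thesis
  proof (rule tangent_spaceI)
    fix f h :: "'k \<Rightarrow> real" assume s: "smooth_near N (F p) f" "smooth_near N (F p) h"
    note n = near[OF s(1)] near[OF s(2)]
    show "differential N F p \<xi> (\<lambda>x. f x + h x) = differential N F p \<xi> f + differential N F p \<xi> h"
      using s N.smooth_near_add[OF s] tangent_add[OF assms(5) n] by (simp add: differential_def o_def)
    show "differential N F p \<xi> (\<lambda>x. f x * h x) = differential N F p \<xi> f * h (F p) + f (F p) * differential N F p \<xi> h"
      using s N.smooth_near_mult[OF s] tangent_mult[OF assms(5) n] by (simp add: differential_def o_def)
    fix W assume W: "openin (mtop N) W" "F p \<in> W" "\<And>x. x \<in> W \<Longrightarrow> f x = h x"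
    have "\<xi> (\<lambda>x. f (F x)) = \<xi> (\<lambda>x. h (F x))"
      by (rule tangent_local[OF assms(5) n smooth_map_vimage_open[OF assms(3) W(1)]]) (use W assms(4) in auto)
    then show "differential N F p \<xi> f = differential N F p \<xi> h" using s by (simp add: differential_def o_def)
  next
    fix c and f :: "'k \<Rightarrow> real" assume s: "smooth_near N (F p) f"
    have "smooth_near N (F p) (\<lambda>x. c * f x)"
      by (rule N.smooth_near_mult[OF N.smooth_near_const s]) (rule N.smooth_near_topspace[OF s])
    then show "differential N F p \<xi> (\<lambda>x. c * f x) = c * differential N F p \<xi> f"
      using s tangent_scale[OF assms(5) near[OF s]] by (simp add: differential_def o_def)
  qed (simp add: differential_def)
qed

lemma dir_deriv_differential:
  assumes "charted N" "smooth_near N (F p) f"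
  shows "dir_deriv (differential N F p \<xi>) f = dir_deriv \<xi> (\<lambda>x. f (F x))"
  using charted.smooth_near_inner[OF assms] by (simp add: dir_deriv_def differential_def o_def)

section \<open>Frames\<close>

text \<open>A frame is a family of vector fields that is indexed linearly by the model space, rather than by a
  basis, so that a field with component function \<open>x\<close> is simply \<open>\<lambda>p. E (x p) p\<close>.\<close>

locale framed = smooth_charted M for M :: "('m, 'e::euclidean_space) mfd" +
  fixes E :: "'e \<Rightarrow> 'm vfield"
  assumes frame_field: "E v \<in> vector_fields M"
    and frame_plus: "E (v + w) p = E v p + E w p"
    and frame_scale: "E (c *\<^sub>R v) p = (\<lambda>f. c * E v p f)"
    and frame_inj: "p \<in> topspace (mtop M) \<Longrightarrow> E v p = 0 \<Longrightarrow> v = 0"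
begin

lemma frame_linear: "linear (\<lambda>v. E v p f)"
  by (rule linearI) (simp_all add: frame_plus frame_scale)

lemma frame_dir_deriv_linear: "linear (\<lambda>v. dir_deriv (E v p) F)"
  by (rule linearI) (simp_all add: frame_plus frame_scale dir_deriv_plus dir_deriv_scale)

lemma frame_tangent: "p \<in> topspace (mtop M) \<Longrightarrow> E v p \<in> tangent_space M p"
  by (rule vector_fields_tangent[OF frame_field])

lemma frame_diff: "E (v - w) p = E v p - E w p"
  using linear_diff[OF frame_linear, of v w p] by (simp add: fun_eq_iff)

lemma frame_uminus: "E (- v) p = - E v p"
  using linear_neg[OF frame_linear, of v p] by (simp add: fun_eq_iff)

lemma frame_zero: "E 0 p = 0"
  using linear_0[OF frame_linear, of p] by (simp add: fun_eq_iff)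

lemma frame_inj_iff:
  assumes "p \<in> topspace (mtop M)"
  shows "E v p = E w p \<longleftrightarrow> v = w"
proof
  assume "E v p = E w p"
  then have "E (v - w) p = 0" by (simp add: frame_diff)
  then show "v = w" using frame_inj[OF assms] by fastforce
qed simp

lemma frame_chart_inj:
  assumes "(U, \<phi>) \<in> atlas M" "p \<in> U"
  shows "inj (\<lambda>v. dir_deriv (E v p) \<phi>)"
proof (rule injI)
  have p: "p \<in> topspace (mtop M)" using openin_subset[OF openin_chart[OF assms(1)]] assms(2) by auto
  fix v w assume "dir_deriv (E v p) \<phi> = dir_deriv (E w p) \<phi>"
  then have "E v p = E w p" by (rule tangent_eqI[OF frame_tangent[OF p] frame_tangent[OF p] assms])
  then show "v = w" by (simp add: frame_inj_iff[OF p])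
qed

text \<open>The model space has the dimension of the tangent spaces, so that injectivity of a frame at
  a point suffices.\<close>

lemma frame_surj:
  assumes "p \<in> topspace (mtop M)" "\<xi> \<in> tangent_space M p"
  obtains v where "E v p = \<xi>"
proof -
  obtain U \<phi> where c: "(U, \<phi>) \<in> atlas M" "p \<in> U" using assms(1) by (rule obtain_chart)
  have "surj (\<lambda>v. dir_deriv (E v p) \<phi>)"
    by (rule linear_inj_imp_surj[OF frame_dir_deriv_linear frame_chart_inj[OF c]])
  from surjD[OF this, of "dir_deriv \<xi> \<phi>"] obtain v where "dir_deriv (E v p) \<phi> = dir_deriv \<xi> \<phi>" by auto
  then have "E v p = \<xi>" by (rule tangent_eqI[OF frame_tangent[OF assms(1)] assms(2) c])
  then show ?thesis by (rule that)
qed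

definition coef :: "'m \<Rightarrow> 'm tvec \<Rightarrow> 'e" where
  "coef p = inv_into UNIV (\<lambda>v. E v p)"

lemma coef_frame: "p \<in> topspace (mtop M) \<Longrightarrow> coef p (E v p) = v"
  unfolding coef_def by (rule inv_into_f_f) (auto intro: injI simp: frame_inj_iff)

lemma frame_coef: "p \<in> topspace (mtop M) \<Longrightarrow> \<xi> \<in> tangent_space M p \<Longrightarrow> E (coef p \<xi>) p = \<xi>"
  by (metis frame_surj coef_frame)

lemma frame_expansion: "E v p f = (\<Sum>b\<in>Basis. (v \<bullet> b) * E b p f)"
  using linear_Basis_expansion[OF frame_linear, of v p f] by simp

lemma frame_dir_deriv_expansion: "dir_deriv (E v p) F = (\<Sum>b\<in>Basis. (v \<bullet> b) *\<^sub>R dir_deriv (E b p) F)"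
  by (rule linear_Basis_expansion[OF frame_dir_deriv_linear])

lemma frame_combination_field:
  assumes x: "smooth_fun_on M (topspace (mtop M)) x"
  shows "(\<lambda>p. E (x p) p) \<in> vector_fields M"
proof (rule vector_fieldsI)
  show "E (x p) p \<in> tangent_space M p" if "p \<in> topspace (mtop M)" for p using that by (rule frame_tangent)
  show "E (x p) p = 0" if "p \<notin> topspace (mtop M)" for p using that by (rule vector_fields_outside[OF frame_field])
  fix U \<phi> assume c: "(U, \<phi>) \<in> atlas M"
  show "smooth_fun_on M U (\<lambda>p. dir_deriv (E (x p) p) \<phi>)"
    unfolding frame_dir_deriv_expansion[of "x _"]
    by (intro smooth_fun_on_sum smooth_fun_on_bilinear[OF bounded_bilinear_scaleR] openin_chart[OF c]
        smooth_fun_on_bounded_linear[OF bounded_linear_inner_left]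
        smooth_fun_on_subset[OF x openin_subset] vector_fields_smooth_dir_deriv[OF frame_field] smooth_fun_on_chart[OF c])
qed

end

text \<open>In a chart, the components of a tangent vector with respect to the frame solve the linear system
  with this smooth and invertible matrix.\<close>

lemma frame_matrix:
  fixes M :: "('m, real^'n) mfd"
  assumes "framed M E" and c: "(U, \<phi>) \<in> atlas M"
  defines "A \<equiv> \<lambda>p. matrix (\<lambda>v. dir_deriv (E v p) \<phi>)"
  shows "A p *v v = dir_deriv (E v p) \<phi>" "p \<in> U \<Longrightarrow> invertible (A p)" "smooth_fun_on M U A"
proof -
  interpret framed M E by fact
  show A: "A p *v v = dir_deriv (E v p) \<phi>" for p v
    unfolding A_def by (rule matrix_works) (simp add: frame_dir_deriv_linear linear_matrix_vector_mul_eq)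
  show "invertible (A p)" if "p \<in> U"
  proof -
    have "(*v) (A p) = (\<lambda>v. dir_deriv (E v p) \<phi>)" by (rule ext) (rule A)
    then show ?thesis
      using frame_chart_inj[OF c that] unfolding invertible_left_inverse matrix_left_invertible_injective by simp
  qed
  show "smooth_fun_on M U A"
  proof (rule smooth_fun_on_componentwise[OF openin_chart[OF c]])
    fix b :: "real^'n^'n" assume "b \<in> Basis"
    then obtain i j where b: "b = axis i (axis j 1)" by (auto simp: Basis_vec_def)
    have "smooth_fun_on M U (\<lambda>p. dir_deriv (E (axis j 1) p) \<phi> $ i)"
      by (intro smooth_fun_on_bounded_linear[OF bounded_linear_vec_nth] openin_chart[OF c]
          vector_fields_smooth_dir_deriv[OF frame_field] smooth_fun_on_chart[OF c])
    then show "smooth_fun_on M U (\<lambda>p. A p \<bullet> b)" by (simp add: b A_def matrix_def inner_axis)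
  qed
qed

locale smooth_framed = framed +
  assumes coef_smooth: "X \<in> vector_fields M \<Longrightarrow> smooth_fun_on M (topspace (mtop M)) (\<lambda>p. coef p (X p))"

lemma framed_smooth_framed:
  fixes M :: "('m, real^'n) mfd"
  assumes "framed M E"
  shows "smooth_framed M E"
proof -
  interpret framed M E by fact
  show ?thesis
  proof
    fix X assume X: "X \<in> vector_fields M"
    show "smooth_fun_on M (topspace (mtop M)) (\<lambda>p. coef p (X p))"
    proof (rule smooth_fun_on_local)
      fix p assume "p \<in> topspace (mtop M)"
      then obtain U \<phi> where c: "(U, \<phi>) \<in> atlas M" "p \<in> U" by (rule obtain_chart)
      note U = openin_chart[OF c(1)]
      have "smooth_fun_on M U (\<lambda>p. coef p (X p))"
      proof (rule smooth_fun_on_linear_system[OF U frame_matrix(3)[OF assms c(1)]])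
        show "smooth_fun_on M U (\<lambda>p. dir_deriv (X p) \<phi>)"
          by (rule vector_fields_smooth_dir_deriv[OF X U smooth_fun_on_chart[OF c(1)]])
        fix q assume q: "q \<in> U"
        then have "q \<in> topspace (mtop M)" using openin_subset[OF U] by auto
        then show "matrix (\<lambda>v. dir_deriv (E v q) \<phi>) *v coef q (X q) = dir_deriv (X q) \<phi>"
          by (simp add: frame_matrix(1)[OF assms c(1)] frame_coef vector_fields_tangent[OF X])
      qed (rule frame_matrix(2)[OF assms c(1)])
      then show "\<exists>W'. openin (mtop M) W' \<and> p \<in> W' \<and> smooth_fun_on M W' (\<lambda>p. coef p (X p))"
        using U c(2) by blast
    qed
  qed
qed

lemma (in smooth_framed) vector_field_expansion:
  assumes "X \<in> vector_fields M"
  shows "X = (\<lambda>p. E (coef p (X p)) p)"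
proof
  fix p show "X p = E (coef p (X p)) p"
    using frame_coef vector_fields_tangent[OF assms] vector_fields_outside[OF assms]
      vector_fields_outside[OF frame_field] by (cases "p \<in> topspace (mtop M)") simp_all
qed

section \<open>Constant structures in commuting frames\<close>

locale commuting_frame = smooth_framed M E for M :: "('m, 'e::euclidean_space) mfd" and E +
  assumes commute: "lie_bracket M (E v) (E w) = 0"
begin

lemma second_derivatives_commute:
  assumes "smooth_near M p f"
  shows "E v p (\<lambda>q. E w q f) = E w p (\<lambda>q. E v q f)"
  using fun_cong[OF fun_cong[OF commute[of v w]], of p f] assms by (simp add: lie_bracket_def)

text \<open>By the product rule, \<open>X (Y f)\<close> consists of the derivative of \<open>y\<close> along \<open>X\<close> and of second derivatives
  of \<open>f\<close> along frame fields. The latter are symmetric, since the frame commutes, and cancel.\<close>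

lemma lie_bracket_combination:
  assumes x: "smooth_fun_on M (topspace (mtop M)) x" and y: "smooth_fun_on M (topspace (mtop M)) y"
    and p: "p \<in> topspace (mtop M)"
  shows "lie_bracket M (\<lambda>p. E (x p) p) (\<lambda>p. E (y p) p) p =
    E (dir_deriv (E (x p) p) y - dir_deriv (E (y p) p) x) p"
proof
  fix f
  have second: "E u p (\<lambda>q. E (z q) q f) = E (dir_deriv (E u p) z) p f + (\<Sum>b\<in>Basis. \<Sum>a\<in>Basis. (z p \<bullet> b) * ((u \<bullet> a) * E a p (\<lambda>q. E b q f)))"
    if f: "smooth_near M p f" and z: "smooth_fun_on M (topspace (mtop M)) z" for u z
  proof -
    have t: "E u p \<in> tangent_space M p" using p by (rule frame_tangent)
    have n: "smooth_near M p (\<lambda>q. z q \<bullet> b)" "smooth_near M p (\<lambda>q. E b q f)" for b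
      using smooth_nearI[OF openin_topspace p z] f by (auto intro: smooth_near_inner smooth_near_vfield[OF frame_field])
    have "E u p (\<lambda>q. E (z q) q f) = E u p (\<lambda>q. \<Sum>b\<in>Basis. (z q \<bullet> b) * E b q f)"
      by (subst frame_expansion[of "z _"]) simp
    also have "\<dots> = (\<Sum>b\<in>Basis. E u p (\<lambda>q. (z q \<bullet> b) * E b q f))"
      by (rule tangent_sum[OF t p smooth_near_mult[OF n]])
    also have "\<dots> = (\<Sum>b\<in>Basis. (dir_deriv (E u p) z \<bullet> b) * E b p f + (z p \<bullet> b) * E u p (\<lambda>q. E b q f))"
      by (rule sum.cong[OF refl]) (simp add: tangent_mult[OF t n] dir_deriv_inner)
    also have "\<dots> = E (dir_deriv (E u p) z) p f + (\<Sum>b\<in>Basis. (z p \<bullet> b) * E u p (\<lambda>q. E b q f))"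
      by (simp add: sum.distrib frame_expansion[of "dir_deriv (E u p) z"])
    also have "(\<Sum>b\<in>Basis. (z p \<bullet> b) * E u p (\<lambda>q. E b q f)) =
        (\<Sum>b\<in>Basis. \<Sum>a\<in>Basis. (z p \<bullet> b) * ((u \<bullet> a) * E a p (\<lambda>q. E b q f)))"
      by (simp only: frame_expansion[of u] sum_distrib_left)
    finally show ?thesis .
  qed
  show "lie_bracket M (\<lambda>p. E (x p) p) (\<lambda>p. E (y p) p) p f =
    E (dir_deriv (E (x p) p) y - dir_deriv (E (y p) p) x) p f"
  proof (cases "smooth_near M p f")
    case True
    have "(\<Sum>b\<in>Basis. \<Sum>a\<in>Basis. (y p \<bullet> b) * ((x p \<bullet> a) * E a p (\<lambda>q. E b q f))) =
        (\<Sum>a\<in>Basis. \<Sum>b\<in>Basis. (x p \<bullet> a) * ((y p \<bullet> b) * E b p (\<lambda>q. E a q f)))"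
      by (subst sum.swap) (simp add: second_derivatives_commute[OF True] mult_ac)
    then show ?thesis
      using True by (simp add: lie_bracket_def second[OF True x] second[OF True y] frame_diff)
  next
    case False
    then show ?thesis using tangent_not_smooth[OF frame_tangent[OF p] False] by (simp add: lie_bracket_def)
  qed
qed

definition constant_structure :: "('e \<Rightarrow> 'e) \<Rightarrow> 'm \<Rightarrow> 'm tvec \<Rightarrow> 'm tvec" where
  "constant_structure A p \<xi> = E (A (coef p \<xi>)) p"

context
  fixes A :: "'e \<Rightarrow> 'e"
  assumes A: "linear A" and A_A: "\<And>v. A (A v) = - v"
begin

lemma apply_constant_structure:
  "apply_field M (constant_structure A) X = (\<lambda>p. E (A (coef p (X p))) p)"
  unfolding apply_field_def constant_structure_def fun_eq_iff
  using vector_fields_outside[OF frame_field] by auto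

lemma apply_constant_structure_field:
  "X \<in> vector_fields M \<Longrightarrow> apply_field M (constant_structure A) X \<in> vector_fields M"
  unfolding apply_constant_structure
  by (intro frame_combination_field smooth_fun_on_bounded_linear[OF linear_conv_bounded_linear[THEN iffD1, OF A]]
      coef_smooth openin_topspace)

lemma almost_complex_constant_structure: "almost_complex_structure M (constant_structure A)"
  unfolding almost_complex_structure_def
proof (intro conjI ballI allI)
  show "apply_field M (constant_structure A) X \<in> vector_fields M" if "X \<in> vector_fields M" for X
    using that by (rule apply_constant_structure_field)
  fix p \<xi> assume p: "p \<in> topspace (mtop M)" and \<xi>: "\<xi> \<in> tangent_space M p"
  obtain v where v: "E v p = \<xi>" using frame_surj[OF p \<xi>] by blast
  show "constant_structure A p \<xi> \<in> tangent_space M p"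
    unfolding constant_structure_def using p by (rule frame_tangent)
  show "constant_structure A p (constant_structure A p \<xi>) = - \<xi>"
    unfolding constant_structure_def by (simp add: coef_frame[OF p] A_A frame_uminus frame_coef[OF p \<xi>])
  show "constant_structure A p (\<lambda>f. c * \<xi> f) = (\<lambda>f. c * constant_structure A p \<xi> f)" for c
    unfolding constant_structure_def v[symmetric] frame_scale[symmetric]
    by (simp add: coef_frame[OF p] linear_cmul[OF A])
  fix \<zeta> assume \<zeta>: "\<zeta> \<in> tangent_space M p"
  obtain w where w: "E w p = \<zeta>" using frame_surj[OF p \<zeta>] by blast
  show "constant_structure A p (\<xi> + \<zeta>) = constant_structure A p \<xi> + constant_structure A p \<zeta>"
    unfolding constant_structure_def v[symmetric] w[symmetric] frame_plus[symmetric]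
    by (simp add: coef_frame[OF p] linear_add[OF A])
qed

text \<open>In a commuting frame, the bracket of fields with component functions \<open>x\<close> and \<open>y\<close> has the
  components \<open>X y - Y x\<close>, and \<open>A\<close> commutes with differentiation. So the terms of the
  Nijenhuis tensor cancel because of \<open>A (A v) = - v\<close>.\<close>

lemma integrable_constant_structure: "integrable_structure M (constant_structure A)"
  unfolding integrable_structure_def
proof (intro ballI ext)
  fix X Y p f
  assume X: "X \<in> vector_fields M" and Y: "Y \<in> vector_fields M"
  let ?J = "apply_field M (constant_structure A)"
  let ?N = "lie_bracket M (?J X) (?J Y) - ?J (lie_bracket M (?J X) Y) - ?J (lie_bracket M X (?J Y)) - lie_bracket M X Y"
  have bl: "bounded_linear A" using A by (simp add: linear_conv_bounded_linear)
  have "?N p = 0"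
  proof (cases "p \<in> topspace (mtop M)")
    case False
    then show ?thesis
      by (simp add: lie_bracket_outside apply_field_def)
  next
    case p: True
    define x where "x = (\<lambda>q. coef q (X q))"
    define y where "y = (\<lambda>q. coef q (Y q))"
    have s: "smooth_fun_on M (topspace (mtop M)) x" "smooth_fun_on M (topspace (mtop M)) y"
      unfolding x_def y_def by (rule coef_smooth[OF X], rule coef_smooth[OF Y])
    have As: "smooth_fun_on M (topspace (mtop M)) (\<lambda>q. A (x q))" "smooth_fun_on M (topspace (mtop M)) (\<lambda>q. A (y q))"
      using s by (intro smooth_fun_on_bounded_linear[OF bl] openin_topspace; simp)+
    have XY: "X = (\<lambda>p. E (x p) p)" "Y = (\<lambda>p. E (y p) p)"
      unfolding x_def y_def by (rule vector_field_expansion[OF X], rule vector_field_expansion[OF Y])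
    have J: "?J X = (\<lambda>p. E (A (x p)) p)" "?J Y = (\<lambda>p. E (A (y p)) p)"
      unfolding x_def y_def by (rule apply_constant_structure)+
    have A_deriv: "dir_deriv (E v p) (\<lambda>q. A (z q)) = A (dir_deriv (E v p) z)"
      if "smooth_fun_on M (topspace (mtop M)) z" for v z
      by (rule dir_deriv_bounded_linear[OF bl frame_tangent[OF p] smooth_nearI[OF openin_topspace p that]])
    have J_bracket: "?J Z p = E (A v) p" if "Z p = E v p" for Z v
      unfolding apply_constant_structure by (simp add: that coef_frame[OF p])
    note bracket = lie_bracket_combination[OF _ _ p]
    have b: "lie_bracket M (?J X) (?J Y) p = E (A (dir_deriv (E (A (x p)) p) y) - A (dir_deriv (E (A (y p)) p) x)) p"
      "lie_bracket M (?J X) Y p = E (dir_deriv (E (A (x p)) p) y - A (dir_deriv (E (y p) p) x)) p"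
      "lie_bracket M X (?J Y) p = E (A (dir_deriv (E (x p) p) y) - dir_deriv (E (A (y p)) p) x) p"
      "lie_bracket M X Y p = E (dir_deriv (E (x p) p) y - dir_deriv (E (y p) p) x) p"
      using bracket[OF As] bracket[OF As(1) s(2)] bracket[OF s(1) As(2)] bracket[OF s]
      by (simp_all add: J A_deriv s flip: XY)
    have "?N p = E ((A (dir_deriv (E (A (x p)) p) y) - A (dir_deriv (E (A (y p)) p) x))
        - A (dir_deriv (E (A (x p)) p) y - A (dir_deriv (E (y p) p) x))
        - A (A (dir_deriv (E (x p) p) y) - dir_deriv (E (A (y p)) p) x)
        - (dir_deriv (E (x p) p) y - dir_deriv (E (y p) p) x)) p"
      by (simp only: frame_diff fun_diff_def[of "_ :: 'm \<Rightarrow> _"] b(1,4) 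
          J_bracket[where Z = "lie_bracket M (?J X) Y", OF b(2)] J_bracket[where Z = "lie_bracket M X (?J Y)", OF b(3)])
    also have "\<dots> = 0"
      by (simp add: linear_diff[OF A] A_A frame_zero)
    finally show ?thesis .
  qed
  then show "?N p f = 0 p f" by simp
qed

end

end

section \<open>Connections in frames\<close>

lemma sum_field_apply: "(\<Sum>i\<in>I. X i) p h = (\<Sum>i\<in>I. X i p h)" for X :: "'i \<Rightarrow> 'm vfield"
  by (induction I rule: infinite_finite_induct) auto

context smooth_charted
begin

lemma vector_fields_zero: "0 \<in> vector_fields M"
  by (rule vector_fieldsI) (auto simp: tangent_space_zero dir_deriv_def smooth_fun_on_const)

lemma vector_fields_plus:
  assumes "X \<in> vector_fields M" "Y \<in> vector_fields M"
  shows "X + Y \<in> vector_fields M"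
proof (rule vector_fieldsI)
  show "(X + Y) p \<in> tangent_space M p" if "p \<in> topspace (mtop M)" for p
    using tangent_space_plus[OF vector_fields_tangent[OF assms(1) that] vector_fields_tangent[OF assms(2) that]] by simp
  show "(X + Y) p = 0" if "p \<notin> topspace (mtop M)" for p
    using vector_fields_outside[OF assms(1) that] vector_fields_outside[OF assms(2) that] by simp
  show "smooth_fun_on M U (\<lambda>p. dir_deriv ((X + Y) p) \<phi>)" if c: "(U, \<phi>) \<in> atlas M" for U \<phi>
    unfolding plus_fun_apply dir_deriv_plus
    by (intro smooth_fun_on_add openin_chart[OF c] vector_fields_smooth_dir_deriv assms smooth_fun_on_chart[OF c])
qed

lemma vector_fields_scale:
  assumes "X \<in> vector_fields M" "smooth_fun_on M (topspace (mtop M)) f"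
  shows "scale_field f X \<in> vector_fields M"
proof (rule vector_fieldsI)
  show "scale_field f X p \<in> tangent_space M p" if "p \<in> topspace (mtop M)" for p
    unfolding scale_field_def by (rule tangent_space_scale[OF vector_fields_tangent[OF assms(1) that]])
  show "scale_field f X p = 0" if "p \<notin> topspace (mtop M)" for p
    using vector_fields_outside[OF assms(1) that] by (simp add: scale_field_def fun_eq_iff)
  show "smooth_fun_on M U (\<lambda>p. dir_deriv (scale_field f X p) \<phi>)" if c: "(U, \<phi>) \<in> atlas M" for U \<phi>
    unfolding scale_field_def dir_deriv_scale
    by (intro smooth_fun_on_bilinear[OF bounded_bilinear_scaleR] openin_chart[OF c]
        vector_fields_smooth_dir_deriv assms smooth_fun_on_chart[OF c]
        smooth_fun_on_subset[OF assms(2) openin_subset])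
qed

lemma vector_fields_sum: "(\<And>i. i \<in> I \<Longrightarrow> X i \<in> vector_fields M) \<Longrightarrow> (\<Sum>i\<in>I. X i) \<in> vector_fields M"
  by (induction I rule: infinite_finite_induct) (auto intro: vector_fields_zero vector_fields_plus)

end

locale connection = smooth_charted M for M :: "('m, 'e::euclidean_space) mfd" +
  fixes nab :: "'m connection"
  assumes affine: "affine_connection M nab"
begin

lemma nab_field: "X \<in> vector_fields M \<Longrightarrow> Y \<in> vector_fields M \<Longrightarrow> nab X Y \<in> vector_fields M"
  using affine unfolding affine_connection_def by blast

lemma nab_plus:
  assumes "X \<in> vector_fields M" "Y \<in> vector_fields M" "Z \<in> vector_fields M"
  shows "nab (X + Y) Z = nab X Z + nab Y Z" "nab X (Y + Z) = nab X Y + nab X Z"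
  using affine assms unfolding affine_connection_def by blast+

lemma nab_scale:
  assumes "X \<in> vector_fields M" "Y \<in> vector_fields M" "smooth_fun_on M (topspace (mtop M)) f"
  shows "nab (scale_field f X) Y = scale_field f (nab X Y)"
    "nab X (scale_field f Y) = scale_field (\<lambda>p. X p f) Y + scale_field f (nab X Y)"
  using affine assms unfolding affine_connection_def by blast+

lemma nab_sum_left:
  assumes "\<And>i. i \<in> I \<Longrightarrow> X i \<in> vector_fields M" "Y \<in> vector_fields M"
  shows "nab (\<Sum>i\<in>I. X i) Y = (\<Sum>i\<in>I. nab (X i) Y)"
proof -
  have z: "nab 0 Y = 0" using nab_plus(1)[OF vector_fields_zero vector_fields_zero assms(2)] by simp
  show ?thesis using assms
    by (induction I rule: infinite_finite_induct) (auto simp: z nab_plus(1) vector_fields_sum)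
qed

lemma nab_sum_right:
  assumes "\<And>i. i \<in> I \<Longrightarrow> Y i \<in> vector_fields M" "X \<in> vector_fields M"
  shows "nab X (\<Sum>i\<in>I. Y i) = (\<Sum>i\<in>I. nab X (Y i))"
proof -
  have z: "nab X 0 = 0" using nab_plus(2)[OF assms(2) vector_fields_zero vector_fields_zero] by simp
  show ?thesis using assms
    by (induction I rule: infinite_finite_induct) (auto simp: z nab_plus(2) vector_fields_sum)
qed

end

locale framed_connection = connection M nab + framed M E for M :: "('m, 'e::euclidean_space) mfd" and nab E
begin

lemma combination_eq_sum: "(\<lambda>p. E (x p) p) = (\<Sum>b\<in>Basis. scale_field (\<lambda>p. x p \<bullet> b) (E b))"
  by (intro ext) (simp add: sum_field_apply scale_field_def frame_expansion[of "x _"])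

lemma components_smooth:
  assumes "smooth_fun_on M (topspace (mtop M)) x"
  shows "smooth_fun_on M (topspace (mtop M)) (\<lambda>p. x p \<bullet> b)"
  by (rule smooth_fun_on_bounded_linear[OF bounded_linear_inner_left openin_topspace assms])

text \<open>Together with the Leibniz rule below, this reduces a connection to its values on a frame.\<close>

lemma nab_combination_left:
  assumes "smooth_fun_on M (topspace (mtop M)) x" "Y \<in> vector_fields M"
  shows "nab (\<lambda>p. E (x p) p) Y p h = (\<Sum>b\<in>Basis. (x p \<bullet> b) * nab (E b) Y p h)"
proof -
  note s = components_smooth[OF assms(1)]
  show ?thesis
    by (subst combination_eq_sum, subst nab_sum_left[OF vector_fields_scale[OF frame_field s] assms(2)])
      (simp only: nab_scale(1)[OF frame_field assms(2) s] sum_field_apply, simp only: scale_field_def)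
qed

lemma nab_combination_right:
  assumes "smooth_fun_on M (topspace (mtop M)) y" "X \<in> vector_fields M"
  shows "nab X (\<lambda>p. E (y p) p) p h = E (dir_deriv (X p) y) p h + (\<Sum>b\<in>Basis. (y p \<bullet> b) * nab X (E b) p h)"
proof -
  note s = components_smooth[OF assms(1)]
  have "nab X (\<lambda>p. E (y p) p) p h = (\<Sum>b\<in>Basis. X p (\<lambda>q. y q \<bullet> b) * E b p h + (y p \<bullet> b) * nab X (E b) p h)"
    by (subst combination_eq_sum, subst nab_sum_right[OF vector_fields_scale[OF frame_field s] assms(2)])
      (simp only: nab_scale(2)[OF assms(2) frame_field s] sum_field_apply plus_fun_apply,
        simp only: scale_field_def)
  then show ?thesis
    by (simp add: sum.distrib frame_expansion[of "dir_deriv (X p) y"] dir_deriv_inner)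
qed

end

section \<open>The parallel frame of a left invariant affine structure\<close>

lemma bounded_bilinear_matrix_vector_mult:
  "bounded_bilinear ((*v) :: real^'n^'m \<Rightarrow> real^'n \<Rightarrow> real^'m)"
  unfolding bilinear_conv_bounded_bilinear[symmetric] bilinear_def
  by (intro conjI allI linearI)
    (simp_all add: matrix_vector_mult_add_rdistrib matrix_vector_right_distrib matrix_vector_mult_scaleR scaleR_matrix_vector_assoc)

lemma bounded_linear_matrix_mult_left:
  "bounded_linear ((**) A :: real^'n^'n \<Rightarrow> real^'n^'n)"
  unfolding linear_conv_bounded_linear[symmetric]
  by (rule linearI)
    (simp add: matrix_add_ldistrib, simp add: matrix_matrix_mult_def vec_eq_iff sum_distrib_left mult_ac)

lemma matrix_inv:
  fixes A :: "real^'n^'n"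
  assumes "invertible A"
  shows matrix_inv_right: "A ** matrix_inv A = mat 1" and matrix_inv_left: "matrix_inv A ** A = mat 1"
proof -
  have "\<exists>B. A ** B = mat 1 \<and> B ** A = mat 1" using assms by (simp add: invertible_def)
  from someI_ex[OF this] show "A ** matrix_inv A = mat 1" "matrix_inv A ** A = mat 1"
    unfolding matrix_inv_def by blast+
qed

lemma invertible_mult_eq_0:
  fixes A :: "real^'n^'n"
  assumes "invertible A" "A *v x = 0"
  shows "x = 0"
  using assms by (metis matrix_inv_left matrix_vector_mul_assoc matrix_vector_mul_lid matrix_vector_mult_0_right)

locale left_invariant_structure =
  fixes G :: "'g monoid"
    and M :: "('g, real^'n) mfd"
    and nab :: "'g connection"
    and i :: "'g vfield \<Rightarrow> real^'n"
    and rho :: "'g \<Rightarrow> (real^'n^'n) \<times> (real^'n)"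
  assumes lie: "lie_group G M"
    and affine_structure: "left_invariant_affine_structure G M nab"
    and coords: "lie_algebra_coordinates G M i"
    and action: "corresponding_affine_action G M nab i rho"
begin

sublocale group G using lie by (simp add: lie_group_def)

sublocale connection M nab
proof (intro connection.intro connection_axioms.intro)
  show "smooth_charted M" using lie by (auto simp: lie_group_def intro: smooth_manifold_smooth_charted)
  show "affine_connection M nab" using affine_structure by (simp add: left_invariant_affine_structure_def)
qed

lemma topspace_carrier: "topspace (mtop M) = carrier G"
  using lie by (simp add: lie_group_def)

lemma translation_smooth:
  assumes "g \<in> carrier G"
  shows "smooth_map M M (\<lambda>x. g \<otimes>\<^bsub>G\<^esub> x)"
proof -
  have M: "smooth_charted M" by (rule smooth_charted_axioms)
  have "smooth_map M (prod_mfd M M) (\<lambda>x. (g, x))"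
    using assms by (intro smooth_map_Pair M smooth_map_const smooth_map_ident charted_axioms) (simp add: topspace_carrier)
  moreover have "smooth_map (prod_mfd M M) M (\<lambda>(x, y). x \<otimes>\<^bsub>G\<^esub> y)" using lie by (simp add: lie_group_def)
  ultimately have "smooth_map M M (\<lambda>x. (\<lambda>(x, y). x \<otimes>\<^bsub>G\<^esub> y) (g, x))"
    by (intro smooth_map_compose[OF charted_axioms smooth_charted.axioms(1)[OF smooth_charted_prod[OF M M]] charted_axioms])
  then show ?thesis by simp
qed

definition L :: "real^'n \<Rightarrow> 'g vfield" where
  "L = inv_into (left_invariant_fields G M) i"

lemma L_invariant: "L v \<in> left_invariant_fields G M" and i_L: "i (L v) = v"
proof -
  have "v \<in> i ` left_invariant_fields G M"
    using coords by (simp add: lie_algebra_coordinates_def bij_betw_def)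
  then show "L v \<in> left_invariant_fields G M" "i (L v) = v"
    unfolding L_def by (rule inv_into_into, rule f_inv_into_f)
qed

lemma L_i: "X \<in> left_invariant_fields G M \<Longrightarrow> L (i X) = X"
  using coords unfolding L_def by (simp add: lie_algebra_coordinates_def bij_betw_def)

lemma i_linear:
  assumes "X \<in> left_invariant_fields G M"
  shows "Y \<in> left_invariant_fields G M \<Longrightarrow> i (X + Y) = i X + i Y"
    and "i (scale_field (\<lambda>_. c) X) = c *\<^sub>R i X"
  using coords assms by (simp_all add: lie_algebra_coordinates_def)

lemma left_invariant_fieldsD:
  assumes "X \<in> left_invariant_fields G M"
  shows "X \<in> vector_fields M"
    and "g \<in> carrier G \<Longrightarrow> h \<in> carrier G \<Longrightarrow> differential M (\<lambda>x. g \<otimes>\<^bsub>G\<^esub> x) h (X h) = X (g \<otimes>\<^bsub>G\<^esub> h)"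
  using assms by (simp_all add: left_invariant_fields_def)

lemma left_invariant_fields_plus:
  assumes "X \<in> left_invariant_fields G M" "Y \<in> left_invariant_fields G M"
  shows "X + Y \<in> left_invariant_fields G M"
proof -
  have "differential M (\<lambda>x. g \<otimes>\<^bsub>G\<^esub> x) h ((X + Y) h) = (X + Y) (g \<otimes>\<^bsub>G\<^esub> h)"
    if "g \<in> carrier G" "h \<in> carrier G" for g h
    using left_invariant_fieldsD(2)[OF assms(1) that, symmetric] left_invariant_fieldsD(2)[OF assms(2) that, symmetric]
    by (simp add: differential_def fun_eq_iff)
  then show ?thesis
    using assms vector_fields_plus by (simp add: left_invariant_fields_def)
qed

lemma left_invariant_fields_scale:
  assumes "X \<in> left_invariant_fields G M"
  shows "scale_field (\<lambda>_. c) X \<in> left_invariant_fields G M"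
proof -
  have "differential M (\<lambda>x. g \<otimes>\<^bsub>G\<^esub> x) h (scale_field (\<lambda>_. c) X h) = scale_field (\<lambda>_. c) X (g \<otimes>\<^bsub>G\<^esub> h)"
    if "g \<in> carrier G" "h \<in> carrier G" for g h
    using left_invariant_fieldsD(2)[OF assms(1) that, symmetric]
    by (simp add: differential_def scale_field_def fun_eq_iff)
  then show ?thesis
    using assms vector_fields_scale[OF _ smooth_fun_on_const] by (simp add: left_invariant_fields_def)
qed

lemma L_plus: "L (v + w) = L v + L w"
  using L_i[OF left_invariant_fields_plus[OF L_invariant L_invariant], of v w]
  by (simp add: i_linear(1)[OF L_invariant L_invariant] i_L)

lemma L_scale: "L (c *\<^sub>R v) = scale_field (\<lambda>_. c) (L v)"
  using L_i[OF left_invariant_fields_scale[OF L_invariant], of c v]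
  by (simp add: i_linear(2)[OF L_invariant] i_L)

lemma L_translate:
  assumes "g \<in> carrier G" "h \<in> carrier G"
  shows "differential M (\<lambda>x. g \<otimes>\<^bsub>G\<^esub> x) h (L v h) = L v (g \<otimes>\<^bsub>G\<^esub> h)"
  by (rule left_invariant_fieldsD(2)[OF L_invariant assms])

text \<open>An invariant field that vanishes at one point vanishes everywhere. So it is its own multiple by
  \<open>0\<close>, and \<open>i\<close> maps it to \<open>0\<close>.\<close>

lemma L_inj:
  assumes p: "p \<in> carrier G" and "L v p = 0"
  shows "v = 0"
proof -
  have "L v q = 0" for q
  proof (cases "q \<in> carrier G")
    case True
    have "L v q = differential M (\<lambda>x. (q \<otimes>\<^bsub>G\<^esub> inv\<^bsub>G\<^esub> p) \<otimes>\<^bsub>G\<^esub> x) p (L v p)"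
      using L_translate[of "q \<otimes>\<^bsub>G\<^esub> inv\<^bsub>G\<^esub> p" p v] p True by (simp add: m_assoc)
    then show ?thesis using assms(2) by (simp add: differential_def fun_eq_iff)
  next
    case False
    then show ?thesis
      using vector_fields_outside[OF left_invariant_fieldsD(1)[OF L_invariant]] by (simp add: topspace_carrier)
  qed
  then have "L v = scale_field (\<lambda>_. 0) (L v)" by (simp add: scale_field_def fun_eq_iff)
  then have "i (L v) = 0 *\<^sub>R i (L v)" using i_linear(2)[OF L_invariant, of 0 v] by simp
  then show ?thesis by (simp add: i_L)
qed

text \<open>The space of the fields \<open>L v\<close> has the dimension of \<open>G\<close>, and by \<open>L_inj\<close> its elements are
  determined by their values at any point. So the bijection \<open>i\<close> alone yields a global frame of invariant
  fields.\<close>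

sublocale left: framed M L
proof
  show "L v \<in> vector_fields M" for v by (rule left_invariant_fieldsD(1)[OF L_invariant])
  show "L (v + w) p = L v p + L w p" for v w p by (simp add: L_plus)
  show "L (c *\<^sub>R v) p = (\<lambda>f. c * L v p f)" for c v p by (simp add: L_scale scale_field_def)
  show "v = 0" if "p \<in> topspace (mtop M)" "L v p = 0" for p v
    using that L_inj by (simp add: topspace_carrier)
qed

sublocale left: smooth_framed M L
  by (rule framed_smooth_framed[OF left.framed_axioms])

sublocale left: framed_connection M nab L ..

text \<open>Left translation fixes \<open>X\<close> and \<open>Y\<close>, hence also \<open>nab X Y\<close>.\<close>

lemma nab_left_invariant:
  assumes X: "X \<in> left_invariant_fields G M" and Y: "Y \<in> left_invariant_fields G M"
  shows "nab X Y \<in> left_invariant_fields G M"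
proof -
  have fixed: "left_translate_field G M g Z = Z" if g: "g \<in> carrier G" and Z: "Z \<in> left_invariant_fields G M" for g Z
  proof
    fix p show "left_translate_field G M g Z p = Z p"
      using left_invariant_fieldsD(2)[OF Z g, of "inv\<^bsub>G\<^esub> g \<otimes>\<^bsub>G\<^esub> p"] g
        vector_fields_outside[OF left_invariant_fieldsD(1)[OF Z]]
      by (simp add: left_translate_field_def topspace_carrier m_assoc[symmetric])
  qed
  note XY = left_invariant_fieldsD(1)[OF X] left_invariant_fieldsD(1)[OF Y]
  have inv: "left_translate_field G M g (nab X Y) = nab X Y" if "g \<in> carrier G" for g
  proof -
    have "nab (left_translate_field G M g X) (left_translate_field G M g Y) = left_translate_field G M g (nab X Y)"
      using affine_structure that XY unfolding left_invariant_affine_structure_def left_invariant_connection_def by blast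
    then show ?thesis by (simp add: fixed that X Y)
  qed
  have "differential M (\<lambda>x. g \<otimes>\<^bsub>G\<^esub> x) h (nab X Y h) = nab X Y (g \<otimes>\<^bsub>G\<^esub> h)"
    if "g \<in> carrier G" "h \<in> carrier G" for g h
    using fun_cong[OF inv[OF that(1)], of "g \<otimes>\<^bsub>G\<^esub> h"] that
    by (simp add: left_translate_field_def m_assoc[symmetric])
  then show ?thesis using nab_field[OF XY] by (simp add: left_invariant_fields_def)
qed

text \<open>The linear part of the differential of the affine action at the unit, which is the operator
  \<open>nab (L u)\<close> on invariant fields in the coordinates \<open>i\<close>.\<close>

definition D :: "real^'n \<Rightarrow> real^'n^'n" where
  "D u = fst (eta G M nab i (L u))"

lemma nab_L: "nab (L u) (L w) = L (D u *v w)"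
proof -
  note f = left_invariant_fieldsD(1)[OF L_invariant]
  have "linear (\<lambda>v. i (nab (L u) (L v)))"
  proof (rule linearI)
    show "i (nab (L u) (L (v + w))) = i (nab (L u) (L v)) + i (nab (L u) (L w))" for v w
      by (simp add: L_plus nab_plus(2)[OF f f f] i_linear(1) nab_left_invariant L_invariant)
    fix c v
    have "nab (L u) (L (c *\<^sub>R v)) = scale_field (\<lambda>p. L u p (\<lambda>_. c)) (L v) + scale_field (\<lambda>_. c) (nab (L u) (L v))"
      unfolding L_scale by (rule nab_scale(2)[OF f f smooth_fun_on_const])
    also have "scale_field (\<lambda>p. L u p (\<lambda>_. c)) (L v) = 0"
    proof (intro ext)
      fix p h
      show "scale_field (\<lambda>p. L u p (\<lambda>_. c)) (L v) p h = 0 p h"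
        using tangent_const[OF left.frame_tangent] vector_fields_outside[OF f]
        by (cases "p \<in> topspace (mtop M)") (simp_all add: scale_field_def)
    qed
    finally show "i (nab (L u) (L (c *\<^sub>R v))) = c *\<^sub>R i (nab (L u) (L v))"
      by (simp add: i_linear(2) nab_left_invariant L_invariant)
  qed
  then have "D u *v w = i (nab (L u) (L w))"
    unfolding D_def eta_def fst_conv L_def[symmetric]
    by (intro matrix_works) (simp add: linear_matrix_vector_mul_eq)
  then show ?thesis by (simp add: L_i nab_left_invariant L_invariant)
qed

definition \<theta> :: "'g \<Rightarrow> real^'n^'n" where
  "\<theta> = fst \<circ> rho"

lemma \<theta>_mult: "g \<in> carrier G \<Longrightarrow> h \<in> carrier G \<Longrightarrow> \<theta> (g \<otimes>\<^bsub>G\<^esub> h) = \<theta> g ** \<theta> h"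
  using action hom_mult[of rho G aff_group g h]
  by (simp add: corresponding_affine_action_def aff_group_def \<theta>_def case_prod_beta)

lemma \<theta>_invertible: "g \<in> carrier G \<Longrightarrow> invertible (\<theta> g)"
  using action hom_in_carrier[of rho G aff_group g]
  by (auto simp: corresponding_affine_action_def aff_group_def \<theta>_def)

lemma \<theta>_one: "\<theta> \<one>\<^bsub>G\<^esub> = mat 1"
proof -
  have "\<theta> \<one>\<^bsub>G\<^esub> ** \<theta> \<one>\<^bsub>G\<^esub> = \<theta> \<one>\<^bsub>G\<^esub>" using \<theta>_mult[of "\<one>\<^bsub>G\<^esub>" "\<one>\<^bsub>G\<^esub>"] by simp
  then show ?thesis
    by (metis \<theta>_invertible matrix_inv_left matrix_mul_assoc matrix_mul_lid one_closed)
qed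

lemma \<theta>_smooth: "smooth_fun_on M (carrier G) \<theta>"
proof -
  have "smooth_fun_on M (carrier G) (\<lambda>x. fst (rho x))"
    using action openin_topspace[of "mtop M"]
    by (intro smooth_fun_on_bounded_linear[OF bounded_linear_fst])
      (simp_all add: corresponding_affine_action_def topspace_carrier)
  then show ?thesis by (simp add: \<theta>_def o_def)
qed

lemma \<theta>_smooth_near: "p \<in> carrier G \<Longrightarrow> smooth_near M p \<theta>"
  using smooth_nearI[OF openin_topspace _ \<theta>_smooth[folded topspace_carrier]] by (simp add: topspace_carrier)

text \<open>As \<open>L u\<close> is invariant and \<open>\<theta> (p x) = \<theta> p \<theta> x\<close>, the derivative at \<open>p\<close> is the one at the unit,
  multiplied by \<open>\<theta> p\<close>.\<close>

lemma \<theta>_deriv: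
  assumes p: "p \<in> carrier G"
  shows "dir_deriv (L u p) \<theta> = \<theta> p ** D u"
proof -
  let ?e = "\<one>\<^bsub>G\<^esub>"
  have t: "L u ?e \<in> tangent_space M ?e" by (rule left.frame_tangent) (simp add: topspace_carrier)
  have op: "openin (mtop M) (carrier G)" using openin_topspace[of "mtop M"] by (simp add: topspace_carrier)
  have near: "smooth_near M ?e rho"
    using action by (intro smooth_nearI[OF op]) (simp_all add: corresponding_affine_action_def)
  have unit: "dir_deriv (L u ?e) \<theta> = D u"
    using dir_deriv_bounded_linear[OF bounded_linear_fst t near] action L_invariant
    by (simp add: corresponding_affine_action_def D_def \<theta>_def o_def)
  have "dir_deriv (L u p) \<theta> = dir_deriv (L u ?e) (\<lambda>x. \<theta> (p \<otimes>\<^bsub>G\<^esub> x))"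
    using dir_deriv_differential[OF charted_axioms, of "\<lambda>x. p \<otimes>\<^bsub>G\<^esub> x" ?e \<theta> "L u ?e"] L_translate[of p ?e u] \<theta>_smooth_near[OF p] p
    by simp
  also have "\<dots> = dir_deriv (L u ?e) (\<lambda>x. \<theta> p ** \<theta> x)"
    by (rule dir_deriv_local[OF t _ op, symmetric])
      (use p in \<open>auto simp: \<theta>_mult intro: smooth_near_bounded_linear[OF bounded_linear_matrix_mult_left \<theta>_smooth_near]\<close>)
  also have "\<dots> = \<theta> p ** D u"
    using dir_deriv_bounded_linear[OF bounded_linear_matrix_mult_left t \<theta>_smooth_near] unit by simp
  finally show ?thesis .
qed

text \<open>Differentiating \<open>\<theta> (\<theta>\<inverse> v) = v\<close> along \<open>L u\<close>, with \<open>\<theta>_deriv\<close>, gives \<open>- D u (\<theta>\<inverse> v)\<close> for the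
  derivative of the components \<open>\<theta>\<inverse> v\<close>. This cancels the contribution \<open>D u (\<theta>\<inverse> v)\<close> of the invariant
  frame to \<open>nab (L u) (P v)\<close>, so that \<open>P v\<close> is parallel.\<close>

definition P :: "real^'n \<Rightarrow> 'g vfield" where
  "P v = (\<lambda>p. L (matrix_inv (\<theta> p) *v v) p)"

lemma \<theta>_inv: "p \<in> carrier G \<Longrightarrow> \<theta> p *v (matrix_inv (\<theta> p) *v v) = v"
  by (simp add: matrix_vector_mul_assoc matrix_inv_right \<theta>_invertible)

lemma inv_\<theta>: "p \<in> carrier G \<Longrightarrow> matrix_inv (\<theta> p) *v (\<theta> p *v v) = v"
  by (simp add: matrix_vector_mul_assoc matrix_inv_left \<theta>_invertible)

lemma P_components_smooth: "smooth_fun_on M (topspace (mtop M)) (\<lambda>p. matrix_inv (\<theta> p) *v v)"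
  by (rule smooth_fun_on_linear_system[OF openin_topspace \<theta>_smooth[folded topspace_carrier] smooth_fun_on_const[of _ v]])
    (simp_all add: topspace_carrier \<theta>_invertible \<theta>_inv)

sublocale parallel: framed M P
proof
  show "P v \<in> vector_fields M" for v
    unfolding P_def by (rule left.frame_combination_field[OF P_components_smooth])
  show "P (v + w) p = P v p + P w p" for v w p
    by (simp add: P_def matrix_vector_right_distrib left.frame_plus)
  show "P (c *\<^sub>R v) p = (\<lambda>f. c * P v p f)" for c v p
    by (simp add: P_def matrix_vector_mult_scaleR left.frame_scale)
  show "v = 0" if "p \<in> topspace (mtop M)" "P v p = 0" for p v
    using left.frame_inj[OF that(1) that(2)[unfolded P_def]] \<theta>_inv[of p v] that(1) by (simp add: topspace_carrier)
qed

sublocale parallel: smooth_framed M P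
  by (rule framed_smooth_framed[OF parallel.framed_axioms])

sublocale parallel: framed_connection M nab P ..

lemma nab_L_P: "nab (L u) (P v) = 0"
proof (intro ext)
  fix p h
  let ?f = "\<lambda>p. matrix_inv (\<theta> p) *v v"
  have "nab (L u) (P v) p h = L (dir_deriv (L u p) ?f) p h + (\<Sum>b\<in>Basis. (?f p \<bullet> b) * L (D u *v b) p h)"
    unfolding P_def left.nab_combination_right[OF P_components_smooth left.frame_field] by (simp add: nab_L)
  also have "(\<Sum>b\<in>Basis. (?f p \<bullet> b) * L (D u *v b) p h) = L (D u *v ?f p) p h"
  proof -
    have "linear (\<lambda>w. L (D u *v w) p h)"
      by (rule linearI) (simp_all add: matrix_vector_right_distrib matrix_vector_mult_scaleR left.frame_plus left.frame_scale)
    from linear_Basis_expansion[OF this, of "?f p"] show ?thesis by simp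
  qed
  finally have eq: "nab (L u) (P v) p h = L (dir_deriv (L u p) ?f + D u *v ?f p) p h"
    by (simp add: left.frame_plus)
  show "nab (L u) (P v) p h = 0 p h"
  proof (cases "p \<in> carrier G")
    case True
    then have p: "p \<in> topspace (mtop M)" by (simp add: topspace_carrier)
    have n: "smooth_near M p ?f" by (rule smooth_nearI[OF openin_topspace p P_components_smooth])
    have "0 = dir_deriv (L u p) (\<lambda>q. v)" using dir_deriv_const[OF left.frame_tangent[OF p]] by simp
    also have "\<dots> = dir_deriv (L u p) (\<lambda>q. \<theta> q *v ?f q)"
      by (rule dir_deriv_local[OF left.frame_tangent[OF p] smooth_near_const[OF p] openin_topspace p])
        (simp add: topspace_carrier \<theta>_inv)
    also have "\<dots> = \<theta> p *v dir_deriv (L u p) ?f + (\<theta> p ** D u) *v ?f p"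
      using dir_deriv_bilinear[OF bounded_bilinear_matrix_vector_mult left.frame_tangent[OF p] \<theta>_smooth_near[OF True] n]
      by (simp add: \<theta>_deriv[OF True])
    also have "\<dots> = \<theta> p *v (dir_deriv (L u p) ?f + D u *v ?f p)"
      by (simp add: matrix_vector_right_distrib matrix_vector_mul_assoc matrix_mul_assoc)
    finally have "dir_deriv (L u p) ?f + D u *v ?f p = 0"
      using invertible_mult_eq_0[OF \<theta>_invertible[OF True]] by metis
    then show ?thesis unfolding eq by (simp add: left.frame_zero)
  next
    case False
    then show ?thesis
      unfolding eq using vector_fields_outside[OF left.frame_field] by (simp add: topspace_carrier)
  qed
qed

text \<open>\<open>nab Z (P v)\<close> is linear over functions in \<open>Z\<close>, so the case \<open>Z = L u\<close> suffices.\<close>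

lemma P_parallel:
  assumes "Z \<in> vector_fields M"
  shows "nab Z (P v) = 0"
proof (intro ext)
  fix p h
  show "nab Z (P v) p h = 0 p h"
    using left.nab_combination_left[OF left.coef_smooth[OF assms] parallel.frame_field, of v p h]
    by (simp add: nab_L_P flip: left.vector_field_expansion[OF assms])
qed

text \<open>Since the torsion vanishes, the bracket is \<open>nab (P v) (P w) - nab (P w) (P v)\<close>.\<close>

lemma P_commute: "lie_bracket M (P v) (P w) = 0"
proof -
  have "nab (P v) (P w) - nab (P w) (P v) = lie_bracket M (P v) (P w)"
    using affine_structure parallel.frame_field
    unfolding left_invariant_affine_structure_def torsion_free_def by blast
  then show ?thesis by (simp add: P_parallel parallel.frame_field)
qed

text \<open>At \<open>g h\<close>, the invariant components \<open>\<theta> (g h)\<inverse> \<theta> g v\<close> of the right-hand side reduce to the components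
  \<open>\<theta> h\<inverse> v\<close> of \<open>P v\<close> at \<open>h\<close>.\<close>

lemma P_translate:
  assumes "g \<in> carrier G" "h \<in> carrier G"
  shows "differential M (\<lambda>x. g \<otimes>\<^bsub>G\<^esub> x) h (P v h) = P (\<theta> g *v v) (g \<otimes>\<^bsub>G\<^esub> h)"
proof -
  have "matrix_inv (\<theta> (g \<otimes>\<^bsub>G\<^esub> h)) *v (\<theta> g *v v) =
      matrix_inv (\<theta> (g \<otimes>\<^bsub>G\<^esub> h)) *v (\<theta> (g \<otimes>\<^bsub>G\<^esub> h) *v (matrix_inv (\<theta> h) *v v))"
    by (simp add: \<theta>_mult assms \<theta>_inv flip: matrix_vector_mul_assoc)
  also have "\<dots> = matrix_inv (\<theta> h) *v v" using assms by (simp add: inv_\<theta>)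
  finally show ?thesis unfolding P_def using L_translate[OF assms] by simp
qed

end

section \<open>Tangent vectors of products\<close>

lemma differential_plus: "differential N F p (\<xi> + \<zeta>) = differential N F p \<xi> + differential N F p \<zeta>"
  by (simp add: differential_def fun_eq_iff)

lemma differential_scale: "differential N F p (\<lambda>f. c * \<xi> f) = (\<lambda>f. c * differential N F p \<xi> f)"
  by (simp add: differential_def fun_eq_iff)

lemma dir_deriv_zero: "dir_deriv 0 F = 0"
  by (simp add: dir_deriv_def)

context smooth_charted
begin

lemma dir_deriv_add:
  fixes F H :: "'m \<Rightarrow> 'b::euclidean_space"
  assumes "\<xi> \<in> tangent_space M p" "smooth_near M p F" "smooth_near M p H"
  shows "dir_deriv \<xi> (\<lambda>x. F x + H x) = dir_deriv \<xi> F + dir_deriv \<xi> H"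
  by (rule euclidean_eqI)
    (simp add: dir_deriv_inner inner_add_left tangent_add[OF assms(1) smooth_near_inner[OF assms(2)] smooth_near_inner[OF assms(3)]])

lemma chart_vector_linear:
  assumes "(U, \<phi>) \<in> atlas M" "p \<in> U"
  shows "linear (\<lambda>w. chart_vector U \<phi> p w f)"
proof (cases "smooth_near M p f")
  case True
  then show ?thesis
    unfolding chart_vector_def using has_derivative_linear[OF smooth_near_has_derivative[OF True assms]] by simp
next
  case False
  then show ?thesis by (simp add: chart_vector_def linear_zero)
qed

end

interpretation eucl: smooth_charted "euclidean_mfd :: ('e::euclidean_space, 'e) mfd"
  by (rule smooth_charted_euclidean)

lemma euclidean_topspace: "topspace (mtop euclidean_mfd) = UNIV"
  by (simp add: euclidean_mfd_def)

lemma euclidean_atlas: "(UNIV, \<lambda>x. x) \<in> atlas euclidean_mfd"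
  by (simp add: euclidean_mfd_def)

text \<open>The constant field with value \<open>w\<close>, as a field of derivations.\<close>

definition coordinate_vector :: "'e::euclidean_space \<Rightarrow> 'e vfield" where
  "coordinate_vector w y = eucl.chart_vector UNIV (\<lambda>x. x) y w"

lemma coordinate_vector_tangent: "coordinate_vector w y \<in> tangent_space euclidean_mfd y"
  unfolding coordinate_vector_def by (rule eucl.chart_vector_tangent[OF euclidean_atlas]) simp

lemma coordinate_vector_ident: "dir_deriv (coordinate_vector w y) (\<lambda>x. x) = w"
  unfolding coordinate_vector_def by (rule eucl.dir_deriv_chart_vector[OF euclidean_atlas]) simp

lemma coordinate_vector_linear: "linear (\<lambda>w. coordinate_vector w y f)"
  unfolding coordinate_vector_def by (rule eucl.chart_vector_linear[OF euclidean_atlas]) simp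

lemma coordinate_vector_plus: "coordinate_vector (v + w) y = coordinate_vector v y + coordinate_vector w y"
  by (rule ext) (simp add: linear_add[OF coordinate_vector_linear])

lemma coordinate_vector_scale: "coordinate_vector (c *\<^sub>R w) y = (\<lambda>f. c * coordinate_vector w y f)"
  by (rule ext) (simp add: linear_cmul[OF coordinate_vector_linear])

locale euclidean_product = smooth_charted M for M :: "('m, 'e::euclidean_space) mfd" +
  fixes N :: "('m \<times> 'f::euclidean_space, 'e \<times> 'f) mfd"
  defines "N \<equiv> prod_mfd M euclidean_mfd"
begin

sublocale N: smooth_charted N
  unfolding N_def by (rule smooth_charted_prod[OF smooth_charted_axioms eucl.smooth_charted_axioms])

lemma topspace_N: "z \<in> topspace (mtop N) \<longleftrightarrow> fst z \<in> topspace (mtop M)"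
  by (cases z) (simp add: N_def mtop_prod euclidean_topspace)

lemma atlas_N: "(U, \<phi>) \<in> atlas M \<Longrightarrow> (U \<times> UNIV, \<lambda>(x, y). (\<phi> x, y)) \<in> atlas N"
  unfolding N_def using atlas_prodI[OF _ euclidean_atlas] by fast

lemma atlas_NE:
  assumes "(A, \<kappa>) \<in> atlas N"
  obtains U \<phi> where "A = U \<times> UNIV" "\<kappa> = (\<lambda>z. (\<phi> (fst z), snd z))" "(U, \<phi>) \<in> atlas M"
  using assms unfolding N_def prod_mfd_def euclidean_mfd_def by (force simp: case_prod_beta)

lemma smooth_map_fst_N: "smooth_map N M fst"
  unfolding N_def by (rule smooth_map_fst[OF smooth_charted_axioms eucl.smooth_charted_axioms])

lemma smooth_map_snd_N: "smooth_map N euclidean_mfd snd"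
  unfolding N_def by (rule smooth_map_snd[OF smooth_charted_axioms eucl.smooth_charted_axioms])

lemma smooth_map_to_N:
  assumes "smooth_charted K" "smooth_map K M F" "smooth_map K euclidean_mfd H"
  shows "smooth_map K N (\<lambda>x. (F x, H x))"
  unfolding N_def by (rule smooth_map_Pair[OF assms(1) smooth_charted_axioms eucl.smooth_charted_axioms assms(2,3)])

lemma smooth_near_fst:
  assumes "smooth_near M (fst z) f"
  shows "smooth_near N z (\<lambda>z. f (fst z))"
  using smooth_near_compose[OF N.charted_axioms charted_axioms smooth_map_fst_N _ assms] smooth_near_topspace[OF assms]
  by (simp add: topspace_N)

lemma smooth_fun_on_fst:
  assumes "openin (mtop M) W" "smooth_fun_on M W f"
  shows "smooth_fun_on N (W \<times> UNIV) (\<lambda>z. f (fst z))"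
  by (rule N.smooth_fun_on_subset[OF smooth_fun_on_compose[OF N.charted_axioms charted_axioms smooth_map_fst_N assms]])
    (use openin_subset[OF assms(1)] topspace_N in auto)

lemma openin_times_UNIV: "openin (mtop M) W \<Longrightarrow> openin (mtop N) (W \<times> UNIV)"
  by (simp add: N_def mtop_prod openin_prod_Times_iff euclidean_mfd_def)

lemma smooth_fun_on_snd: "smooth_fun_on N (topspace (mtop N)) snd"
  using smooth_map_chart[OF smooth_map_snd_N euclidean_atlas] by (rule N.smooth_fun_on_subset) simp

lemma smooth_near_snd: "fst z \<in> topspace (mtop M) \<Longrightarrow> smooth_near N z snd"
  by (rule N.smooth_nearI[OF openin_topspace _ smooth_fun_on_snd]) (simp add: topspace_N)

text \<open>The two functions are the components of a chart of the product.\<close>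

lemma tangent_eqI_N:
  assumes "\<xi> \<in> tangent_space N z" "\<zeta> \<in> tangent_space N z" and c: "(U, \<phi>) \<in> atlas M" "fst z \<in> U"
    and "dir_deriv \<xi> (\<lambda>z. \<phi> (fst z)) = dir_deriv \<zeta> (\<lambda>z. \<phi> (fst z))" "dir_deriv \<xi> snd = dir_deriv \<zeta> snd"
  shows "\<xi> = \<zeta>"
proof (rule N.tangent_eqI[OF assms(1,2) atlas_N[OF c(1)]])
  show "z \<in> U \<times> UNIV" using c(2) by (simp add: mem_Times_iff)
  have p: "fst z \<in> topspace (mtop M)" using openin_subset[OF openin_chart[OF c(1)]] c(2) by auto
  note s = smooth_near_fst[OF smooth_near_chart[OF c]] smooth_near_snd[OF p]
  show "dir_deriv \<xi> (\<lambda>(x, y). (\<phi> x, y)) = dir_deriv \<zeta> (\<lambda>(x, y). (\<phi> x, y))"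
    using N.dir_deriv_Pair[OF assms(1) s] N.dir_deriv_Pair[OF assms(2) s] assms(5,6) by (simp add: case_prod_unfold)
qed

text \<open>The vector with components \<open>\<xi>\<close> and \<open>w\<close> under the splitting of the tangent space of a product.\<close>

definition pair_vector :: "'m tvec \<Rightarrow> 'f \<Rightarrow> 'm \<times> 'f \<Rightarrow> ('m \<times> 'f) tvec" where
  "pair_vector \<xi> w z = differential N (\<lambda>x. (x, snd z)) (fst z) \<xi> +
     differential N (\<lambda>y. (fst z, y)) (snd z) (coordinate_vector w (snd z))"

lemma slice_smooth: "smooth_map M N (\<lambda>x. (x, v))"
  by (intro smooth_map_to_N smooth_charted_axioms smooth_map_ident smooth_map_const charted_axioms)
    (simp add: euclidean_topspace)

lemma fibre_smooth: "p \<in> topspace (mtop M) \<Longrightarrow> smooth_map euclidean_mfd N (\<lambda>y. (p, y))"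
  by (intro smooth_map_to_N eucl.smooth_charted_axioms smooth_map_ident smooth_map_const eucl.charted_axioms)

lemma pair_vector_outside: "fst z \<notin> topspace (mtop M) \<Longrightarrow> pair_vector \<xi> w z = 0"
  using N.smooth_near_topspace[of z] topspace_N[of z]
  by (auto simp: pair_vector_def differential_def fun_eq_iff)

context
  fixes z :: "'m \<times> 'f" and \<xi> :: "'m tvec"
  assumes z: "fst z \<in> topspace (mtop M)" and \<xi>: "\<xi> \<in> tangent_space M (fst z)"
begin

lemma pair_vector_tangent: "pair_vector \<xi> w z \<in> tangent_space N z"
  unfolding pair_vector_def
  using differential_tangent[OF charted_axioms N.charted_axioms slice_smooth z \<xi>, of "snd z"]
    differential_tangent[OF eucl.charted_axioms N.charted_axioms fibre_smooth[OF z] _ coordinate_vector_tangent, of "snd z"]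
  by (intro tangent_space_plus) (simp_all add: euclidean_topspace)

lemma dir_deriv_pair_vector_fst:
  fixes F :: "'m \<Rightarrow> 'b::euclidean_space"
  assumes "smooth_near M (fst z) F"
  shows "dir_deriv (pair_vector \<xi> w z) (\<lambda>z. F (fst z)) = dir_deriv \<xi> F"
proof -
  have s: "smooth_near N (fst z, snd z) (\<lambda>z. F (fst z))" using smooth_near_fst[OF assms] by simp
  show ?thesis
    unfolding pair_vector_def dir_deriv_plus
    using dir_deriv_differential[OF N.charted_axioms, of "\<lambda>x. (x, snd z)" "fst z", OF s]
      dir_deriv_differential[OF N.charted_axioms, of "\<lambda>y. (fst z, y)" "snd z", OF s]
    by (simp add: eucl.dir_deriv_const[OF coordinate_vector_tangent])
qed

lemma dir_deriv_pair_vector_snd: "dir_deriv (pair_vector \<xi> w z) snd = w"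
proof -
  have s: "smooth_near N (fst z, snd z) snd" using smooth_near_snd[of z] z by simp
  show ?thesis
    unfolding pair_vector_def dir_deriv_plus
    using dir_deriv_differential[OF N.charted_axioms, of "\<lambda>x. (x, snd z)" "fst z", OF s]
      dir_deriv_differential[OF N.charted_axioms, of "\<lambda>y. (fst z, y)" "snd z", OF s]
    by (simp add: dir_deriv_const[OF \<xi>] coordinate_vector_ident)
qed

lemma differential_fst_pair_vector: "differential M fst z (pair_vector \<xi> w z) = \<xi>"
proof
  fix f
  show "differential M fst z (pair_vector \<xi> w z) f = \<xi> f"
    using dir_deriv_pair_vector_fst[of f] tangent_not_smooth[OF \<xi>, of f]
    by (simp add: differential_def dir_deriv_real o_def)
qed

end

lemma pair_vector_plus: "pair_vector (\<xi> + \<zeta>) (v + w) z = pair_vector \<xi> v z + pair_vector \<zeta> w z"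
  by (simp add: pair_vector_def differential_plus coordinate_vector_plus add_ac)

lemma pair_vector_scale: "pair_vector (\<lambda>f. c * \<xi> f) (c *\<^sub>R w) z = (\<lambda>f. c * pair_vector \<xi> w z f)"
  by (simp add: pair_vector_def differential_scale coordinate_vector_scale fun_eq_iff distrib_left)

text \<open>Both sides have the same derivatives of the coordinates: the graph map does not change the first
  component, and its second component is constant to first order.\<close>

lemma differential_graph:
  assumes p: "p \<in> topspace (mtop M)" and \<xi>: "\<xi> \<in> tangent_space M p"
    and y: "smooth_fun_on M (topspace (mtop M)) y" and "dir_deriv \<xi> y = 0"
  shows "differential N (\<lambda>q. (q, y q)) p \<xi> = pair_vector \<xi> 0 (p, y p)"
proof -
  have g: "smooth_map M N (\<lambda>q. (q, y q))"
    by (intro smooth_map_to_N smooth_charted_axioms smooth_map_ident smooth_map_to_euclidean charted_axioms y)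
  have z: "fst (p, y p) \<in> topspace (mtop M)" "\<xi> \<in> tangent_space M (fst (p, y p))" using p \<xi> by simp_all
  obtain U \<phi> where c: "(U, \<phi>) \<in> atlas M" "p \<in> U" using p by (rule obtain_chart)
  have c': "fst (p, y p) \<in> U" using c(2) by simp
  have s: "smooth_near N (p, y p) (\<lambda>z. \<phi> (fst z))" "smooth_near N (p, y p) snd"
    using smooth_near_fst[of "(p, y p)"] smooth_near_snd[of "(p, y p)"] smooth_near_chart[OF c] p by simp_all
  show ?thesis
  proof (rule tangent_eqI_N[OF _ pair_vector_tangent[OF z] c(1) c'])
    show "differential N (\<lambda>q. (q, y q)) p \<xi> \<in> tangent_space N (p, y p)"
      by (rule differential_tangent[OF charted_axioms N.charted_axioms g p \<xi>])
    show "dir_deriv (differential N (\<lambda>q. (q, y q)) p \<xi>) (\<lambda>z. \<phi> (fst z)) =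
        dir_deriv (pair_vector \<xi> 0 (p, y p)) (\<lambda>z. \<phi> (fst z))"
      using dir_deriv_differential[OF N.charted_axioms, of "\<lambda>q. (q, y q)", OF s(1)]
        dir_deriv_pair_vector_fst[OF z, of \<phi>] smooth_near_chart[OF c] by simp
    show "dir_deriv (differential N (\<lambda>q. (q, y q)) p \<xi>) snd = dir_deriv (pair_vector \<xi> 0 (p, y p)) snd"
      using dir_deriv_differential[OF N.charted_axioms, of "\<lambda>q. (q, y q)", OF s(2)]
        dir_deriv_pair_vector_snd[OF z] assms(4) by simp
  qed
qed

end

text \<open>On the product, the fields \<open>(E u, w)\<close> form a frame, which commutes if the frame \<open>E\<close> does.\<close>

locale framed_product = framed M E + euclidean_product M N
  for M :: "('m, real^'n) mfd" and E and N :: "('m \<times> 'f::euclidean_space, (real^'n) \<times> 'f) mfd" +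
  assumes commute: "lie_bracket M (E u) (E v) = 0"
begin

definition pair_frame :: "(real^'n) \<times> 'f \<Rightarrow> ('m \<times> 'f) vfield" where
  "pair_frame a z = pair_vector (E (fst a) (fst z)) (snd a) z"

lemma pair_frame_tangent: "fst z \<in> topspace (mtop M) \<Longrightarrow> pair_frame a z \<in> tangent_space N z"
  unfolding pair_frame_def by (rule pair_vector_tangent[OF _ frame_tangent])

lemma dir_deriv_pair_frame_fst:
  fixes F :: "'m \<Rightarrow> 'b::euclidean_space"
  shows "smooth_near M (fst z) F \<Longrightarrow> dir_deriv (pair_frame a z) (\<lambda>z. F (fst z)) = dir_deriv (E (fst a) (fst z)) F"
  unfolding pair_frame_def using dir_deriv_pair_vector_fst[OF _ frame_tangent] smooth_near_topspace by blast

lemma dir_deriv_pair_frame_snd: "fst z \<in> topspace (mtop M) \<Longrightarrow> dir_deriv (pair_frame a z) snd = snd a"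
  unfolding pair_frame_def by (rule dir_deriv_pair_vector_snd[OF _ frame_tangent])

lemma pair_frame_field: "pair_frame a \<in> vector_fields N"
proof (rule N.vector_fieldsI)
  show "pair_frame a z \<in> tangent_space N z" if "z \<in> topspace (mtop N)" for z
    using that by (simp add: topspace_N pair_frame_tangent)
  show "pair_frame a z = 0" if "z \<notin> topspace (mtop N)" for z
    using that by (simp add: topspace_N pair_frame_def pair_vector_outside)
  fix A \<kappa> assume "(A, \<kappa>) \<in> atlas N"
  then obtain U \<phi> where A: "A = U \<times> UNIV" "\<kappa> = (\<lambda>z. (\<phi> (fst z), snd z))" and c: "(U, \<phi>) \<in> atlas M"
    by (rule atlas_NE)
  note U = openin_chart[OF c] and UN = openin_times_UNIV[OF openin_chart[OF c]]
  have "smooth_fun_on N (U \<times> UNIV) (\<lambda>z. (dir_deriv (E (fst a) (fst z)) \<phi>, snd a))"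
    by (intro N.smooth_fun_on_Pair UN N.smooth_fun_on_const smooth_fun_on_fst U
        vector_fields_smooth_dir_deriv[OF frame_field] smooth_fun_on_chart[OF c])
  then show "smooth_fun_on N A (\<lambda>z. dir_deriv (pair_frame a z) \<kappa>)"
    unfolding A
  proof (rule N.smooth_fun_on_cong[OF _ UN])
    fix z :: "'m \<times> 'f" assume "z \<in> U \<times> UNIV"
    then have zU: "fst z \<in> U" and z: "fst z \<in> topspace (mtop M)" using openin_subset[OF U] by auto
    note s = smooth_near_chart[OF c zU]
    show "(dir_deriv (E (fst a) (fst z)) \<phi>, snd a) = dir_deriv (pair_frame a z) (\<lambda>z. (\<phi> (fst z), snd z))"
      using N.dir_deriv_Pair[OF pair_frame_tangent[OF z] smooth_near_fst[OF s] smooth_near_snd[OF z]]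
      by (simp add: dir_deriv_pair_frame_fst[OF s] dir_deriv_pair_frame_snd[OF z])
  qed
qed

sublocale pair: framed N pair_frame
proof
  show "pair_frame a \<in> vector_fields N" for a by (rule pair_frame_field)
  show "pair_frame (a + b) z = pair_frame a z + pair_frame b z" for a b z
    by (simp add: pair_frame_def frame_plus pair_vector_plus)
  show "pair_frame (c *\<^sub>R a) z = (\<lambda>f. c * pair_frame a z f)" for c a z
    by (simp add: pair_frame_def frame_scale pair_vector_scale)
  fix z a assume "z \<in> topspace (mtop N)" and zero: "pair_frame a z = 0"
  then have z: "fst z \<in> topspace (mtop M)" by (simp add: topspace_N)
  have snd: "snd a = 0" using dir_deriv_pair_frame_snd[OF z, of a] by (simp add: zero dir_deriv_zero)
  have "differential M fst z (pair_frame a z) = E (fst a) (fst z)"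
    unfolding pair_frame_def by (rule differential_fst_pair_vector[OF z frame_tangent[OF z]])
  moreover have "differential M fst z (0 :: ('m \<times> 'f) tvec) = 0" by (simp add: differential_def fun_eq_iff)
  ultimately have "E (fst a) (fst z) = 0" by (simp add: zero)
  then have "fst a = 0" by (rule frame_inj[OF z])
  with snd show "a = 0" by (simp add: prod_eq_iff)
qed

text \<open>The bracket is a tangent vector, so it is determined by its values on coordinate functions. On a
  coordinate function from \<open>M\<close>, it agrees with the bracket of the fields \<open>E u\<close>, which vanishes. The
  coordinate functions of the second factor have constant derivatives along the frame.\<close>

lemma pair_frame_commute: "lie_bracket N (pair_frame a) (pair_frame b) = 0"
proof
  fix z
  show "lie_bracket N (pair_frame a) (pair_frame b) z = 0 z"
  proof (cases "fst z \<in> topspace (mtop M)")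
    case False
    then show ?thesis by (simp add: N.lie_bracket_outside topspace_N)
  next
    case z: True
    obtain U \<phi> where c: "(U, \<phi>) \<in> atlas M" "fst z \<in> U" using z by (rule obtain_chart)
    note U = openin_chart[OF c(1)]
    have inU: "q \<in> topspace (mtop M)" if "q \<in> U" for q using openin_subset[OF U] that by auto
    have fst_case: "pair_frame a' z (\<lambda>q. pair_frame b' q (\<lambda>z. f (fst z))) = E (fst a') (fst z) (\<lambda>q. E (fst b') q f)"
      if f: "\<And>q. q \<in> U \<Longrightarrow> smooth_near M q f" for a' b' f
    proof -
      have s: "smooth_near M (fst z) (\<lambda>q. E (fst b') q f)" by (rule smooth_near_vfield[OF frame_field f[OF c(2)]])
      have "pair_frame b' q (\<lambda>z. f (fst z)) = E (fst b') (fst q) f" if "q \<in> U \<times> UNIV" for q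
        using dir_deriv_pair_frame_fst[of q f b'] f[of "fst q"] that by (simp add: dir_deriv_real mem_Times_iff)
      then have "pair_frame a' z (\<lambda>q. pair_frame b' q (\<lambda>z. f (fst z))) = pair_frame a' z (\<lambda>q. E (fst b') (fst q) f)"
        using c(2) by (intro tangent_local[OF pair_frame_tangent[OF z] N.smooth_near_vfield[OF pair_frame_field]
              smooth_near_fst[OF s] openin_times_UNIV[OF U]] smooth_near_fst f) (auto simp: mem_Times_iff)
      then show ?thesis using dir_deriv_pair_frame_fst[OF s, of a'] by (simp add: dir_deriv_real)
    qed
    have snd_case: "pair_frame a' z (\<lambda>q. pair_frame b' q (\<lambda>z. snd z \<bullet> e)) = 0" if e: "e \<in> Basis" for a' b' e
    proof -
      have s: "smooth_near N z (\<lambda>z. snd z \<bullet> e)" by (rule N.smooth_near_inner[OF smooth_near_snd[OF z]])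
      have "pair_frame b' q (\<lambda>z. snd z \<bullet> e) = snd b' \<bullet> e" if "q \<in> topspace (mtop N)" for q
        using dir_deriv_inner[OF e, of "pair_frame b' q" snd] dir_deriv_pair_frame_snd[of q b'] that by (simp add: topspace_N)
      then have "pair_frame a' z (\<lambda>q. pair_frame b' q (\<lambda>z. snd z \<bullet> e)) = pair_frame a' z (\<lambda>q. snd b' \<bullet> e)"
        using z by (intro tangent_local[OF pair_frame_tangent[OF z] N.smooth_near_vfield[OF pair_frame_field s]
              N.smooth_near_const openin_topspace]) (simp_all add: topspace_N)
      then show ?thesis using N.tangent_const[OF pair_frame_tangent[OF z]] by simp
    qed
    have "lie_bracket N (pair_frame a) (pair_frame b) z = 0"
    proof (rule tangent_eqI_N[OF _ tangent_space_zero c])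
      show "lie_bracket N (pair_frame a) (pair_frame b) z \<in> tangent_space N z"
        by (rule N.lie_bracket_tangent[OF pair_frame_field pair_frame_field]) (simp add: topspace_N z)
      show "dir_deriv (lie_bracket N (pair_frame a) (pair_frame b) z) (\<lambda>z. \<phi> (fst z)) = dir_deriv 0 (\<lambda>z. \<phi> (fst z))"
      proof (rule euclidean_eqI)
        fix e :: "real^'n" assume e: "e \<in> Basis"
        have f: "smooth_near M q (\<lambda>x. \<phi> x \<bullet> e)" if "q \<in> U" for q
          by (rule smooth_near_inner[OF smooth_near_chart[OF c(1) that]])
        have "lie_bracket M (E (fst a)) (E (fst b)) (fst z) (\<lambda>x. \<phi> x \<bullet> e) = 0" by (simp add: commute)
        then show "dir_deriv (lie_bracket N (pair_frame a) (pair_frame b) z) (\<lambda>z. \<phi> (fst z)) \<bullet> e =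
            dir_deriv 0 (\<lambda>z. \<phi> (fst z)) \<bullet> e"
          using fst_case[OF f, of a b] fst_case[OF f, of b a] smooth_near_fst[OF f[OF c(2)]] f[OF c(2)]
          by (simp add: dir_deriv_inner[OF e] lie_bracket_def)
      qed
      show "dir_deriv (lie_bracket N (pair_frame a) (pair_frame b) z) snd = dir_deriv 0 snd"
        by (rule euclidean_eqI) (simp add: dir_deriv_inner lie_bracket_def snd_case)
    qed
    then show ?thesis by simp
  qed
qed

lemma snd_coef:
  assumes "z \<in> topspace (mtop N)" "\<zeta> \<in> tangent_space N z"
  shows "snd (pair.coef z \<zeta>) = dir_deriv \<zeta> snd"
  using dir_deriv_pair_frame_snd[of z "pair.coef z \<zeta>"] pair.frame_coef[OF assms] assms(1)
  by (simp add: topspace_N)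

lemma fst_coef:
  fixes F :: "'m \<Rightarrow> 'b::euclidean_space"
  assumes "z \<in> topspace (mtop N)" "\<zeta> \<in> tangent_space N z" "smooth_near M (fst z) F"
  shows "dir_deriv (E (fst (pair.coef z \<zeta>)) (fst z)) F = dir_deriv \<zeta> (\<lambda>z. F (fst z))"
  using dir_deriv_pair_frame_fst[OF assms(3), of "pair.coef z \<zeta>"] pair.frame_coef[OF assms(1,2)] by simp

sublocale pair: smooth_framed N pair_frame
proof
  fix X assume X: "X \<in> vector_fields N"
  let ?T = "topspace (mtop N)"
  have "smooth_fun_on N ?T (\<lambda>z. dir_deriv (X z) snd)"
    by (rule N.vector_fields_smooth_dir_deriv[OF X openin_topspace smooth_fun_on_snd])
  then have snd: "smooth_fun_on N ?T (\<lambda>z. snd (pair.coef z (X z)))"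
    by (rule N.smooth_fun_on_cong[OF _ openin_topspace]) (simp add: snd_coef vector_fields_tangent[OF X])
  have fst: "smooth_fun_on N ?T (\<lambda>z. fst (pair.coef z (X z)))"
  proof (rule N.smooth_fun_on_local)
    fix z assume "z \<in> ?T"
    then have "fst z \<in> topspace (mtop M)" by (simp add: topspace_N)
    then obtain U \<phi> where c: "(U, \<phi>) \<in> atlas M" "fst z \<in> U" by (rule obtain_chart)
    note U = openin_chart[OF c(1)] and UN = openin_times_UNIV[OF openin_chart[OF c(1)]]
    note A = frame_matrix[OF framed_axioms c(1)]
    have "smooth_fun_on N (U \<times> UNIV) (\<lambda>z. fst (pair.coef z (X z)))"
    proof (rule N.smooth_fun_on_linear_system[OF UN smooth_fun_on_fst[OF U A(3)]])
      show "smooth_fun_on N (U \<times> UNIV) (\<lambda>z. dir_deriv (X z) (\<lambda>z. \<phi> (fst z)))"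
        by (rule N.vector_fields_smooth_dir_deriv[OF X UN smooth_fun_on_fst[OF U smooth_fun_on_chart[OF c(1)]]])
      fix q :: "'m \<times> 'f" assume q: "q \<in> U \<times> UNIV"
      then have qU: "fst q \<in> U" by auto
      then show "invertible (matrix (\<lambda>v. dir_deriv (E v (fst q)) \<phi>))" by (rule A(2))
      have qT: "q \<in> ?T" using q openin_subset[OF UN] by auto
      show "matrix (\<lambda>v. dir_deriv (E v (fst q)) \<phi>) *v fst (pair.coef q (X q)) = dir_deriv (X q) (\<lambda>z. \<phi> (fst z))"
        unfolding A(1) by (rule fst_coef[OF qT vector_fields_tangent[OF X qT] smooth_near_chart[OF c(1) qU]])
    qed
    then show "\<exists>W'. openin (mtop N) W' \<and> z \<in> W' \<and> smooth_fun_on N W' (\<lambda>z. fst (pair.coef z (X z)))"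
      using UN c(2) by (intro exI[of _ "U \<times> UNIV"]) (simp add: mem_Times_iff)
  qed
  show "smooth_fun_on N ?T (\<lambda>z. pair.coef z (X z))"
    using N.smooth_fun_on_Pair[OF openin_topspace fst snd] by simp
qed

sublocale pair: commuting_frame N pair_frame
  by unfold_locales (rule pair_frame_commute)

end

section \<open>The tangent bundle\<close>

context smooth_charted
begin

abbreviation "TM \<equiv> tangent_bundle M"

definition bundle_chart_domain :: "'m set \<Rightarrow> ('m \<times> 'm tvec) set" where
  "bundle_chart_domain U = (SIGMA p : U. tangent_space M p)"

definition bundle_chart :: "('m \<Rightarrow> 'e) \<Rightarrow> 'm \<times> 'm tvec \<Rightarrow> 'e \<times> 'e" where
  "bundle_chart \<phi> = (\<lambda>(p, \<xi>). (\<phi> p, dir_deriv \<xi> \<phi>))"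

lemma atlas_tangent_bundle:
  "atlas TM = {(bundle_chart_domain U, bundle_chart \<phi>) | U \<phi>. (U, \<phi>) \<in> atlas M}"
  by (simp add: tangent_bundle_def Let_def bundle_chart_domain_def bundle_chart_def)

lemma mtop_tangent_bundle:
  "mtop TM = topology_generated_by
     {W \<inter> \<kappa> -` S | W \<kappa> S. (W, \<kappa>) \<in> atlas TM \<and> open S}"
  by (simp add: tangent_bundle_def Let_def)

lemma bundle_atlasI: "(U, \<phi>) \<in> atlas M \<Longrightarrow> (bundle_chart_domain U, bundle_chart \<phi>) \<in> atlas TM"
  unfolding atlas_tangent_bundle by blast

lemma bundle_atlasE:
  assumes "(W, \<kappa>) \<in> atlas TM"
  obtains U \<phi> where "W = bundle_chart_domain U" "\<kappa> = bundle_chart \<phi>" "(U, \<phi>) \<in> atlas M"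
  using assms unfolding atlas_tangent_bundle by auto

text \<open>The transition map of the tangent bundle induced by the transition map \<open>\<tau>\<close>.\<close>

definition bundle_transition :: "('e \<Rightarrow> 'e) \<Rightarrow> 'e \<times> 'e \<Rightarrow> 'e \<times> 'e" where
  "bundle_transition \<tau> z = (\<tau> (fst z), \<Sum>b\<in>Basis. (snd z \<bullet> b) *\<^sub>R frechet_derivative \<tau> (at (fst z)) b)"

lemma smooth_bundle_transition:
  assumes "open S" "smooth_on S \<tau>"
  shows "smooth_on (S \<times> UNIV) (bundle_transition \<tau>)"
proof -
  have S: "open (S \<times> (UNIV :: 'e set))" using assms(1) by (simp add: open_Times)
  have fs: "smooth_on (S \<times> UNIV) (fst :: 'e \<times> 'e \<Rightarrow> 'e)" "smooth_on (S \<times> UNIV) (snd :: 'e \<times> 'e \<Rightarrow> 'e)"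
    using smooth_on_bounded_linear[OF bounded_linear_fst S smooth_on_id[OF S]]
      smooth_on_bounded_linear[OF bounded_linear_snd S smooth_on_id[OF S]] by simp_all
  show ?thesis
    unfolding bundle_transition_def
    by (intro smooth_on_Pair smooth_on_sum S smooth_on_bilinear[OF bounded_bilinear_scaleR]
        smooth_on_bounded_linear[OF bounded_linear_inner_left] fs(2)
        smooth_on_compose[OF S assms(1) _ fs(1)] smooth_on_derivative assms(2)) auto
qed

lemma bundle_chart_transition:
  assumes c: "(U, \<phi>) \<in> atlas M" "(V, \<psi>) \<in> atlas M" and "p \<in> U" "p \<in> V" and \<xi>: "\<xi> \<in> tangent_space M p"
  shows "bundle_chart \<psi> (p, \<xi>) = bundle_transition (\<lambda>x. \<psi> (inv_into U \<phi> x)) (bundle_chart \<phi> (p, \<xi>))"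
proof -
  note D = smooth_near_has_derivative[OF smooth_near_chart[OF c(2) assms(4)] c(1) assms(3)]
  show ?thesis
    using dir_deriv_chart[OF \<xi> c(1) assms(3) smooth_near_chart[OF c(2) assms(4)] D]
      linear_Basis_expansion[OF has_derivative_linear[OF D], of "dir_deriv \<xi> \<phi>"]
    by (simp add: bundle_chart_def bundle_transition_def inv_chart[OF c(1) assms(3)])
qed

lemma bundle_chart_image:
  assumes c: "(U, \<phi>) \<in> atlas M" and "X \<subseteq> U"
  shows "bundle_chart \<phi> ` bundle_chart_domain X = \<phi> ` X \<times> UNIV"
proof
  show "bundle_chart \<phi> ` bundle_chart_domain X \<subseteq> \<phi> ` X \<times> UNIV"
    by (auto simp: bundle_chart_def bundle_chart_domain_def)
  show "\<phi> ` X \<times> UNIV \<subseteq> bundle_chart \<phi> ` bundle_chart_domain X"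
  proof
    fix z assume "z \<in> \<phi> ` X \<times> (UNIV :: 'e set)"
    then obtain p where p: "p \<in> X" "fst z = \<phi> p" by auto
    let ?\<xi> = "chart_vector U \<phi> p (snd z)"
    have "z = bundle_chart \<phi> (p, ?\<xi>)"
      using p assms by (simp add: bundle_chart_def dir_deriv_chart_vector[OF c] subset_iff prod_eq_iff)
    moreover have "(p, ?\<xi>) \<in> bundle_chart_domain X"
      using p assms chart_vector_tangent[OF c] by (auto simp: bundle_chart_domain_def)
    ultimately show "z \<in> bundle_chart \<phi> ` bundle_chart_domain X" by blast
  qed
qed

lemma inj_on_bundle_chart:
  assumes "(U, \<phi>) \<in> atlas M"
  shows "inj_on (bundle_chart \<phi>) (bundle_chart_domain U)"
proof (rule inj_onI)
  fix x y assume xy: "x \<in> bundle_chart_domain U" "y \<in> bundle_chart_domain U" "bundle_chart \<phi> x = bundle_chart \<phi> y"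
  then have U: "fst x \<in> U" "fst y \<in> U" "\<phi> (fst x) = \<phi> (fst y)"
    and t: "snd x \<in> tangent_space M (fst x)" "snd y \<in> tangent_space M (fst y)"
      "dir_deriv (snd x) \<phi> = dir_deriv (snd y) \<phi>"
    by (auto simp: bundle_chart_domain_def bundle_chart_def)
  have eq: "fst x = fst y" using inj_onD[OF inj_on_chart[OF assms] U(3) U(1,2)] .
  have "snd x = snd y" using tangent_eqI[OF t(1) _ assms U(1) t(3)] t(2) eq by simp
  with eq show "x = y" by (simp add: prod_eq_iff)
qed

text \<open>By injectivity of the chart, it is enough to consider the generators of the topology. For the
  preimage of an open set under another chart, the image is the preimage of that set under the
  continuous transition map.\<close>

lemma bundle_chart_open_image:
  assumes c: "(U, \<phi>) \<in> atlas M" and X: "openin (mtop TM) X"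
  shows "open (bundle_chart \<phi> ` (bundle_chart_domain U \<inter> X))"
  using X unfolding mtop_tangent_bundle openin_topology_generated_by_iff
proof (induction rule: generate_topology_on.induct)
  case Empty
  then show ?case by simp
next
  case (Int a b)
  have "bundle_chart \<phi> ` (bundle_chart_domain U \<inter> (a \<inter> b)) =
      bundle_chart \<phi> ` (bundle_chart_domain U \<inter> a) \<inter> bundle_chart \<phi> ` (bundle_chart_domain U \<inter> b)"
    using inj_on_image_Int[OF inj_on_bundle_chart[OF c], of "bundle_chart_domain U \<inter> a" "bundle_chart_domain U \<inter> b"]
    by (simp add: Int_ac)
  then show ?case using open_Int[OF Int.IH] by simp
next
  case (UN K)
  have "bundle_chart \<phi> ` (bundle_chart_domain U \<inter> \<Union> K) = (\<Union>k\<in>K. bundle_chart \<phi> ` (bundle_chart_domain U \<inter> k))"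
    by blast
  then show ?case using UN by auto
next
  case (Basis s)
  then obtain W \<kappa> S where s: "s = W \<inter> \<kappa> -` S" "(W, \<kappa>) \<in> atlas TM" "open S" by blast
  obtain V \<psi> where V: "W = bundle_chart_domain V" "\<kappa> = bundle_chart \<psi>" and d: "(V, \<psi>) \<in> atlas M"
    using s(2) by (rule bundle_atlasE)
  let ?\<tau> = "bundle_transition (\<lambda>x. \<psi> (inv_into U \<phi> x))"
  let ?R = "\<phi> ` (U \<inter> V) \<times> (UNIV :: 'e set)"
  have op: "open (\<phi> ` (U \<inter> V))" by (rule open_chart_image[OF c openin_chart[OF d]])
  have R: "open ?R" using op by (simp add: open_Times)
  have "continuous_on ?R ?\<tau>"
    by (rule smooth_on_imp_continuous_on[OF smooth_bundle_transition[OF op smooth_transition[OF c d]]])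
  then have "open (?\<tau> -` S \<inter> ?R)" using R s(3) continuous_on_open_vimage by blast
  moreover have "bundle_chart \<phi> ` (bundle_chart_domain U \<inter> s) = ?\<tau> -` S \<inter> ?R"
  proof -
    have "bundle_chart_domain U \<inter> s = {x \<in> bundle_chart_domain (U \<inter> V). ?\<tau> (bundle_chart \<phi> x) \<in> S}"
      using bundle_chart_transition[OF c d] unfolding s(1) V by (auto simp: bundle_chart_domain_def)
    then have "bundle_chart \<phi> ` (bundle_chart_domain U \<inter> s) = ?\<tau> -` S \<inter> bundle_chart \<phi> ` bundle_chart_domain (U \<inter> V)"
      by blast
    then show ?thesis using bundle_chart_image[OF c, of "U \<inter> V"] by simp
  qed
  ultimately show ?case by simp
qed

lemma topspace_tangent_bundle:
  "topspace (mtop TM) = (SIGMA p : topspace (mtop M). tangent_space M p)"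
proof -
  have "topspace (mtop TM) = \<Union> {W \<inter> \<kappa> -` S | W \<kappa> S. (W, \<kappa>) \<in> atlas TM \<and> open S}"
    unfolding mtop_tangent_bundle by (rule topology_generated_by_topspace)
  also have "\<dots> = \<Union> (fst ` atlas TM)"
  proof
    show "\<Union> (fst ` atlas TM) \<subseteq>
        \<Union> {W \<inter> \<kappa> -` S | W \<kappa> S. (W, \<kappa>) \<in> atlas TM \<and> open S}"
    proof
      fix x assume "x \<in> \<Union> (fst ` atlas TM)"
      then obtain W \<kappa> where "(W, \<kappa>) \<in> atlas TM" "x \<in> W" by auto
      then show "x \<in> \<Union> {W \<inter> \<kappa> -` S | W \<kappa> S. (W, \<kappa>) \<in> atlas TM \<and> open S}"
        by (intro UnionI[of "W \<inter> \<kappa> -` UNIV"]) blast+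
    qed
  qed force
  also have "\<dots> = (SIGMA p : topspace (mtop M). tangent_space M p)"
    unfolding atlas_tangent_bundle topspace_eq by (force simp: bundle_chart_domain_def)
  finally show ?thesis .
qed

lemma bundle_chart_vimage_open:
  "(U, \<phi>) \<in> atlas M \<Longrightarrow> open S \<Longrightarrow> openin (mtop TM) (bundle_chart_domain U \<inter> bundle_chart \<phi> -` S)"
  unfolding mtop_tangent_bundle using bundle_atlasI by (intro topology_generated_by_Basis) blast

lemma smooth_charted_tangent_bundle: "smooth_charted TM"
proof
  show "topspace (mtop TM) = \<Union> (fst ` atlas TM)"
    unfolding topspace_tangent_bundle atlas_tangent_bundle topspace_eq by (force simp: bundle_chart_domain_def)
next
  fix W \<kappa> assume "(W, \<kappa>) \<in> atlas TM"
  then obtain U \<phi> where W: "W = bundle_chart_domain U" "\<kappa> = bundle_chart \<phi>" and c: "(U, \<phi>) \<in> atlas M"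
    by (rule bundle_atlasE)
  show "openin (mtop TM) W" using bundle_chart_vimage_open[OF c open_UNIV] unfolding W by simp
  show "inj_on \<kappa> W" unfolding W by (rule inj_on_bundle_chart[OF c])
  show "open (\<kappa> ` (W \<inter> X))" if "openin (mtop TM) X" for X
    unfolding W by (rule bundle_chart_open_image[OF c that])
  show "openin (mtop TM) (W \<inter> \<kappa> -` S)" if "open S" for S
    unfolding W by (rule bundle_chart_vimage_open[OF c that])
  fix W' \<kappa>' assume "(W', \<kappa>') \<in> atlas TM"
  then obtain V \<psi> where W': "W' = bundle_chart_domain V" "\<kappa>' = bundle_chart \<psi>" and d: "(V, \<psi>) \<in> atlas M"
    by (rule bundle_atlasE)
  have im: "\<kappa> ` (W \<inter> W') = \<phi> ` (U \<inter> V) \<times> UNIV"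
  proof -
    have "W \<inter> W' = bundle_chart_domain (U \<inter> V)" unfolding W W' by (auto simp: bundle_chart_domain_def)
    then show ?thesis using bundle_chart_image[OF c, of "U \<inter> V"] unfolding W by simp
  qed
  have op: "open (\<phi> ` (U \<inter> V))" by (rule open_chart_image[OF c openin_chart[OF d]])
  have R: "open (\<kappa> ` (W \<inter> W'))" unfolding im using op by (simp add: open_Times)
  show "smooth_on (\<kappa> ` (W \<inter> W')) (\<lambda>z. \<kappa>' (inv_into W \<kappa> z))"
  proof (rule smooth_on_cong[OF _ R])
    show "smooth_on (\<kappa> ` (W \<inter> W')) (bundle_transition (\<lambda>x. \<psi> (inv_into U \<phi> x)))"
      unfolding im by (rule smooth_bundle_transition[OF op smooth_transition[OF c d]])
    fix z assume "z \<in> \<kappa> ` (W \<inter> W')"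
    then obtain x where x: "x \<in> W" "x \<in> W'" "z = \<kappa> x" by blast
    then have "inv_into W \<kappa> z = x" using inj_on_bundle_chart[OF c] unfolding W by simp
    then show "bundle_transition (\<lambda>x. \<psi> (inv_into U \<phi> x)) z = \<kappa>' (inv_into W \<kappa> z)"
      using bundle_chart_transition[OF c d, of "fst x" "snd x"] x unfolding W W'
      by (auto simp: bundle_chart_domain_def)
  qed
qed

lemma smooth_map_bundle_projection: "smooth_map TM M fst"
proof -
  interpret TM: smooth_charted TM by (rule smooth_charted_tangent_bundle)
  show ?thesis
  proof (rule smooth_mapI)
    show "continuous_map (mtop TM) (mtop M) fst"
      unfolding continuous_map_def
    proof (intro conjI allI impI)
      show "fst \<in> topspace (mtop TM) \<rightarrow> topspace (mtop M)"
        by (auto simp: topspace_tangent_bundle)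
      fix X assume X: "openin (mtop M) X"
      show "openin (mtop TM) {x \<in> topspace (mtop TM). fst x \<in> X}"
      proof (subst openin_subopen, intro ballI)
        fix x assume x: "x \<in> {x \<in> topspace (mtop TM). fst x \<in> X}"
        then have "fst x \<in> topspace (mtop M)" by (auto simp: topspace_tangent_bundle)
        then obtain U \<phi> where c: "(U, \<phi>) \<in> atlas M" "fst x \<in> U" by (rule obtain_chart)
        let ?S = "\<phi> ` (U \<inter> X) \<times> (UNIV :: 'e set)"
        let ?O = "bundle_chart_domain U \<inter> bundle_chart \<phi> -` ?S"
        have "openin (mtop TM) ?O"
          using open_chart_image[OF c(1) X] by (intro bundle_chart_vimage_open[OF c(1)]) (simp add: open_Times)
        moreover have "x \<in> ?O"
          using x c(2) by (auto simp: bundle_chart_domain_def bundle_chart_def topspace_tangent_bundle)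
        moreover have "?O \<subseteq> {x \<in> topspace (mtop TM). fst x \<in> X}"
        proof
          fix y assume y: "y \<in> ?O"
          then have "fst y \<in> U" "\<phi> (fst y) \<in> \<phi> ` (U \<inter> X)" by (auto simp: bundle_chart_domain_def bundle_chart_def)
          then have "fst y \<in> X" using inj_on_chart[OF c(1)] by (auto dest: inj_onD)
          moreover have "y \<in> topspace (mtop TM)"
            using y openin_subset[OF openin_chart[OF c(1)]] by (auto simp: topspace_tangent_bundle bundle_chart_domain_def)
          ultimately show "y \<in> {x \<in> topspace (mtop TM). fst x \<in> X}" by simp
        qed
        ultimately show "\<exists>T. openin (mtop TM) T \<and> x \<in> T \<and>
            T \<subseteq> {x \<in> topspace (mtop TM). fst x \<in> X}" by blast
      qed
    qed
    fix V \<psi> assume c: "(V, \<psi>) \<in> atlas M"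
    note d = bundle_atlasI[OF c]
    show "smooth_fun_on TM (fst -` V) (\<lambda>x. \<psi> (fst x))"
    proof (rule TM.smooth_fun_on_local)
      fix x assume x: "x \<in> fst -` V" "x \<in> topspace (mtop TM)"
      have "smooth_fun_on TM (bundle_chart_domain V) (\<lambda>x. fst (bundle_chart \<psi> x))"
        by (rule TM.smooth_fun_on_bounded_linear[OF bounded_linear_fst TM.openin_chart[OF d] TM.smooth_fun_on_chart[OF d]])
      then show "\<exists>W'. openin (mtop TM) W' \<and> x \<in> W' \<and> smooth_fun_on TM W' (\<lambda>x. \<psi> (fst x))"
        using TM.openin_chart[OF d] x
        by (intro exI[of _ "bundle_chart_domain V"])
          (auto simp: bundle_chart_def bundle_chart_domain_def case_prod_beta topspace_tangent_bundle)
    qed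
  qed
qed

end

section \<open>The trivialization by a frame\<close>

locale framed_tangent_bundle = framed_product M E N
  for M :: "('m, real^'n) mfd" and E and N :: "('m \<times> (real^'n), (real^'n) \<times> (real^'n)) mfd"
begin

sublocale TM: smooth_charted TM by (rule smooth_charted_tangent_bundle)

definition trivialization :: "'m \<times> (real^'n) \<Rightarrow> 'm \<times> 'm tvec" where
  "trivialization z = (fst z, E (snd z) (fst z))"

lemma trivialization_mem_chart: "(U, \<phi>) \<in> atlas M \<Longrightarrow> trivialization z \<in> bundle_chart_domain U \<longleftrightarrow> fst z \<in> U"
  by (auto simp: trivialization_def bundle_chart_domain_def intro!: frame_tangent subsetD[OF openin_subset[OF openin_chart]])

lemma bundle_chart_trivialization_smooth:
  assumes c: "(U, \<phi>) \<in> atlas M"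
  shows "smooth_fun_on N (U \<times> UNIV) (\<lambda>z. bundle_chart \<phi> (trivialization z))"
proof -
  note U = openin_chart[OF c] and UN = openin_times_UNIV[OF openin_chart[OF c]]
  note A = frame_matrix[OF framed_axioms c]
  have "smooth_fun_on N (U \<times> UNIV) (\<lambda>z. (\<phi> (fst z), matrix (\<lambda>v. dir_deriv (E v (fst z)) \<phi>) *v snd z))"
    using openin_subset[OF UN]
    by (intro N.smooth_fun_on_Pair UN N.smooth_fun_on_bilinear[OF bounded_bilinear_matrix_vector_mult]
        smooth_fun_on_fst[OF U A(3)] smooth_fun_on_fst[OF U smooth_fun_on_chart[OF c]]
        N.smooth_fun_on_subset[OF smooth_fun_on_snd])
  then show ?thesis by (simp add: bundle_chart_def trivialization_def A(1))
qed

lemma trivialization_smooth: "smooth_map N TM trivialization"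
proof (rule smooth_mapI)
  show "continuous_map (mtop N) (mtop TM) trivialization"
    unfolding mtop_tangent_bundle continuous_on_generated_topo_iff
  proof (intro conjI allI impI)
    fix X assume "X \<in> {W \<inter> \<kappa> -` S | W \<kappa> S. (W, \<kappa>) \<in> atlas TM \<and> open S}"
    then obtain W \<kappa> S where X: "X = W \<inter> \<kappa> -` S" "(W, \<kappa>) \<in> atlas TM" "open S" by blast
    obtain U \<phi> where W: "W = bundle_chart_domain U" "\<kappa> = bundle_chart \<phi>" and c: "(U, \<phi>) \<in> atlas M"
      using X(2) by (rule bundle_atlasE)
    have "openin (mtop N) ((U \<times> UNIV) \<inter> (\<lambda>z. bundle_chart \<phi> (trivialization z)) -` S)"
      by (rule N.smooth_fun_on_vimage_open[OF openin_times_UNIV[OF openin_chart[OF c]]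
            bundle_chart_trivialization_smooth[OF c] X(3)])
    moreover have "(U \<times> UNIV) \<inter> (\<lambda>z. bundle_chart \<phi> (trivialization z)) -` S =
        trivialization -` X \<inter> topspace (mtop N)"
    proof (rule Set.set_eqI)
      fix z show "z \<in> (U \<times> UNIV) \<inter> (\<lambda>z. bundle_chart \<phi> (trivialization z)) -` S \<longleftrightarrow>
          z \<in> trivialization -` X \<inter> topspace (mtop N)"
        using subsetD[OF openin_subset[OF openin_chart[OF c]], of "fst z"]
        by (auto simp: X(1) W trivialization_mem_chart[OF c] topspace_N mem_Times_iff)
    qed
    ultimately show "openin (mtop N) (trivialization -` X \<inter> topspace (mtop N))" by simp
  next
    have "trivialization ` topspace (mtop N) \<subseteq> topspace (mtop TM)"
      by (auto simp: trivialization_def topspace_tangent_bundle topspace_N frame_tangent)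
    then show "trivialization ` topspace (mtop N) \<subseteq> \<Union> {W \<inter> \<kappa> -` S | W \<kappa> S. (W, \<kappa>) \<in> atlas TM \<and> open S}"
      unfolding mtop_tangent_bundle topology_generated_by_topspace .
  qed
  fix W \<kappa> assume "(W, \<kappa>) \<in> atlas TM"
  then obtain U \<phi> where W: "W = bundle_chart_domain U" "\<kappa> = bundle_chart \<phi>" and c: "(U, \<phi>) \<in> atlas M"
    by (rule bundle_atlasE)
  have "trivialization -` W = U \<times> UNIV"
    unfolding W by (rule Set.set_eqI) (simp add: trivialization_mem_chart[OF c] mem_Times_iff)
  then show "smooth_fun_on N (trivialization -` W) (\<lambda>z. \<kappa> (trivialization z))"
    unfolding W using bundle_chart_trivialization_smooth[OF c] by simp
qed

definition inverse_trivialization :: "'m \<times> 'm tvec \<Rightarrow> 'm \<times> (real^'n)" where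
  "inverse_trivialization x = (fst x, coef (fst x) (snd x))"

lemma inverse_trivialization_smooth: "smooth_map TM N inverse_trivialization"
proof -
  have "smooth_fun_on TM (topspace (mtop TM)) (\<lambda>x. coef (fst x) (snd x))"
  proof (rule TM.smooth_fun_on_local)
    fix x assume x: "x \<in> topspace (mtop TM)"
    then have "fst x \<in> topspace (mtop M)" by (auto simp: topspace_tangent_bundle)
    then obtain U \<phi> where c: "(U, \<phi>) \<in> atlas M" "fst x \<in> U" by (rule obtain_chart)
    note d = bundle_atlasI[OF c(1)] and A = frame_matrix[OF framed_axioms c(1)]
    let ?W = "bundle_chart_domain U"
    have UM: "U \<subseteq> topspace (mtop M)" by (rule openin_subset[OF openin_chart[OF c(1)]])
    have "smooth_fun_on TM ?W (\<lambda>x. coef (fst x) (snd x))"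
    proof (rule TM.smooth_fun_on_linear_system[OF TM.openin_chart[OF d]])
      show "smooth_fun_on TM ?W (\<lambda>x. matrix (\<lambda>v. dir_deriv (E v (fst x)) \<phi>))"
        by (rule TM.smooth_fun_on_subset[OF smooth_fun_on_compose[OF TM.charted_axioms charted_axioms
                smooth_map_bundle_projection openin_chart[OF c(1)] A(3)]])
          (use UM in \<open>auto simp: bundle_chart_domain_def topspace_tangent_bundle\<close>)
      show "smooth_fun_on TM ?W (\<lambda>x. snd (bundle_chart \<phi> x))"
        by (rule TM.smooth_fun_on_bounded_linear[OF bounded_linear_snd TM.openin_chart[OF d] TM.smooth_fun_on_chart[OF d]])
      fix y assume "y \<in> ?W"
      then have y: "fst y \<in> U" "snd y \<in> tangent_space M (fst y)" by (auto simp: bundle_chart_domain_def)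
      show "invertible (matrix (\<lambda>v. dir_deriv (E v (fst y)) \<phi>))" by (rule A(2)[OF y(1)])
      show "matrix (\<lambda>v. dir_deriv (E v (fst y)) \<phi>) *v coef (fst y) (snd y) = snd (bundle_chart \<phi> y)"
        unfolding A(1) using y UM by (simp add: bundle_chart_def case_prod_beta frame_coef subset_iff)
    qed
    then show "\<exists>W'. openin (mtop TM) W' \<and> x \<in> W' \<and> smooth_fun_on TM W' (\<lambda>x. coef (fst x) (snd x))"
      using TM.openin_chart[OF d] x c(2)
      by (intro exI[of _ ?W]) (auto simp: bundle_chart_domain_def topspace_tangent_bundle)
  qed
  then show ?thesis
    unfolding inverse_trivialization_def[abs_def]
    by (intro smooth_map_to_N TM.smooth_charted_axioms smooth_map_bundle_projection
        smooth_map_to_euclidean TM.charted_axioms)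
qed

lemma inverse_trivialization: "z \<in> topspace (mtop N) \<Longrightarrow> inverse_trivialization (trivialization z) = z"
  by (simp add: inverse_trivialization_def trivialization_def coef_frame topspace_N)

lemma trivialization_diffeomorphism: "diffeomorphism N TM trivialization"
  unfolding diffeomorphism_def
proof (intro conjI exI[of _ inverse_trivialization] ballI)
  fix x assume "x \<in> topspace (mtop TM)"
  then show "trivialization (inverse_trivialization x) = x"
    by (auto simp: inverse_trivialization_def trivialization_def topspace_tangent_bundle frame_coef)
qed (rule trivialization_smooth inverse_trivialization_smooth inverse_trivialization; assumption?)+

context
  fixes z :: "'m \<times> (real^'n)"
  assumes z: "z \<in> topspace (mtop N)"
begin

text \<open>A function \<open>f\<close> on \<open>N\<close> is the pullback of its composition with the inverse trivialization.\<close>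

lemma differential_trivialization_inj:
  assumes "\<zeta> \<in> tangent_space N z" "\<zeta>' \<in> tangent_space N z"
    and eq: "differential TM trivialization z \<zeta> = differential TM trivialization z \<zeta>'"
  shows "\<zeta> = \<zeta>'"
proof
  fix f
  show "\<zeta> f = \<zeta>' f"
  proof (cases "smooth_near N z f")
    case True
    let ?g = "\<lambda>x. f (inverse_trivialization x)"
    have g: "smooth_near TM (trivialization z) ?g"
      using smooth_near_compose[OF TM.charted_axioms N.charted_axioms inverse_trivialization_smooth, of "trivialization z" f]
        smooth_map_topspace[OF trivialization_smooth z] True by (simp add: inverse_trivialization[OF z])
    then have gT: "smooth_near N z (\<lambda>y. ?g (trivialization y))"
      by (rule smooth_near_compose[OF N.charted_axioms TM.charted_axioms trivialization_smooth z])
    have "\<eta> f = differential TM trivialization z \<eta> ?g" if "\<eta> \<in> tangent_space N z" for \<eta>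
      using tangent_local[OF that True gT openin_topspace z] g
      by (simp add: inverse_trivialization differential_def o_def)
    from this[OF assms(1)] this[OF assms(2)] show ?thesis by (simp add: eq)
  next
    case False
    then show ?thesis using tangent_not_smooth[OF assms(1)] tangent_not_smooth[OF assms(2)] by simp
  qed
qed

text \<open>The projection of \<open>TM\<close> corresponds to the one of \<open>N\<close>, so the vertical vectors are those
  without \<open>E\<close>-component.\<close>

lemma vertical_iff:
  assumes \<zeta>: "\<zeta> \<in> tangent_space N z"
  shows "differential TM trivialization z \<zeta> \<in> vertical_space M (trivialization z) \<longleftrightarrow> fst (pair.coef z \<zeta>) = 0"
proof -
  let ?a = "pair.coef z \<zeta>"
  have p: "fst z \<in> topspace (mtop M)" using z by (simp add: topspace_N)
  have T: "trivialization z \<in> topspace (mtop TM)" by (rule smooth_map_topspace[OF trivialization_smooth z])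
  have "differential M fst (trivialization z) (differential TM trivialization z \<zeta>) = differential M fst z \<zeta>"
  proof
    fix f
    show "differential M fst (trivialization z) (differential TM trivialization z \<zeta>) f = differential M fst z \<zeta> f"
      using smooth_near_compose[OF TM.charted_axioms charted_axioms smooth_map_bundle_projection T, of f]
      by (simp add: differential_def o_def trivialization_def)
  qed
  also have "\<dots> = E (fst ?a) (fst z)"
    using differential_fst_pair_vector[OF p frame_tangent[OF p], of "fst ?a" "snd ?a"] pair.frame_coef[OF z \<zeta>]
    by (simp add: pair_frame_def)
  finally show ?thesis
    using differential_tangent[OF N.charted_axioms TM.charted_axioms trivialization_smooth z \<zeta>]
      frame_inj[OF p] frame_zero by (auto simp: vertical_space_def)
qed

end

end

text \<open>If the frame is parallel, then the horizontal vectors can be described in the same way.\<close>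

locale parallel_tangent_bundle = framed_tangent_bundle M E N + framed_connection M nab E + smooth_framed M E
  for M :: "('m, real^'n) mfd" and E and N :: "('m \<times> (real^'n), (real^'n) \<times> (real^'n)) mfd" and nab +
  assumes parallel: "Z \<in> vector_fields M \<Longrightarrow> nab Z (E v) = 0"
begin

text \<open>In a parallel frame, only the derivatives of the components of \<open>Y\<close> contribute to \<open>nab Z Y\<close>.\<close>

lemma parallel_at_components:
  assumes Y: "Y \<in> vector_fields M" and p: "p \<in> topspace (mtop M)"
    and par: "\<And>Z. Z \<in> vector_fields M \<Longrightarrow> nab Z Y p = 0" and w: "w \<in> tangent_space M p"
  shows "dir_deriv w (\<lambda>q. coef q (Y q)) = 0"
proof -
  let ?y = "\<lambda>q. coef q (Y q)"
  obtain u where u: "E u p = w" using frame_surj[OF p w] by blast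
  have "nab (E u) Y p = E (dir_deriv w ?y) p"
  proof
    fix h
    show "nab (E u) Y p h = E (dir_deriv w ?y) p h"
      using nab_combination_right[OF coef_smooth[OF Y] frame_field, of u p h]
      by (simp add: parallel frame_field u flip: vector_field_expansion[OF Y])
  qed
  then show ?thesis using par[OF frame_field] frame_inj[OF p] by metis
qed

text \<open>A section of the tangent bundle is the trivialization applied to the graph of its components.\<close>

lemma differential_section:
  assumes Y: "Y \<in> vector_fields M" and p: "p \<in> topspace (mtop M)" and w: "w \<in> tangent_space M p"
    and const: "dir_deriv w (\<lambda>q. coef q (Y q)) = 0"
  shows "differential TM (\<lambda>q. (q, Y q)) p w =
    differential TM trivialization (p, coef p (Y p)) (pair_vector w 0 (p, coef p (Y p)))"
proof -
  let ?y = "\<lambda>q. coef q (Y q)"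
  have sec: "(q, Y q) = trivialization (q, ?y q)" for q
    using fun_cong[OF vector_field_expansion[OF Y], of q] by (simp add: trivialization_def)
  have z: "(p, ?y p) \<in> topspace (mtop N)" using p by (simp add: topspace_N)
  have "differential TM (\<lambda>q. (q, Y q)) p w = differential TM trivialization (p, ?y p) (differential N (\<lambda>q. (q, ?y q)) p w)"
  proof
    fix f
    show "differential TM (\<lambda>q. (q, Y q)) p w f =
        differential TM trivialization (p, ?y p) (differential N (\<lambda>q. (q, ?y q)) p w) f"
      using smooth_near_compose[OF N.charted_axioms TM.charted_axioms trivialization_smooth z, of f]
      by (simp add: differential_def o_def sec)
  qed
  then show ?thesis using differential_graph[OF p w coef_smooth[OF Y] const] by simp
qed

text \<open>A section that is parallel at a point has there the same differential as the slice through the point,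
  and the slices are the parallel sections \<open>E v\<close>. So the horizontal vectors are the vectors
  \<open>(E u, 0)\<close>.\<close>

lemma horizontal_iff:
  assumes z: "z \<in> topspace (mtop N)" and \<zeta>: "\<zeta> \<in> tangent_space N z"
  shows "differential TM trivialization z \<zeta> \<in> horizontal_space M nab (trivialization z) \<longleftrightarrow> snd (pair.coef z \<zeta>) = 0"
proof
  have p: "fst z \<in> topspace (mtop M)" using z by (simp add: topspace_N)
  {
    assume "differential TM trivialization z \<zeta> \<in> horizontal_space M nab (trivialization z)"
    then obtain Y w where Y: "Y \<in> vector_fields M" "Y (fst z) = E (snd z) (fst z)"
      "\<And>Z. Z \<in> vector_fields M \<Longrightarrow> nab Z Y (fst z) = 0" and w: "w \<in> tangent_space M (fst z)"
      and eq: "differential TM trivialization z \<zeta> = differential TM (\<lambda>q. (q, Y q)) (fst z) w"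
      unfolding horizontal_space_def trivialization_def by auto
    have "coef (fst z) (Y (fst z)) = snd z" by (simp add: Y(2) coef_frame[OF p])
    then have "differential TM trivialization z \<zeta> = differential TM trivialization z (pair_vector w 0 z)"
      unfolding eq using differential_section[OF Y(1) p w parallel_at_components[OF Y(1) p Y(3) w]] by simp
    then have "\<zeta> = pair_vector w 0 z"
      by (rule differential_trivialization_inj[OF z \<zeta> pair_vector_tangent[OF p w]])
    then show "snd (pair.coef z \<zeta>) = 0" using snd_coef[OF z \<zeta>] dir_deriv_pair_vector_snd[OF p w, of 0] by simp
  }
  assume 0: "snd (pair.coef z \<zeta>) = 0"
  let ?u = "fst (pair.coef z \<zeta>)" and ?Y = "E (snd z)"
  have coef: "coef q (?Y q) = snd z" if "q \<in> topspace (mtop M)" for q by (simp add: coef_frame that)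
  have "dir_deriv (E ?u (fst z)) (\<lambda>q. coef q (?Y q)) = 0"
    by (rule parallel_at_components[OF frame_field p _ frame_tangent[OF p]]) (simp add: parallel)
  from differential_section[OF frame_field p frame_tangent[OF p] this]
  have "differential TM trivialization z (pair_vector (E ?u (fst z)) 0 z) = differential TM (\<lambda>q. (q, ?Y q)) (fst z) (E ?u (fst z))"
    by (simp add: coef[OF p])
  moreover have "pair_vector (E ?u (fst z)) 0 z = \<zeta>"
    using pair.frame_coef[OF z \<zeta>] 0 by (simp add: pair_frame_def)
  ultimately show "differential TM trivialization z \<zeta> \<in> horizontal_space M nab (trivialization z)"
    unfolding horizontal_space_def using frame_field frame_tangent[OF p] parallel
    by (auto simp: trivialization_def intro!: exI[of _ ?Y] exI[of _ "E ?u (fst z)"])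
qed

text \<open>The complex structure on the components with respect to the frame \<open>(E u, w)\<close>; the sign makes its
  square \<open>- 1\<close>.\<close>

definition swap :: "(real^'n) \<times> (real^'n) \<Rightarrow> (real^'n) \<times> (real^'n)" where
  "swap a = (- snd a, fst a)"

lemma swap_linear: "linear swap"
  by (rule linearI) (simp_all add: swap_def)

lemma swap_swap: "swap (swap a) = - a"
  by (simp add: swap_def prod_eq_iff)

lemma swaps: "swaps_vertical_horizontal M nab N trivialization (pair.constant_structure swap)"
  unfolding swaps_vertical_horizontal_def Let_def
proof (intro ballI)
  fix z assume z: "z \<in> topspace (mtop N)"
  let ?J = "pair.constant_structure swap z"
  let ?V = "{\<zeta> \<in> tangent_space N z. fst (pair.coef z \<zeta>) = 0}"
  let ?H = "{\<zeta> \<in> tangent_space N z. snd (pair.coef z \<zeta>) = 0}"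
  have J: "?J \<zeta> \<in> tangent_space N z" "pair.coef z (?J \<zeta>) = swap (pair.coef z \<zeta>)" for \<zeta>
    by (simp_all add: pair.constant_structure_def pair.coef_frame[OF z] pair.frame_tangent[OF z])
  \<comment> \<open>The inverse of \<open>J\<close> is \<open>- J\<close>.\<close>
  have inv: "\<zeta> = ?J (pair_frame (- swap (pair.coef z \<zeta>)) z)" if "\<zeta> \<in> tangent_space N z" for \<zeta>
    by (simp add: pair.constant_structure_def pair.coef_frame[OF z] linear_neg[OF swap_linear] swap_swap
        pair.frame_coef[OF z that])
  have "?J ` ?V = ?H"
  proof
    show "?J ` ?V \<subseteq> ?H" using J by (auto simp: swap_def)
    show "?H \<subseteq> ?J ` ?V"
    proof
      fix \<zeta> assume "\<zeta> \<in> ?H"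
      then show "\<zeta> \<in> ?J ` ?V"
        by (intro image_eqI[where f = ?J and x = "pair_frame (- swap (pair.coef z \<zeta>)) z"] inv)
            (auto simp: pair.coef_frame[OF z] pair.frame_tangent[OF z] swap_def)
    qed
  qed
  moreover have "?J ` ?H = ?V"
  proof
    show "?J ` ?H \<subseteq> ?V" using J by (auto simp: swap_def)
    show "?V \<subseteq> ?J ` ?H"
    proof
      fix \<zeta> assume "\<zeta> \<in> ?V"
      then show "\<zeta> \<in> ?J ` ?H"
        by (intro image_eqI[where f = ?J and x = "pair_frame (- swap (pair.coef z \<zeta>)) z"] inv)
            (auto simp: pair.coef_frame[OF z] pair.frame_tangent[OF z] swap_def)
    qed
  qed
  moreover have "{\<zeta> \<in> tangent_space N z. differential TM trivialization z \<zeta> \<in> vertical_space M (trivialization z)} = ?V"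
    using vertical_iff[OF z] by blast
  moreover have "{\<zeta> \<in> tangent_space N z. differential TM trivialization z \<zeta> \<in> horizontal_space M nab (trivialization z)} = ?H"
    using horizontal_iff[OF z] by blast
  ultimately show "?J ` {\<zeta> \<in> tangent_space N z. differential TM trivialization z \<zeta> \<in> vertical_space M (trivialization z)} =
      {\<zeta> \<in> tangent_space N z. differential TM trivialization z \<zeta> \<in> horizontal_space M nab (trivialization z)} \<and>
    ?J ` {\<zeta> \<in> tangent_space N z. differential TM trivialization z \<zeta> \<in> horizontal_space M nab (trivialization z)} =
      {\<zeta> \<in> tangent_space N z. differential TM trivialization z \<zeta> \<in> vertical_space M (trivialization z)}"
    by simp
qed

end

section \<open>The complex structure on the semidirect product\<close>

context left_invariant_structure
begin

abbreviation N :: "('g \<times> (real^'n), (real^'n) \<times> (real^'n)) mfd" where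
  "N \<equiv> prod_mfd M euclidean_mfd"

sublocale tangent: parallel_tangent_bundle M P N nab
  by unfold_locales (simp_all add: P_commute P_parallel)

lemma parallel_trivialization: "parallel_trivialization G M nab i tangent.trivialization"
  unfolding parallel_trivialization_def
proof (intro conjI allI bexI[of _ "P _"] ballI)
  show "diffeomorphism N (tangent_bundle M) tangent.trivialization" by (rule tangent.trivialization_diffeomorphism)
  show "P v \<in> vector_fields M" for v by (rule parallel.frame_field)
  show "nab Z (P v) = 0" if "Z \<in> vector_fields M" for Z v using that by (rule P_parallel)
  show "tangent.trivialization (g, v) = (g, P v g)" for g v by (simp add: tangent.trivialization_def)
  show "P v \<one>\<^bsub>G\<^esub> = inv_into (left_invariant_fields G M) i v \<one>\<^bsub>G\<^esub>" for v
    using \<theta>_inv[of "\<one>\<^bsub>G\<^esub>" v] by (simp add: P_def L_def \<theta>_one)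
qed

definition I :: "'g \<times> (real^'n) \<Rightarrow> ('g \<times> (real^'n)) tvec \<Rightarrow> ('g \<times> (real^'n)) tvec" where
  "I = tangent.pair.constant_structure tangent.swap"

lemma semidirect_translation:
  "(\<lambda>z. a \<otimes>\<^bsub>semidirect G \<theta>\<^esub> z) = (\<lambda>z. (fst a \<otimes>\<^bsub>G\<^esub> fst z, snd a + \<theta> (fst a) *v snd z))"
  by (simp add: semidirect_def case_prod_beta)

lemma fibre_map_smooth_near:
  assumes "z \<in> topspace (mtop N)"
  shows "smooth_near N z (\<lambda>z. A *v snd z)"
  using assms tangent.smooth_near_snd[of z]
  by (intro tangent.N.smooth_near_bounded_linear[OF matrix_vector_mul_bounded_linear]) (simp add: tangent.topspace_N)

lemma semidirect_translation_smooth: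
  assumes "fst a \<in> carrier G"
  shows "smooth_map N N (\<lambda>z. a \<otimes>\<^bsub>semidirect G \<theta>\<^esub> z)"
  unfolding semidirect_translation
proof (rule tangent.smooth_map_to_N[OF tangent.N.smooth_charted_axioms])
  show "smooth_map N M (\<lambda>z. fst a \<otimes>\<^bsub>G\<^esub> fst z)"
    by (rule smooth_map_compose[OF tangent.N.charted_axioms charted_axioms charted_axioms
          tangent.smooth_map_fst_N translation_smooth[OF assms]])
  show "smooth_map N euclidean_mfd (\<lambda>z. snd a + \<theta> (fst a) *v snd z)"
    by (intro smooth_map_to_euclidean tangent.N.charted_axioms tangent.N.smooth_fun_on_add openin_topspace
        tangent.N.smooth_fun_on_const tangent.smooth_fun_on_snd
        tangent.N.smooth_fun_on_bounded_linear[OF matrix_vector_mul_bounded_linear])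
qed

text \<open>Left translation by \<open>(g, v)\<close> acts on both components of the frame \<open>(P u, w)\<close> by \<open>\<theta> g\<close>:
  on the first by the transformation of parallel fields, on the second by the definition of the
  semidirect product.\<close>

lemma semidirect_translation_frame:
  assumes a: "fst a \<in> carrier G" and z: "z \<in> topspace (mtop N)"
  shows "differential N (\<lambda>z. a \<otimes>\<^bsub>semidirect G \<theta>\<^esub> z) z (tangent.pair_frame c z) =
    tangent.pair_frame (\<theta> (fst a) *v fst c, \<theta> (fst a) *v snd c) (a \<otimes>\<^bsub>semidirect G \<theta>\<^esub> z)"
proof -
  let ?l = "\<lambda>z. a \<otimes>\<^bsub>semidirect G \<theta>\<^esub> z" and ?A = "\<theta> (fst a)"
  let ?z = "a \<otimes>\<^bsub>semidirect G \<theta>\<^esub> z"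
  have l: "?l y = (fst a \<otimes>\<^bsub>G\<^esub> fst y, snd a + ?A *v snd y)" for y
    using fun_cong[OF semidirect_translation, of a y] .
  have p: "fst z \<in> carrier G" "fst z \<in> topspace (mtop M)" using z by (simp_all add: tangent.topspace_N topspace_carrier)
  have lz: "fst ?z \<in> topspace (mtop M)" using a p by (simp add: l topspace_carrier)
  obtain U \<phi> where c: "(U, \<phi>) \<in> atlas M" "fst ?z \<in> U" using lz by (rule obtain_chart)
  have s: "smooth_near M (fst a \<otimes>\<^bsub>G\<^esub> fst z) \<phi>" using smooth_near_chart[OF c] by (simp add: l)
  have sl: "smooth_near M (fst z) (\<lambda>x. \<phi> (fst a \<otimes>\<^bsub>G\<^esub> x))"
    by (rule smooth_near_compose[OF charted_axioms charted_axioms translation_smooth[OF a] p(2) s])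
  note t = tangent.pair_frame_tangent[OF p(2)]
  show ?thesis
  proof (rule tangent.tangent_eqI_N[OF _ tangent.pair_frame_tangent[OF lz] c])
    show "differential N ?l z (tangent.pair_frame c z) \<in> tangent_space N ?z"
      by (rule differential_tangent[OF tangent.N.charted_axioms tangent.N.charted_axioms semidirect_translation_smooth[OF a] z t])
    have "dir_deriv (differential N ?l z (tangent.pair_frame c z)) (\<lambda>z. \<phi> (fst z)) =
        dir_deriv (tangent.pair_frame c z) (\<lambda>y. \<phi> (fst (?l y)))"
      by (rule dir_deriv_differential[where F = ?l and p = z, OF tangent.N.charted_axioms tangent.smooth_near_fst[OF smooth_near_chart[OF c]]])
    also have "\<dots> = dir_deriv (P (fst c) (fst z)) (\<lambda>x. \<phi> (fst a \<otimes>\<^bsub>G\<^esub> x))"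
      using tangent.dir_deriv_pair_frame_fst[OF sl, of c] by (simp add: l)
    also have "\<dots> = dir_deriv (differential M (\<lambda>x. fst a \<otimes>\<^bsub>G\<^esub> x) (fst z) (P (fst c) (fst z))) \<phi>"
      using dir_deriv_differential[OF charted_axioms, of "\<lambda>x. fst a \<otimes>\<^bsub>G\<^esub> x" "fst z" \<phi>, OF s] by simp
    also have "\<dots> = dir_deriv (P (?A *v fst c) (fst ?z)) \<phi>" by (simp add: P_translate[OF a p(1)] l)
    also have "\<dots> = dir_deriv (tangent.pair_frame (?A *v fst c, ?A *v snd c) ?z) (\<lambda>z. \<phi> (fst z))"
      using tangent.dir_deriv_pair_frame_fst[OF smooth_near_chart[OF c], of "(?A *v fst c, ?A *v snd c)"] by simp
    finally show "dir_deriv (differential N ?l z (tangent.pair_frame c z)) (\<lambda>z. \<phi> (fst z)) =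
        dir_deriv (tangent.pair_frame (?A *v fst c, ?A *v snd c) ?z) (\<lambda>z. \<phi> (fst z))" .
    have "dir_deriv (differential N ?l z (tangent.pair_frame c z)) snd =
        dir_deriv (tangent.pair_frame c z) (\<lambda>y. snd (?l y))"
      by (rule dir_deriv_differential[where F = ?l and p = z, OF tangent.N.charted_axioms tangent.smooth_near_snd[OF lz]])
    also have "\<dots> = dir_deriv (tangent.pair_frame c z) (\<lambda>y. snd a + ?A *v snd y)" by (simp add: l)
    also have "\<dots> = dir_deriv (tangent.pair_frame c z) (\<lambda>y. snd a) + dir_deriv (tangent.pair_frame c z) (\<lambda>y. ?A *v snd y)"
      by (rule tangent.N.dir_deriv_add[OF t tangent.N.smooth_near_const[OF z] fibre_map_smooth_near[OF z]])
    also have "\<dots> = ?A *v snd c"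
      using tangent.N.dir_deriv_bounded_linear[OF matrix_vector_mul_bounded_linear t tangent.smooth_near_snd[OF p(2)]]
      by (simp add: tangent.N.dir_deriv_const[OF t] tangent.dir_deriv_pair_frame_snd[OF p(2)])
    also have "\<dots> = dir_deriv (tangent.pair_frame (?A *v fst c, ?A *v snd c) ?z) snd"
      by (simp add: tangent.dir_deriv_pair_frame_snd[OF lz])
    finally show "dir_deriv (differential N ?l z (tangent.pair_frame c z)) snd =
        dir_deriv (tangent.pair_frame (?A *v fst c, ?A *v snd c) ?z) snd" .
  qed
qed

lemma I_left_invariant: "left_invariant_endomorphism (semidirect G \<theta>) N I"
  unfolding left_invariant_endomorphism_def
proof (intro ballI)
  fix a z \<zeta> assume "a \<in> carrier (semidirect G \<theta>)" "z \<in> carrier (semidirect G \<theta>)" and \<zeta>: "\<zeta> \<in> tangent_space N z"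
  then have a: "fst a \<in> carrier G" and z: "z \<in> topspace (mtop N)"
    by (auto simp: semidirect_def tangent.topspace_N topspace_carrier)
  have lz: "a \<otimes>\<^bsub>semidirect G \<theta>\<^esub> z \<in> topspace (mtop N)"
    by (rule smooth_map_topspace[OF semidirect_translation_smooth[OF a] z])
  obtain c where c: "tangent.pair_frame c z = \<zeta>" using tangent.pair.frame_surj[OF z \<zeta>] by blast
  show "differential N (\<lambda>x. a \<otimes>\<^bsub>semidirect G \<theta>\<^esub> x) z (I z \<zeta>) =
      I (a \<otimes>\<^bsub>semidirect G \<theta>\<^esub> z) (differential N (\<lambda>x. a \<otimes>\<^bsub>semidirect G \<theta>\<^esub> x) z \<zeta>)"
    unfolding c[symmetric] semidirect_translation_frame[OF a z] I_def tangent.pair.constant_structure_def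
      tangent.pair.coef_frame[OF z] tangent.pair.coef_frame[OF lz]
    by (simp add: tangent.swap_def linear_neg[OF matrix_vector_mul_linear])
qed

end

theorem theorem1p3:
  fixes G :: "'g monoid"
    and M :: "('g, real^'n) mfd"
    and nab :: "'g connection"
    and i :: "'g vfield \<Rightarrow> real^'n"
    and rho :: "'g \<Rightarrow> (real^'n^'n) \<times> (real^'n)"
    and \<theta> :: "'g \<Rightarrow> real^'n^'n"
  assumes "lie_group G M"
    and "simply_connected_space (mtop M)"
    and "left_invariant_affine_structure G M nab"
    and "lie_algebra_coordinates G M i"
    and "corresponding_affine_action G M nab i rho"
    and "\<theta> = fst \<circ> rho"
  shows "\<exists>T I. parallel_trivialization G M nab i T \<and>
    almost_complex_structure (prod_mfd M euclidean_mfd) I \<and>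
    integrable_structure (prod_mfd M euclidean_mfd) I \<and>
    left_invariant_endomorphism (semidirect G \<theta>) (prod_mfd M euclidean_mfd) I \<and>
    swaps_vertical_horizontal M nab (prod_mfd M euclidean_mfd) T I"
proof -
  interpret left_invariant_structure G M nab i rho
    using assms(1,3-5) by unfold_locales
  have \<theta>: "\<theta> = left_invariant_structure.\<theta> rho"
    using assms(6) by (simp add: \<theta>_def)
  show ?thesis
    unfolding \<theta>
  proof (intro exI conjI)
    show "parallel_trivialization G M nab i tangent.trivialization" by (rule parallel_trivialization)
    show "almost_complex_structure (prod_mfd M euclidean_mfd) I"
      unfolding I_def by (rule tangent.pair.almost_complex_constant_structure[OF tangent.swap_linear tangent.swap_swap])
    show "integrable_structure (prod_mfd M euclidean_mfd) I"
      unfolding I_def by (rule tangent.pair.integrable_constant_structure[OF tangent.swap_linear tangent.swap_swap])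
    show "left_invariant_endomorphism (semidirect G (left_invariant_structure.\<theta> rho)) (prod_mfd M euclidean_mfd) I"
      by (rule I_left_invariant)
    show "swaps_vertical_horizontal M nab (prod_mfd M euclidean_mfd) tangent.trivialization I"
      unfolding I_def by (rule tangent.swaps)
  qed
qed

end
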